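(* Let $d\ge2$ be an integer and $0<m_0\le M_0<\infty$. There exists a constant $C_{d,m_0,M_0}>0$, depending only on $d$, $m_0$ and $M_0$, such that for every $n\ge2$, every distribution $P$ on $[0,1]^d$ with a Lebesgue density $p_0$ satisfying $m_0\le\inf_{x\in[0,1]^d}p_0(x)\le\sup_{x\in[0,1]^d}p_0(x)\le M_0$, and every measurable function $f_0:[0,1]^d\to\mathbb{R}$, \[ R(\hat f_n,f_0)\le\inf_{k\in\mathbb{N}}\biggl\{\inf_{f\in\mathcal{F}_d^{(k)}}\|f-f_0\|_{L_2(P)}^2+C_{d,m_0,M_0}\Bigl(\frac kn\Bigr)^{2/d}\log_+^{2\gamma_d}\Bigl(\frac nk\Bigr)\biggr\}. \]
   Context: $\mathcal{F}_d$ is the class of $f:[0,1]^d\to\mathbb{R}$ with $f(x)\le f(x')$ whenever $x_j\le x_j'$ for all $j=1,\ldots,d$. A hyperrectangle is a set $\prod_{j=1}^dI_j$ with each $I_j$ an interval. $\mathcal{F}_d^{(k)}$ is the class of $f\in\mathcal{F}_d$ for which there is a partition $[0,1]^d=\bigsqcup_{\ell=1}^kR_\ell$ such that the closure of each $R_\ell$ is a hyperrectangle and $f$ is constant on each $R_\ell$. $\|g\|_{L_2(P)}^2:=\int g^2\,\mathrm{d}P$ (possibly $+\infty$). $\gamma_2:=9/2$, $\gamma_d:=(d^2+d+1)/2$ for $d\ge3$, and $\log_+(x):=\log(\max(x,e))$. Model: $X_1,\ldots,X_n$ are i.i.d. from $P$, $\epsilon_1,\ldots,\epsilon_n$ are i.i.d.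 $N(0,1)$ independent of the $X_i$, and $Y_i=f_0(X_i)+\epsilon_i$. The least squares estimator is $\hat f_n\in\arg\min_{f\in\mathcal{F}_d}\sum_{i=1}^n\{Y_i-f(X_i)\}^2$ (its values at $X_1,\ldots,X_n$ are uniquely determined), and $R(\hat f_n,f_0):=\mathbb{E}\bigl[\frac1n\sum_{i=1}^n\{\hat f_n(X_i)-f_0(X_i)\}^2\bigr]$. *)

theory Defs
  imports "HOL-Probability.Probability"
begin

section \<open>Isotonic functions on the unit cube\<close>

text \<open>The order on \<open>real ^ 'd\<close> is the componentwise one. All functions on the cube are
  represented by total functions, of which only the values on the cube matter.\<close>

abbreviation unit_cube :: "(real ^ 'd) set" where
  "unit_cube \<equiv> cbox 0 1"

definition isotonic :: "((real ^ 'd) \<Rightarrow> real) set" where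
  "isotonic = {f. mono_on unit_cube f}"

definition hyperrectangle :: "(real ^ 'd) set \<Rightarrow> bool" where
  "hyperrectangle S \<longleftrightarrow>
     (\<exists>I :: 'd \<Rightarrow> real set. (\<forall>j. is_interval (I j)) \<and> S = {x. \<forall>j. x $ j \<in> I j})"

definition isotonic_pieces :: "nat \<Rightarrow> ((real ^ 'd) \<Rightarrow> real) set" where
  "isotonic_pieces k = {f \<in> isotonic. \<exists>R :: nat \<Rightarrow> (real ^ 'd) set.
     disjoint_family_on R {1..k} \<and> (\<Union>l\<in>{1..k}. R l) = unit_cube \<and>
     (\<forall>l\<in>{1..k}. hyperrectangle (closure (R l)) \<and> f constant_on R l)}"


section \<open>Norm, exponent and logarithm\<close>

text \<open>Elements of \<open>isotonic_pieces k\<close> need not be Borel measurable (on the boundaries of the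
  pieces), but they agree with Borel functions outside a Lebesgue null set. Since
  \<open>nn_integral (completion P) g = nn_integral P g\<close> holds for every \<open>g\<close>
  (\<open>nn_integral_completion\<close>), the integral below is the usual one for them as well.\<close>

definition L2_norm_sq :: "'a measure \<Rightarrow> ('a \<Rightarrow> real) \<Rightarrow> ennreal" where
  "L2_norm_sq P g = (\<integral>\<^sup>+ x. ennreal ((g x)\<^sup>2) \<partial>P)"

definition gamma_exponent :: "nat \<Rightarrow> real" where
  "gamma_exponent d = (if d = 2 then 9 / 2 else ((real d)\<^sup>2 + real d + 1) / 2)"

definition log_plus :: "real \<Rightarrow> real" where
  "log_plus x = ln (max x (exp 1))"


section \<open>The regression model\<close>

definition cube_density :: "(real ^ 'd) measure \<Rightarrow> ((real ^ 'd) \<Rightarrow> real) \<Rightarrow> bool" where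
  "cube_density P p \<longleftrightarrow>
     p \<in> borel_measurable (restrict_space lborel unit_cube) \<and> (\<forall>x\<in>unit_cube. 0 \<le> p x) \<and>
     P = density (restrict_space lborel unit_cube) (\<lambda>x. ennreal (p x)) \<and> prob_space P"

abbreviation std_normal :: "real measure" where
  "std_normal \<equiv> density lborel (\<lambda>x. ennreal (std_normal_density x))"

text \<open>The joint law of the design points and the errors, indexed by \<open>0, \<dots>, n - 1\<close>.\<close>

definition sample_law ::
    "(real ^ 'd) measure \<Rightarrow> nat \<Rightarrow> ((nat \<Rightarrow> real ^ 'd) \<times> (nat \<Rightarrow> real)) measure" where
  "sample_law P n = (\<Pi>\<^sub>M i\<in>{..<n}. P) \<Otimes>\<^sub>M (\<Pi>\<^sub>M i\<in>{..<n}. std_normal)"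

text \<open>This is the law of the sample on any underlying probability space.\<close>

lemma (in prob_space) distr_sample:
  fixes X :: "nat \<Rightarrow> 'a \<Rightarrow> real ^ 'd" and e :: "nat \<Rightarrow> 'a \<Rightarrow> real"
  assumes "n > 0"
    and X: "indep_vars (\<lambda>_. P) X {..<n}" "\<And>i. i < n \<Longrightarrow> distr M P (X i) = P"
    and e: "indep_vars (\<lambda>_. borel) e {..<n}" "\<And>i. i < n \<Longrightarrow> distr M borel (e i) = std_normal"
    and Xe: "indep_set {(\<lambda>w. \<lambda>i\<in>{..<n}. X i w) -` A \<inter> space M | A. A \<in> sets (\<Pi>\<^sub>M i\<in>{..<n}. P)}
                       {(\<lambda>w. \<lambda>i\<in>{..<n}. e i w) -` B \<inter> space M | B. B \<in> sets (\<Pi>\<^sub>M i\<in>{..<n}. borel)}"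
  shows "distr M (sample_law P n) (\<lambda>w. (\<lambda>i\<in>{..<n}. X i w, \<lambda>i\<in>{..<n}. e i w)) = sample_law P n"
proof -
  have ne: "{..<n} \<noteq> {}"
    using \<open>n > 0\<close> by auto
  have "distr M (\<Pi>\<^sub>M i\<in>{..<n}. P) (\<lambda>w. \<lambda>i\<in>{..<n}. X i w) = (\<Pi>\<^sub>M i\<in>{..<n}. distr M P (X i))"
    using X(1) indep_vars_iff_distr_eq_PiM'[OF ne, where M' = "\<lambda>_. P" and X = X]
    by (auto simp: indep_vars_def)
  also have "\<dots> = (\<Pi>\<^sub>M i\<in>{..<n}. P)"
    by (rule PiM_cong) (use X(2) in auto)
  finally have 1: "distr M (\<Pi>\<^sub>M i\<in>{..<n}. P) (\<lambda>w. \<lambda>i\<in>{..<n}. X i w) = (\<Pi>\<^sub>M i\<in>{..<n}. P)" .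
  have "distr M (\<Pi>\<^sub>M i\<in>{..<n}. borel) (\<lambda>w. \<lambda>i\<in>{..<n}. e i w)
      = (\<Pi>\<^sub>M i\<in>{..<n}. distr M borel (e i))"
    using e(1) indep_vars_iff_distr_eq_PiM'[OF ne, where M' = "\<lambda>_. borel" and X = e]
    by (auto simp: indep_vars_def)
  also have "\<dots> = (\<Pi>\<^sub>M i\<in>{..<n}. std_normal)"
    by (rule PiM_cong) (use e(2) in auto)
  finally have 2: "distr M (\<Pi>\<^sub>M i\<in>{..<n}. borel) (\<lambda>w. \<lambda>i\<in>{..<n}. e i w)
      = (\<Pi>\<^sub>M i\<in>{..<n}. std_normal)" .
  have mX: "(\<lambda>w. \<lambda>i\<in>{..<n}. X i w) \<in> measurable M (\<Pi>\<^sub>M i\<in>{..<n}. P)"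
    by (rule measurable_restrict) (use X(1) in \<open>auto simp: indep_vars_def\<close>)
  have "(\<lambda>w. \<lambda>i\<in>{..<n}. e i w) \<in> measurable M (\<Pi>\<^sub>M i\<in>{..<n}. borel)"
    by (rule measurable_restrict) (use e(1) in \<open>auto simp: indep_vars_def\<close>)
  also have "\<dots> = measurable M (\<Pi>\<^sub>M i\<in>{..<n}. std_normal)"
    by (intro measurable_cong_sets sets_PiM_cong) auto
  finally have me: "(\<lambda>w. \<lambda>i\<in>{..<n}. e i w) \<in> measurable M (\<Pi>\<^sub>M i\<in>{..<n}. std_normal)" .
  have sets_e: "sets (\<Pi>\<^sub>M i\<in>{..<n}. std_normal) = sets (\<Pi>\<^sub>M i\<in>{..<n}. (borel :: real measure))"
    by (rule sets_PiM_cong) auto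
  have 3: "distr M (\<Pi>\<^sub>M i\<in>{..<n}. std_normal) (\<lambda>w. \<lambda>i\<in>{..<n}. e i w) = (\<Pi>\<^sub>M i\<in>{..<n}. std_normal)"
    using 2 by (simp add: distr_cong[OF refl sets_e refl])
  have pX: "prob_space (\<Pi>\<^sub>M i\<in>{..<n}. P)"
    using prob_space_distr[OF mX] 1 by simp
  have pe: "prob_space (\<Pi>\<^sub>M i\<in>{..<n}. std_normal)"
    using prob_space_distr[OF me] 3 by simp
  interpret pX: prob_space "\<Pi>\<^sub>M i\<in>{..<n}. P" by (rule pX)
  interpret pe: prob_space "\<Pi>\<^sub>M i\<in>{..<n}. std_normal" by (rule pe)
  have "(\<Pi>\<^sub>M i\<in>{..<n}. P) \<Otimes>\<^sub>M (\<Pi>\<^sub>M i\<in>{..<n}. std_normal) =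
    distr M (sample_law P n) (\<lambda>w. (\<lambda>i\<in>{..<n}. X i w, \<lambda>i\<in>{..<n}. e i w))"
  proof (rule pair_measure_eqI)
    fix A B
    assume A: "A \<in> sets (\<Pi>\<^sub>M i\<in>{..<n}. P)" and B: "B \<in> sets (\<Pi>\<^sub>M i\<in>{..<n}. std_normal)"
    define A' where "A' = (\<lambda>w. \<lambda>i\<in>{..<n}. X i w) -` A \<inter> space M"
    define B' where "B' = (\<lambda>w. \<lambda>i\<in>{..<n}. e i w) -` B \<inter> space M"
    have "prob (A' \<inter> B') = prob A' * prob B'"
      by (rule indep_setD[OF Xe]) (use A B sets_e in \<open>auto simp: A'_def B'_def\<close>)
    then have "emeasure M (A' \<inter> B') = emeasure M A' * emeasure M B'"
      by (simp add: emeasure_eq_measure ennreal_mult)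
    moreover have "emeasure (\<Pi>\<^sub>M i\<in>{..<n}. P) A = emeasure M A'"
      by (subst 1[symmetric]) (simp add: emeasure_distr[OF mX A] A'_def)
    moreover have "emeasure (\<Pi>\<^sub>M i\<in>{..<n}. std_normal) B = emeasure M B'"
      by (subst 3[symmetric]) (simp add: emeasure_distr[OF me B] B'_def)
    moreover have "emeasure (distr M (sample_law P n) (\<lambda>w. (\<lambda>i\<in>{..<n}. X i w, \<lambda>i\<in>{..<n}. e i w)))
        (A \<times> B) = emeasure M (A' \<inter> B')"
    proof (subst emeasure_distr)
      show "(\<lambda>w. (\<lambda>i\<in>{..<n}. X i w, \<lambda>i\<in>{..<n}. e i w)) \<in> measurable M (sample_law P n)"
        unfolding sample_law_def by (rule measurable_Pair[OF mX me])
      show "A \<times> B \<in> sets (sample_law P n)"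
        unfolding sample_law_def by (rule pair_measureI[OF A B])
      show "emeasure M ((\<lambda>w. (\<lambda>i\<in>{..<n}. X i w, \<lambda>i\<in>{..<n}. e i w)) -` (A \<times> B) \<inter> space M)
          = emeasure M (A' \<inter> B')"
        by (rule arg_cong[where f = "emeasure M"]) (auto simp: A'_def B'_def)
    qed
    ultimately show "emeasure (\<Pi>\<^sub>M i\<in>{..<n}. P) A * emeasure (\<Pi>\<^sub>M i\<in>{..<n}. std_normal) B =
      emeasure (distr M (sample_law P n) (\<lambda>w. (\<lambda>i\<in>{..<n}. X i w, \<lambda>i\<in>{..<n}. e i w))) (A \<times> B)"
      by simp
  qed (unfold_locales, simp add: sample_law_def)
  then show ?thesis
    by (simp add: sample_law_def)
qed

text \<open>An estimator maps the data \<open>x\<^sub>i\<close>, \<open>y\<^sub>i\<close> (\<open>i < n\<close>) to a function. The minimiser is unique only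
  at the design points, so a least squares estimator is any selection of minimisers.\<close>

type_synonym 'd estimator = "(nat \<Rightarrow> real ^ 'd) \<Rightarrow> (nat \<Rightarrow> real) \<Rightarrow> ((real ^ 'd) \<Rightarrow> real)"

definition least_squares_estimator :: "nat \<Rightarrow> 'd::finite estimator \<Rightarrow> bool" where
  "least_squares_estimator n fhat \<longleftrightarrow> (\<forall>x y. (\<forall>i<n. x i \<in> unit_cube) \<longrightarrow>
     is_arg_min (\<lambda>f. \<Sum>i<n. (y i - f (x i))\<^sup>2) (\<lambda>f. f \<in> isotonic) (fhat x y))"

definition risk ::
    "(real ^ 'd) measure \<Rightarrow> nat \<Rightarrow> 'd::finite estimator \<Rightarrow> ((real ^ 'd) \<Rightarrow> real) \<Rightarrow> ennreal" where
  "risk P n fhat f0 = (\<integral>\<^sup>+ (x, e).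
     (let y = (\<lambda>i. f0 (x i) + e i) in
      ennreal ((\<Sum>i<n. (fhat x y (x i) - f0 (x i))\<^sup>2) / real n)) \<partial>sample_law P n)"

end

theory Submission
  imports Defs
begin

text \<open>By convexity, the loss of the estimator at a piecewise constant \<open>f\<close> exceeds that of \<open>f\<close> by at most
  \<open>2 \<langle>e, h\<rangle> - |h|\<^sup>2\<close>, where \<open>h\<close> is isotonic on every piece. The positive part of \<open>h\<close> at \<open>x\<close> is at most
  \<open>|h|\<close> divided by the root of the number of design points in any box with lower corner \<open>x\<close> on which \<open>f\<close>
  is constant. So the points are grouped into dyadic cells shaped like a largest such box, shifted
  copies of the cells carry the norm of \<open>h\<close>, and within a cell a chaining along dyadic subcells bounds
  the noise. Choosing boxes of maximal volume makes the shifted cells overlap boundedly often, even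
  though the closures of the pieces may overlap. The cells of small volume cover little: near the
  upper corner of a piece they form a hyperbolic region, and in pieces that are large compared to
  it they have low density, hence small total volume. The negative part of \<open>h\<close> is reduced to the
  positive one by reflecting the cube.\<close>

section \<open>Sets of low density in boxes\<close>

text \<open>No bound on the estimator is available, because \<open>f0\<close> is an arbitrary
  measurable function. So the noise cannot be controlled by a supremum over a bounded class.
  Instead, the noise in a cell is compared with the maximum of \<open>h\<close> there, and the
  square of this maximum times the number of points in the shifted cell is absorbed by the quadratic
  term that convexity supplies. What remains is a sum of squared chaining bounds divided by counts,
  free of \<open>h\<close>. The rate arises as follows. Up to logarithms, a cell with
  \<open>lam\<close> expected points costs \<open>lam powr (1 - 2 / d)\<close>, and about
  \<open>k\<close> cells have \<open>lam = n / k\<close>, which gives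
  \<open>n * (k / n) powr (2 / d)\<close> in total. The logarithm enters with the power
  \<open>d + 5\<close>: \<open>d\<close> from the volume of the hyperbolic corners, 4 from the
  chaining over logarithmically many levels, and 1 from the number of cell sizes. This is at most
  \<open>2 * gamma_exponent d\<close> for all \<open>d \<ge> 2\<close>, which leaves room for crude
  steps.\<close>

lemma minimal_subcover:
  fixes S :: "'l \<Rightarrow> 'a set"
  assumes "finite L"
  obtains L' where "L' \<subseteq> L" "(\<Union>l\<in>L'. S l) = (\<Union>l\<in>L. S l)"
    "\<And>l. l \<in> L' \<Longrightarrow> (\<Union>i\<in>L' - {l}. S i) \<noteq> (\<Union>i\<in>L. S i)"
proof -
  define Q where "Q = (\<lambda>L'. L' \<subseteq> L \<and> (\<Union>l\<in>L'. S l) = (\<Union>l\<in>L. S l))"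
  have "Q L" by (simp add: Q_def)
  then obtain L' where L': "Q L'" "\<And>K. Q K \<Longrightarrow> card L' \<le> card K"
    using ex_has_least_nat[of Q L card] by auto
  have fin: "finite L'" using L'(1) assms by (auto simp: Q_def intro: finite_subset)
  have "(\<Union>i\<in>L' - {l}. S i) \<noteq> (\<Union>i\<in>L. S i)" if "l \<in> L'" for l
  proof
    assume "(\<Union>i\<in>L' - {l}. S i) = (\<Union>i\<in>L. S i)"
    then have "Q (L' - {l})" using L'(1) by (auto simp: Q_def)
    then have "card L' \<le> card (L' - {l})" by (rule L'(2))
    moreover have "card (L' - {l}) < card L'" using fin that by (rule card_Diff1_less)
    ultimately show False by simp
  qed
  then show ?thesis using that[of L'] L'(1) by (auto simp: Q_def)
qed

text \<open>Among the intervals through \<open>x\<close>, the one reaching farthest left and the one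
  reaching farthest right together cover all the others, so irredundancy leaves at most these
  two.\<close>

lemma interval_subcover_overlap:
  fixes a b :: "'l \<Rightarrow> real"
  assumes fin: "finite L"
    and irr: "\<And>l. l \<in> L \<Longrightarrow> (\<Union>i\<in>L - {l}. {a i<..<b i}) \<noteq> (\<Union>i\<in>L. {a i<..<b i})"
  shows "card {l \<in> L. a l < x \<and> x < b l} \<le> 2"
proof (cases "{l \<in> L. a l < x \<and> x < b l} = {}")
  case False
  let ?X = "{l \<in> L. a l < x \<and> x < b l}"
  have finX: "finite ?X" using fin by simp
  obtain p where p: "p \<in> ?X" "\<And>l. l \<in> ?X \<Longrightarrow> a p \<le> a l"
  proof -
    have "Min (a ` ?X) \<in> a ` ?X" using finX False by (intro Min_in) auto
    then obtain p where "p \<in> ?X" "a p = Min (a ` ?X)" by force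
    then show ?thesis using that[of p] finX by simp
  qed
  obtain q where q: "q \<in> ?X" "\<And>l. l \<in> ?X \<Longrightarrow> b l \<le> b q"
  proof -
    have "Max (b ` ?X) \<in> b ` ?X" using finX False by (intro Max_in) auto
    then obtain q where "q \<in> ?X" "b q = Max (b ` ?X)" by force
    then show ?thesis using that[of q] finX by simp
  qed
  have "?X \<subseteq> {p, q}"
  proof
    fix l assume l: "l \<in> ?X"
    show "l \<in> {p, q}"
    proof (rule ccontr)
      assume n: "l \<notin> {p, q}"
      have "{a l<..<b l} \<subseteq> {a p<..<b p} \<union> {a q<..<b q}"
      proof
        fix y assume y: "y \<in> {a l<..<b l}"
        show "y \<in> {a p<..<b p} \<union> {a q<..<b q}"
        proof (cases "y \<le> x")
          case True
          then show ?thesis using p(1) p(2)[OF l] y by auto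
        next
          case False
          then show ?thesis using q(1) q(2)[OF l] y by auto
        qed
      qed
      moreover have "p \<in> L - {l}" "q \<in> L - {l}" using n p q by auto
      ultimately have "(\<Union>i\<in>L - {l}. {a i<..<b i}) = (\<Union>i\<in>L. {a i<..<b i})" by blast
      then show False using irr l by blast
    qed
  qed
  then have "card ?X \<le> card {p, q}" by (intro card_mono) auto
  also have "\<dots> \<le> 2" by (simp add: card_insert_if)
  finally show ?thesis .
next
  case True
  then show ?thesis by (simp only: card.empty)
qed

text \<open>An irredundant subfamily covers every point at most twice, so its lengths add up to at
  most 2, however often the original intervals overlap.\<close>

lemma interval_family_density:
  fixes a b :: "'l \<Rightarrow> real"
  assumes fin: "finite L" and E: "E \<in> sets lborel"
    and sub: "\<And>l. l \<in> L \<Longrightarrow> {a l<..<b l} \<subseteq> {0..1}"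
    and dens: "\<And>l. l \<in> L \<Longrightarrow>
      emeasure lborel (E \<inter> {a l<..<b l}) \<le> ennreal s * emeasure lborel {a l<..<b l}"
  shows "emeasure lborel (E \<inter> (\<Union>l\<in>L. {a l<..<b l})) \<le> 2 * ennreal s"
proof -
  obtain L' where L': "L' \<subseteq> L" "(\<Union>l\<in>L'. {a l<..<b l}) = (\<Union>l\<in>L. {a l<..<b l})"
    "\<And>l. l \<in> L' \<Longrightarrow> (\<Union>i\<in>L' - {l}. {a i<..<b i}) \<noteq> (\<Union>i\<in>L. {a i<..<b i})"
    by (rule minimal_subcover[OF fin, of "\<lambda>l. {a l<..<b l}"]) blast
  have fin': "finite L'" using L'(1) fin by (rule finite_subset)
  have ov: "card {l \<in> L'. a l < x \<and> x < b l} \<le> 2" for x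
    by (rule interval_subcover_overlap[OF fin']) (use L' in auto)
  have "emeasure lborel (E \<inter> (\<Union>l\<in>L. {a l<..<b l})) = emeasure lborel (\<Union>l\<in>L'. E \<inter> {a l<..<b l})"
    using L'(2) by (metis Int_UN_distrib)
  also have "\<dots> \<le> (\<Sum>l\<in>L'. emeasure lborel (E \<inter> {a l<..<b l}))"
    by (rule emeasure_subadditive_finite) (use fin' E in auto)
  also have "\<dots> \<le> (\<Sum>l\<in>L'. ennreal s * emeasure lborel {a l<..<b l})"
    by (intro sum_mono dens) (use L' in auto)
  also have "\<dots> = ennreal s * (\<Sum>l\<in>L'. \<integral>\<^sup>+x. indicator {a l<..<b l} x \<partial>lborel)"
    by (simp add: sum_distrib_left)
  also have "(\<Sum>l\<in>L'. \<integral>\<^sup>+x. indicator {a l<..<b l} x \<partial>lborel)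
      = (\<integral>\<^sup>+x. (\<Sum>l\<in>L'. indicator {a l<..<b l} x) \<partial>lborel)"
    by (rule nn_integral_sum[symmetric]) simp
  also have "\<dots> \<le> (\<integral>\<^sup>+x. 2 * indicator {0..1::real} x \<partial>lborel)"
  proof (rule nn_integral_mono)
    fix x :: real
    have "(\<Sum>l\<in>L'. indicator {a l<..<b l} x) = (of_nat (card {l \<in> L'. a l < x \<and> x < b l}) :: ennreal)"
      using fin' by (simp add: indicator_def sum.If_cases Int_def conj_commute)
    also have "\<dots> \<le> 2 * indicator {0..1::real} x"
    proof (cases "x \<in> {0..1}")
      case True
      have "(of_nat (card {l \<in> L'. a l < x \<and> x < b l}) :: ennreal) \<le> of_nat 2"
        by (rule of_nat_mono) (rule ov)
      then show ?thesis using True by simp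
    next
      case False
      then have "{l \<in> L'. a l < x \<and> x < b l} = {}" 
      proof (intro equals0I)
        fix l assume "l \<in> {l \<in> L'. a l < x \<and> x < b l}"
        then have "l \<in> L" "x \<in> {a l<..<b l}" using L'(1) by auto
        then show False using sub False by blast
      qed
      then show ?thesis by (simp only: card.empty) simp
    qed
    finally show "(\<Sum>l\<in>L'. indicator {a l<..<b l} x) \<le> (2 * indicator {0..1::real} x :: ennreal)" .
  qed
  also have "\<dots> = 2" by (simp add: nn_integral_cmult)
  finally show ?thesis by (simp add: mult.commute[of 2] mult_left_mono del: nn_integral_indicator)
qed

text \<open>In dimension two and higher, boxes of arbitrary side ratios have in general no subcover
  of bounded overlap, so the one-dimensional argument is iterated over the coordinates. Each step
  splits the density into its square root for the fibres and its square root for the base, whence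
  the exponent \<open>1 / 2 ^ card I\<close>. The loss is harmless, because the density will be a
  high power of \<open>k / n\<close> up to a constant.\<close>

lemma low_density_PiM:
  fixes a b :: "'l \<Rightarrow> 'i \<Rightarrow> real" and E :: "('i \<Rightarrow> real) set"
  assumes "finite I" "finite L" "E \<in> sets (PiM I (\<lambda>_. lborel))" "E \<subseteq> PiE I (\<lambda>_. {0..1})"
    and "\<And>l i. l \<in> L \<Longrightarrow> i \<in> I \<Longrightarrow> {a l i<..<b l i} \<subseteq> {0..1}"
    and "\<And>l. l \<in> L \<Longrightarrow> emeasure (PiM I (\<lambda>_. lborel)) (E \<inter> (\<Pi>\<^sub>E i\<in>I. {a l i<..<b l i}))
        \<le> ennreal \<theta> * emeasure (PiM I (\<lambda>_. lborel)) (\<Pi>\<^sub>E i\<in>I. {a l i<..<b l i})"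
    and "0 < \<theta>" "\<theta> \<le> 1"
  shows "emeasure (PiM I (\<lambda>_. lborel)) (E \<inter> (\<Union>l\<in>L. \<Pi>\<^sub>E i\<in>I. {a l i<..<b l i}))
    \<le> ennreal ((2 * real (card I) + 1) * \<theta> powr (1 / 2 ^ card I))"
  using assms
proof (induction I arbitrary: L E \<theta> rule: finite_induct)
  case empty
  have sp: "(\<Pi>\<^sub>E i\<in>{}. {a l i<..<b l i}) = {\<lambda>_. undefined}" for l
    by simp
  show ?case
  proof (cases "L = {}")
    case True
    then show ?thesis by simp
  next
    case False
    then obtain l where l: "l \<in> L" by auto
    have "E \<inter> (\<Union>l\<in>L. \<Pi>\<^sub>E i\<in>{}. {a l i<..<b l i}) = E \<inter> (\<Pi>\<^sub>E i\<in>{}. {a l i<..<b l i})"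
      using l by auto
    then show ?thesis using empty.prems(5)[OF l] \<open>0 < \<theta>\<close> by simp
  qed
next
  case (insert i I)
  interpret psf: product_sigma_finite "\<lambda>_::'i. lborel :: real measure" ..
  interpret fI: finite_product_sigma_finite "\<lambda>_::'i. lborel :: real measure" I
    by standard (rule insert.hyps)
  let ?M = "PiM I (\<lambda>_. lborel :: real measure)"
  let ?N = "PiM (insert i I) (\<lambda>_. lborel :: real measure)"
  interpret ps: pair_sigma_finite ?M "lborel :: real measure" ..
  define s where "s = sqrt \<theta>"
  have s: "0 < s" "s \<le> 1" "\<theta> = s * s" using insert.prems by (auto simp: s_def)
  define A' where "A' l = (\<Pi>\<^sub>E j\<in>I. {a l j<..<b l j})" for l
  define J where "J l = {a l i<..<b l i}" for l
  have E[measurable]: "E \<in> sets ?N" by (rule insert.prems)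
  have A'[measurable]: "A' l \<in> sets ?M" for l
    unfolding A'_def by (rule sets_PiM_I_finite) (use insert.hyps in auto)
  have J[measurable]: "J l \<in> sets lborel" for l by (simp add: J_def)
  have upd[measurable]: "(\<lambda>(y, t). y(i := t)) \<in> measurable (?M \<Otimes>\<^sub>M lborel) ?N"
    by (rule measurable_add_dim)
  define F where "F = (\<lambda>(y, t). (indicator E (y(i := t)) :: ennreal))"
  have F[measurable]: "F \<in> borel_measurable (?M \<Otimes>\<^sub>M lborel)"
    unfolding F_def by measurable
  define D where "D l y = (\<integral>\<^sup>+t. F (y, t) * indicator (J l) t \<partial>lborel)" for l y
  have D[measurable]: "D l \<in> borel_measurable ?M" for l
    unfolding D_def by measurable
  \<comment> \<open>The good base points, whose fibre has density at most the square root of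
    \<open>\<theta>\<close>. By Markov's inequality the bad ones have density at most
    \<open>s\<close> in the base box.\<close>
  define P where "P l = {y \<in> space ?M. D l y \<le> ennreal s * emeasure lborel (J l)}" for l
  have P[measurable]: "P l \<in> sets ?M" for l unfolding P_def by measurable
  define G1 where "G1 = (\<lambda>(y, t). F (y, t) * indicator (\<Union>l\<in>L. (A' l \<inter> P l) \<times> J l) (y, t))"
  \<comment> \<open>The good parts of all boxes are removed, not just that of one box. A point of
    \<open>U2\<close> is therefore bad for every box that contains it, and the slices satisfy the
    density hypothesis of the induction for all boxes at once.\<close>
  define U2 where "U2 = (\<Union>l\<in>L. A' l \<times> J l) - (\<Union>l\<in>L. (A' l \<inter> P l) \<times> J l)"
  define G2 where "G2 = (\<lambda>(y, t). F (y, t) * indicator U2 (y, t))"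
  have G1m[measurable]: "G1 \<in> borel_measurable (?M \<Otimes>\<^sub>M lborel)"
    unfolding G1_def using \<open>finite L\<close> by (measurable; auto intro!: sets.finite_UN)
  have U2[measurable]: "U2 \<in> sets (?M \<Otimes>\<^sub>M lborel)"
    unfolding U2_def using \<open>finite L\<close> by (intro sets.Diff sets.finite_UN pair_measureI sets.Int A' P J)
  have G2m[measurable]: "G2 \<in> borel_measurable (?M \<Otimes>\<^sub>M lborel)"
    unfolding G2_def by measurable
  have boxeq: "y(i := t) \<in> (\<Pi>\<^sub>E j\<in>insert i I. {a l j<..<b l j}) \<longleftrightarrow> y \<in> A' l \<and> t \<in> J l"
    if "y \<in> space ?M" for y t l
    using that insert.hyps(2) unfolding A'_def J_def
    by (auto simp: PiE_iff space_PiM extensional_def split: if_splits)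
  have boxm: "(\<Pi>\<^sub>E j\<in>insert i I. {a l j<..<b l j}) \<in> sets ?N" for l
    by (rule sets_PiM_I_finite) (use insert.hyps in auto)
  have Eb: "E \<inter> (\<Union>l\<in>L. \<Pi>\<^sub>E j\<in>insert i I. {a l j<..<b l j}) \<in> sets ?N"
    by (intro sets.Int sets.finite_UN E boxm \<open>finite L\<close>)
  have "emeasure ?N (E \<inter> (\<Union>l\<in>L. \<Pi>\<^sub>E j\<in>insert i I. {a l j<..<b l j}))
      = (\<integral>\<^sup>+y. \<integral>\<^sup>+t. indicator (E \<inter> (\<Union>l\<in>L. \<Pi>\<^sub>E j\<in>insert i I. {a l j<..<b l j})) (y(i := t)) \<partial>lborel \<partial>?M)"
    by (subst nn_integral_indicator[OF Eb, symmetric],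
        rule psf.product_nn_integral_insert) (use insert.hyps Eb in auto)
  also have "\<dots> \<le> (\<integral>\<^sup>+y. \<integral>\<^sup>+t. G1 (y, t) + G2 (y, t) \<partial>lborel \<partial>?M)"
    by (intro nn_integral_mono)
       (auto simp: G1_def G2_def F_def U2_def indicator_def boxeq split: if_splits)
  also have "\<dots> = (\<integral>\<^sup>+y. (\<integral>\<^sup>+t. G1 (y, t) \<partial>lborel) + (\<integral>\<^sup>+t. G2 (y, t) \<partial>lborel) \<partial>?M)"
    by (intro nn_integral_cong nn_integral_add) measurable
  also have "\<dots> = (\<integral>\<^sup>+y. \<integral>\<^sup>+t. G1 (y, t) \<partial>lborel \<partial>?M) + (\<integral>\<^sup>+y. \<integral>\<^sup>+t. G2 (y, t) \<partial>lborel \<partial>?M)"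
    by (rule nn_integral_add) measurable
  also have "(\<integral>\<^sup>+y. \<integral>\<^sup>+t. G1 (y, t) \<partial>lborel \<partial>?M) \<le> (\<integral>\<^sup>+y. 2 * ennreal s * indicator (\<Pi>\<^sub>E j\<in>I. {0..1}) y \<partial>?M)"
  proof (rule nn_integral_mono)
    fix y assume y: "y \<in> space ?M"
    define E1 where "E1 = {t. y(i := t) \<in> E}"
    have E1: "E1 \<in> sets lborel"
    proof -
      have "(\<lambda>t. y(i := t)) \<in> measurable lborel ?N"
        using measurable_comp[OF measurable_Pair1'[OF y, of lborel] upd] by (simp add: comp_def)
      then have "(\<lambda>t. y(i := t)) -` E \<inter> space lborel \<in> sets lborel"
        using E by (rule measurable_sets)
      then show ?thesis by (simp add: E1_def vimage_def)
    qed
    have Fy: "F (y, t) = indicator E1 t" for t by (simp add: F_def E1_def indicator_def)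
    have Dy: "D l y = emeasure lborel (E1 \<inter> J l)" for l
    proof -
      have "D l y = (\<integral>\<^sup>+t. indicator (E1 \<inter> J l) t \<partial>lborel)"
        unfolding D_def Fy by (intro nn_integral_cong) (auto simp: indicator_def)
      then show ?thesis using E1 J by simp
    qed
    define L1 where "L1 = {l \<in> L. y \<in> A' l \<inter> P l}"
    have "(\<integral>\<^sup>+t. G1 (y, t) \<partial>lborel) = (\<integral>\<^sup>+t. indicator (E1 \<inter> (\<Union>l\<in>L1. J l)) t \<partial>lborel)"
      unfolding G1_def by (intro nn_integral_cong) (auto simp: Fy L1_def indicator_def)
    also have "\<dots> = emeasure lborel (E1 \<inter> (\<Union>l\<in>L1. J l))"
      using E1 \<open>finite L\<close> by (intro nn_integral_indicator sets.Int sets.finite_UN J) (auto simp: L1_def)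
    also have "\<dots> \<le> 2 * ennreal s * indicator (\<Pi>\<^sub>E j\<in>I. {0..1}) y"
    proof (cases "y \<in> (\<Pi>\<^sub>E j\<in>I. {0..1})")
      case True
      have "emeasure lborel (E1 \<inter> (\<Union>l\<in>L1. {a l i<..<b l i})) \<le> 2 * ennreal s"
      proof (rule interval_family_density[OF _ E1])
        show "finite L1" using \<open>finite L\<close> by (simp add: L1_def)
        show "{a l i<..<b l i} \<subseteq> {0..1}" if "l \<in> L1" for l
          using insert.prems(4)[of l i] that by (auto simp: L1_def)
        show "emeasure lborel (E1 \<inter> {a l i<..<b l i}) \<le> ennreal s * emeasure lborel {a l i<..<b l i}"
          if "l \<in> L1" for l
        proof -
          have "y \<in> P l" using that by (simp add: L1_def)
          then show ?thesis unfolding P_def mem_Collect_eq Dy J_def by simp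
        qed
      qed
      then show ?thesis using True by (simp add: J_def)
    next
      case False
      have "E1 = {}"
      proof (rule equals0I)
        fix t assume "t \<in> E1"
        then have "y(i := t) \<in> (\<Pi>\<^sub>E j\<in>insert i I. {0..1})" using insert.prems(3) by (auto simp: E1_def)
        then have "y \<in> (\<Pi>\<^sub>E j\<in>I. {0..1})"
          using y insert.hyps(2) by (auto simp: PiE_iff space_PiM extensional_def split: if_splits)
        then show False using False by simp
      qed
      then show ?thesis by simp
    qed
    finally show "(\<integral>\<^sup>+t. G1 (y, t) \<partial>lborel) \<le> 2 * ennreal s * indicator (\<Pi>\<^sub>E j\<in>I. {0..1}) y" .
  qed
  also have "(\<integral>\<^sup>+y. 2 * ennreal s * indicator (\<Pi>\<^sub>E j\<in>I. {0..1}) y \<partial>?M) = 2 * ennreal s"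
  proof -
    have m: "(\<Pi>\<^sub>E j\<in>I. {0..1::real}) \<in> sets ?M" by (rule sets_PiM_I_finite) (use insert.hyps in auto)
    have "emeasure ?M (\<Pi>\<^sub>E j\<in>I. {0..1::real}) = (\<Prod>j\<in>I. emeasure lborel {0..1::real})"
      by (rule psf.emeasure_PiM) (use insert.hyps in auto)
    then show ?thesis using m by (simp add: nn_integral_cmult_indicator)
  qed
  also have "(\<integral>\<^sup>+y. \<integral>\<^sup>+t. G2 (y, t) \<partial>lborel \<partial>?M) = (\<integral>\<^sup>+t. \<integral>\<^sup>+y. G2 (y, t) \<partial>?M \<partial>lborel)"
    using ps.Fubini'[of "\<lambda>y t. G2 (y, t)"] by simp
  also have "\<dots> \<le> (\<integral>\<^sup>+t. ennreal ((2 * real (card I) + 1) * s powr (1 / 2 ^ card I)) * indicator {0..1::real} t \<partial>lborel)"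
  proof (rule nn_integral_mono)
    fix t :: real
    define E2 where "E2 = {y \<in> space ?M. y(i := t) \<in> E \<and> (y, t) \<in> U2}"
    define L2 where "L2 = {l \<in> L. t \<in> J l}"
    have updt: "(\<lambda>y. y(i := t)) \<in> measurable ?M ?N"
      using measurable_comp[OF measurable_Pair2'[of t lborel ?M] upd] by (simp add: comp_def)
    have E2[measurable]: "E2 \<in> sets ?M"
    proof -
      have "(\<lambda>y. y(i := t)) -` E \<inter> space ?M \<in> sets ?M" using updt E by (rule measurable_sets)
      moreover have "(\<lambda>y. (y, t)) -` U2 \<inter> space ?M \<in> sets ?M"
        by (rule measurable_sets[OF measurable_Pair2' U2]) simp
      ultimately have "((\<lambda>y. y(i := t)) -` E \<inter> space ?M) \<inter> ((\<lambda>y. (y, t)) -` U2 \<inter> space ?M) \<in> sets ?M"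
        by (rule sets.Int)
      then show ?thesis by (rule back_subst[of "\<lambda>X. X \<in> sets ?M"]) (auto simp: E2_def)
    qed
    have "(\<integral>\<^sup>+y. G2 (y, t) \<partial>?M) = (\<integral>\<^sup>+y. indicator E2 y \<partial>?M)"
      unfolding G2_def F_def E2_def by (intro nn_integral_cong) (auto simp: indicator_def)
    also have "\<dots> = emeasure ?M E2" by simp
    also have "E2 = E2 \<inter> (\<Union>l\<in>L2. A' l)"
      by (auto simp: E2_def L2_def U2_def)
    also have "emeasure ?M \<dots> \<le> ennreal ((2 * real (card I) + 1) * s powr (1 / 2 ^ card I)) * indicator {0..1::real} t"
    proof (cases "t \<in> {0..1}")
      case True
      have "emeasure ?M (E2 \<inter> (\<Union>l\<in>L2. A' l)) \<le> ennreal ((2 * real (card I) + 1) * s powr (1 / 2 ^ card I))"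
        unfolding A'_def
      proof (rule insert.IH)
        show "finite L2" using \<open>finite L\<close> by (simp add: L2_def)
        show "E2 \<in> sets ?M" by (rule E2)
        show "E2 \<subseteq> (\<Pi>\<^sub>E j\<in>I. {0..1})"
        proof
          fix y assume y: "y \<in> E2"
          then have "y(i := t) \<in> (\<Pi>\<^sub>E j\<in>insert i I. {0..1})" using insert.prems(3) by (auto simp: E2_def)
          then show "y \<in> (\<Pi>\<^sub>E j\<in>I. {0..1})"
            using y insert.hyps(2) by (auto simp: E2_def PiE_iff space_PiM extensional_def split: if_splits)
        qed
        show "{a l j<..<b l j} \<subseteq> {0..1}" if "l \<in> L2" "j \<in> I" for l j
          using insert.prems(4)[of l j] that by (auto simp: L2_def)
        show "0 < s" "s \<le> 1" by (rule s)+
        fix l assume l: "l \<in> L2"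
        then have lL: "l \<in> L" and tJ: "t \<in> J l" by (auto simp: L2_def)
        have Jf: "emeasure lborel (J l) = ennreal (b l i - a l i)" and Jp: "0 < b l i - a l i"
          using tJ by (auto simp: J_def)
        define v where "v = b l i - a l i"
        have sub: "E2 \<inter> A' l \<subseteq> A' l - P l"
          using lL tJ by (auto simp: E2_def U2_def)
        \<comment> \<open>Markov's inequality: on the bad base points the fibre measure exceeds
          \<open>s * v\<close>, while its integral over the base box is the measure of
          \<open>E\<close> in the full box.\<close>
        have "ennreal (s * v) * emeasure ?M (A' l - P l) = (\<integral>\<^sup>+y. ennreal (s * v) * indicator (A' l - P l) y \<partial>?M)"
          by (simp add: nn_integral_cmult_indicator)
        also have "\<dots> \<le> (\<integral>\<^sup>+y. indicator (A' l) y * D l y \<partial>?M)"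
        proof (rule nn_integral_mono)
          fix y assume y: "y \<in> space ?M"
          show "ennreal (s * v) * indicator (A' l - P l) y \<le> indicator (A' l) y * D l y"
          proof (cases "y \<in> A' l - P l")
            case True
            then have "\<not> D l y \<le> ennreal s * emeasure lborel (J l)" using y by (auto simp: P_def)
            then show ?thesis using True s Jp by (simp add: Jf v_def[symmetric] ennreal_mult)
          qed simp
        qed
        also have "\<dots> = (\<integral>\<^sup>+y. \<integral>\<^sup>+t. indicator (A' l) y * (F (y, t) * indicator (J l) t) \<partial>lborel \<partial>?M)"
          unfolding D_def by (intro nn_integral_cong nn_integral_cmult[symmetric]) measurable
        also have "\<dots> = (\<integral>\<^sup>+y. \<integral>\<^sup>+t. indicator (E \<inter> (\<Pi>\<^sub>E j\<in>insert i I. {a l j<..<b l j})) (y(i := t)) \<partial>lborel \<partial>?M)"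
          by (intro nn_integral_cong) (auto simp: F_def indicator_def boxeq)
        also have "\<dots> = emeasure ?N (E \<inter> (\<Pi>\<^sub>E j\<in>insert i I. {a l j<..<b l j}))"
          by (subst nn_integral_indicator[symmetric], use boxm E in blast, 
              rule psf.product_nn_integral_insert[symmetric]) (use insert.hyps boxm E in auto)
        also have "\<dots> \<le> ennreal \<theta> * emeasure ?N (\<Pi>\<^sub>E j\<in>insert i I. {a l j<..<b l j})"
          by (rule insert.prems) (rule lL)
        also have "emeasure ?N (\<Pi>\<^sub>E j\<in>insert i I. {a l j<..<b l j}) = ennreal v * emeasure ?M (A' l)"
          unfolding A'_def using insert.hyps Jp
          by (simp add: psf.emeasure_PiM v_def)
        also have "ennreal \<theta> * (ennreal v * emeasure ?M (A' l)) = ennreal (s * v) * (ennreal s * emeasure ?M (A' l))"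
          using s Jp by (simp add: ennreal_mult v_def ac_simps)
        finally have "ennreal (s * v) * emeasure ?M (A' l - P l) \<le> ennreal (s * v) * (ennreal s * emeasure ?M (A' l))" .
        then have "emeasure ?M (A' l - P l) \<le> ennreal s * emeasure ?M (A' l)"
          by (subst (asm) ennreal_mult_le_mult_iff) (use s Jp in \<open>auto simp: v_def\<close>)
        moreover have "emeasure ?M (E2 \<inter> A' l) \<le> emeasure ?M (A' l - P l)"
          by (rule emeasure_mono[OF sub]) measurable
        ultimately show "emeasure ?M (E2 \<inter> (\<Pi>\<^sub>E j\<in>I. {a l j<..<b l j})) \<le> ennreal s * emeasure ?M (\<Pi>\<^sub>E j\<in>I. {a l j<..<b l j})"
          unfolding A'_def by simp
      qed
      then show ?thesis using True by simp
    next
      case False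
      have "L2 = {}" using False insert.prems(4)[of _ i] by (fastforce simp: L2_def J_def)
      then show ?thesis by simp
    qed
    finally show "(\<integral>\<^sup>+y. G2 (y, t) \<partial>?M) \<le> ennreal ((2 * real (card I) + 1) * s powr (1 / 2 ^ card I)) * indicator {0..1::real} t" .
  qed
  also have "\<dots> = ennreal ((2 * real (card I) + 1) * s powr (1 / 2 ^ card I))"
    by (simp add: nn_integral_cmult)
  finally have "emeasure ?N (E \<inter> (\<Union>l\<in>L. \<Pi>\<^sub>E j\<in>insert i I. {a l j<..<b l j}))
     \<le> 2 * ennreal s + ennreal ((2 * real (card I) + 1) * s powr (1 / 2 ^ card I))"
    by (simp add: add_mono)
  also have "\<dots> = ennreal (2 * s + (2 * real (card I) + 1) * s powr (1 / 2 ^ card I))"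
  proof -
    have "2 * ennreal s = ennreal (2 * s)" using s by (simp add: ennreal_mult)
    moreover have "ennreal (2 * s) + ennreal ((2 * real (card I) + 1) * s powr (1 / 2 ^ card I))
      = ennreal (2 * s + (2 * real (card I) + 1) * s powr (1 / 2 ^ card I))"
      by (rule ennreal_plus[symmetric]) (use s in simp_all)
    ultimately show ?thesis by simp
  qed
  also have "\<dots> \<le> ennreal ((2 * real (card (insert i I)) + 1) * \<theta> powr (1 / 2 ^ card (insert i I)))"
  proof (rule ennreal_leI)
    have e: "\<theta> powr (1 / 2 ^ card (insert i I)) = s powr (1 / 2 ^ card I)"
    proof -
      have "\<theta> = s powr 2" using s by (simp add: powr_numeral power2_eq_square)
      then show ?thesis using insert.hyps by (simp add: powr_powr)
    qed
    \<comment> \<open>As \<open>s \<le> 1\<close>, the good part \<open>2 * s\<close> is absorbed by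
      adding 2 to the coefficient, which is why the coefficient grows only linearly in the
      dimension.\<close>
    have "s powr 1 \<le> s powr (1 / 2 ^ card I)"
      by (rule powr_mono') (use s in auto)
    then have "2 * s \<le> 2 * s powr (1 / 2 ^ card I)" using s by simp
    then show "2 * s + (2 * real (card I) + 1) * s powr (1 / 2 ^ card I)
      \<le> (2 * real (card (insert i I)) + 1) * \<theta> powr (1 / 2 ^ card (insert i I))"
      unfolding e using insert.hyps by (simp add: algebra_simps)
  qed
  finally show ?case .
qed

section \<open>Lebesgue measure of boxes in coordinates\<close>

lemma prod_Basis_cart:
  fixes g :: "(real ^ 'd::finite) \<Rightarrow> 'b::comm_monoid_mult"
  shows "(\<Prod>b\<in>Basis. g b) = (\<Prod>i\<in>UNIV. g (axis i 1))"
proof -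
  have B: "(Basis :: (real ^ 'd) set) = range (\<lambda>i. axis i 1)"
    by (auto simp: Basis_vec_def)
  have "inj (\<lambda>i::'d. axis i (1::real))"
    by (auto simp: inj_def axis_eq_axis)
  then show ?thesis unfolding B by (subst prod.reindex) auto
qed

lemma nn_integral_lborel_prod_cart:
  fixes f :: "'d::finite \<Rightarrow> real \<Rightarrow> ennreal"
  assumes "\<And>i. f i \<in> borel_measurable borel"
  shows "(\<integral>\<^sup>+x. (\<Prod>i\<in>UNIV. f i (x $ i)) \<partial>(lborel :: (real ^ 'd) measure)) = (\<Prod>i\<in>UNIV. \<integral>\<^sup>+t. f i t \<partial>lborel)"
proof -
  define F where "F b = f (THE i. b = axis i (1::real))" for b :: "real ^ 'd"
  have the: "(THE i'. axis i 1 = (axis i' 1 :: real ^ 'd)) = i" for i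
    by (rule the_equality) (auto simp: axis_eq_axis)
  have F: "F (axis i 1) = f i" for i
    by (simp add: F_def the)
  have "(\<integral>\<^sup>+x. (\<Prod>b\<in>Basis. F b (x \<bullet> b)) \<partial>(lborel :: (real ^ 'd) measure)) = (\<Prod>b\<in>Basis. \<integral>\<^sup>+t. F b t \<partial>lborel)"
    by (rule nn_integral_lborel_prod) (use assms in \<open>auto simp: F_def\<close>)
  then show ?thesis
    by (simp add: prod_Basis_cart F inner_axis)
qed

lemma emeasure_lborel_box_cart:
  fixes l u :: "real ^ 'd::finite"
  assumes "\<And>i. l $ i \<le> u $ i"
  shows "emeasure lborel (box l u) = ennreal (\<Prod>i\<in>UNIV. u $ i - l $ i)"
    and "emeasure lborel (cbox l u) = ennreal (\<Prod>i\<in>UNIV. u $ i - l $ i)"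
proof -
  have "l \<bullet> b \<le> u \<bullet> b" if "b \<in> Basis" for b
    using that assms by (auto simp: Basis_vec_def inner_axis)
  then show "emeasure lborel (box l u) = ennreal (\<Prod>i\<in>UNIV. u $ i - l $ i)"
    "emeasure lborel (cbox l u) = ennreal (\<Prod>i\<in>UNIV. u $ i - l $ i)"
    by (simp_all add: prod_Basis_cart inner_axis)
qed

lemma low_density_cube:
  fixes al be :: "'l \<Rightarrow> real ^ 'd::finite"
  assumes L: "finite L" and E: "E \<in> sets borel" "E \<subseteq> cbox 0 1"
    and sub: "\<And>l i. l \<in> L \<Longrightarrow> 0 \<le> al l $ i" "\<And>l i. l \<in> L \<Longrightarrow> be l $ i \<le> 1"
    and dens: "\<And>l. l \<in> L \<Longrightarrow> emeasure lborel (E \<inter> box (al l) (be l)) \<le> ennreal \<theta> * emeasure lborel (box (al l) (be l))"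
    and \<theta>: "0 < \<theta>" "\<theta> \<le> 1"
  shows "emeasure lborel (E \<inter> (\<Union>l\<in>L. box (al l) (be l))) \<le> ennreal ((2 * real CARD('d) + 1) * \<theta> powr (1 / 2 ^ CARD('d)))"
proof -
  let ?B = "Basis :: (real ^ 'd) set"
  let ?M = "PiM ?B (\<lambda>_. lborel :: real measure)"
  define T where "T f = (\<Sum>b\<in>?B. f b *\<^sub>R b)" for f :: "real ^ 'd \<Rightarrow> real"
  have T[measurable]: "T \<in> measurable ?M borel" unfolding T_def by measurable
  have lb: "lborel = distr ?M borel T" unfolding T_def by (rule lborel_eq)
  have Tb: "T f \<bullet> b = f b" if "b \<in> ?B" for f b
    using that unfolding T_def by (rule inner_sum_left_Basis)
  have em: "emeasure lborel A = emeasure ?M (T -` A \<inter> space ?M)" if "A \<in> sets borel" for A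
    by (subst lb, rule emeasure_distr[OF T that])
  have box: "T -` box l u \<inter> space ?M = (\<Pi>\<^sub>E b\<in>?B. {l \<bullet> b<..<u \<bullet> b})" for l u
    by (auto simp: box_def Tb space_PiM PiE_iff)
  let ?E = "T -` E \<inter> space ?M"
  have bm: "box (al l) (be l) \<in> sets borel" for l by simp
  have Um: "E \<inter> (\<Union>l\<in>L. box (al l) (be l)) \<in> sets borel"
    using L E by (intro sets.Int sets.finite_UN bm) auto
  have "emeasure lborel (E \<inter> (\<Union>l\<in>L. box (al l) (be l))) = emeasure ?M (T -` (E \<inter> (\<Union>l\<in>L. box (al l) (be l))) \<inter> space ?M)"
    using Um by (rule em)
  also have "T -` (E \<inter> (\<Union>l\<in>L. box (al l) (be l))) \<inter> space ?M = ?E \<inter> (\<Union>l\<in>L. \<Pi>\<^sub>E b\<in>?B. {al l \<bullet> b<..<be l \<bullet> b})"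
    unfolding box[symmetric] by blast
  also have "emeasure ?M \<dots> \<le> ennreal ((2 * real (card ?B) + 1) * \<theta> powr (1 / 2 ^ card ?B))"
  proof (rule low_density_PiM)
    show "?E \<in> sets ?M" using T E(1) by (rule measurable_sets)
    show "?E \<subseteq> (\<Pi>\<^sub>E b\<in>?B. {0..1})"
    proof
      fix f assume f: "f \<in> ?E"
      have "f b \<in> {0..1}" if b: "b \<in> ?B" for b
      proof -
        have "T f \<in> cbox 0 1" using f E by auto
        moreover obtain i where "b = axis i 1" using b by (auto simp: Basis_vec_def)
        ultimately show ?thesis using Tb[OF b, of f]
          by (simp add: mem_box_cart inner_axis) metis
      qed
      then show "f \<in> (\<Pi>\<^sub>E b\<in>?B. {0..1})" using f by (auto simp: space_PiM PiE_iff)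
    qed
    show "{al l \<bullet> b<..<be l \<bullet> b} \<subseteq> {0..1}" if l: "l \<in> L" and "b \<in> ?B" for l b
    proof -
      obtain i where "b = axis i 1" using \<open>b \<in> ?B\<close> by (auto simp: Basis_vec_def)
      then show ?thesis using sub(1)[OF l, of i] sub(2)[OF l, of i] by (auto simp: inner_axis)
    qed
    show "emeasure ?M (?E \<inter> (\<Pi>\<^sub>E b\<in>?B. {al l \<bullet> b<..<be l \<bullet> b})) \<le> ennreal \<theta> * emeasure ?M (\<Pi>\<^sub>E b\<in>?B. {al l \<bullet> b<..<be l \<bullet> b})"
      if "l \<in> L" for l
    proof -
      have "?E \<inter> (\<Pi>\<^sub>E b\<in>?B. {al l \<bullet> b<..<be l \<bullet> b}) = T -` (E \<inter> box (al l) (be l)) \<inter> space ?M"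
        unfolding box[symmetric] by blast
      moreover have "emeasure lborel (E \<inter> box (al l) (be l)) = emeasure ?M (T -` (E \<inter> box (al l) (be l)) \<inter> space ?M)"
        by (rule em) (use E in auto)
      moreover have "emeasure lborel (box (al l) (be l)) = emeasure ?M (T -` box (al l) (be l) \<inter> space ?M)"
        by (rule em) auto
      ultimately show ?thesis using dens[OF that] by (simp add: box)
    qed
  qed (use L \<theta> in auto)
  finally show ?thesis by simp
qed

section \<open>Volume of the hyperbolic region at the upper corner of a box\<close>

lemma nn_integral_powr_distance:
  assumes w: "0 < w" and ab: "a < (b::real)"
  shows "(\<integral>\<^sup>+t. ennreal ((b - t) powr (w - 1)) * indicator {a<..<b} t \<partial>lborel) = ennreal ((b - a) powr w / w)"
proof -
  have "(\<integral>\<^sup>+t. ennreal ((b - t) powr (w - 1)) * indicator {a<..<b} t \<partial>lborel)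
    = (\<integral>\<^sup>+x. ennreal ((b - (b + (-1) * x)) powr (w - 1)) * indicator {a<..<b} (b + (-1) * x) \<partial>lborel)"
    by (subst nn_integral_real_affine[of _ "-1" b]) auto
  also have "\<dots> = (\<integral>\<^sup>+x. ennreal (indicator {0<..<b - a} x * x powr (w - 1)) \<partial>lborel)"
    by (intro nn_integral_cong) (auto simp: indicator_def)
  also have "\<dots> = ennreal ((b - a) powr w / w)"
  proof (rule nn_integral_has_integral_lebesgue)
    have "((\<lambda>x. x powr (w - 1)) has_integral ((b - a) powr (w - 1 + 1) / (w - 1 + 1))) {0..b - a}"
      by (rule has_integral_powr_from_0) (use w ab in auto)
    then show "((\<lambda>x. x powr (w - 1)) has_integral ((b - a) powr w / w)) {0<..<b - a}"
      by (simp add: has_integral_Icc_iff_Ioo)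
  qed simp
  finally show ?thesis .
qed

text \<open>Markov's inequality for a negative power of the product: on the region,
  \<open>\<tau> powr (1 - w)\<close> times the product to the power \<open>w - 1\<close> is at least
  1, and the integral of this majorant factorises over the coordinates. The exponent
  \<open>w\<close> stays free, since small boxes call for a small \<open>w\<close> depending on the
  volume ratio and large ones for \<open>1 / 2\<close>.\<close>

lemma hyperbolic_corner_volume:
  fixes al be :: "real ^ 'd::finite"
  assumes ab: "\<And>i. al $ i < be $ i" and \<tau>: "0 < \<tau>" and w: "0 < w" "w \<le> 1"
  shows "emeasure lborel {y \<in> box al be. (\<Prod>i\<in>UNIV. be $ i - y $ i) \<le> \<tau>}
    \<le> ennreal (\<tau> powr (1 - w) * (\<Prod>i\<in>UNIV. be $ i - al $ i) powr w * (1 / w) ^ CARD('d))"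
proof -
  let ?H = "{y \<in> box al be. (\<Prod>i\<in>UNIV. be $ i - y $ i) \<le> \<tau>}"
  define f where "f i t = ennreal ((be $ i - t) powr (w - 1)) * indicator {al $ i<..<be $ i} t" for i t
  have [measurable]: "?H \<in> sets borel" by measurable
  have "emeasure lborel ?H = (\<integral>\<^sup>+y. indicator ?H y \<partial>lborel)" by simp
  also have "\<dots> \<le> (\<integral>\<^sup>+y. ennreal (\<tau> powr (1 - w)) * (\<Prod>i\<in>UNIV. f i (y $ i)) \<partial>lborel)"
  proof (rule nn_integral_mono)
    fix y :: "real ^ 'd"
    show "indicator ?H y \<le> ennreal (\<tau> powr (1 - w)) * (\<Prod>i\<in>UNIV. f i (y $ i))"
    proof (cases "y \<in> ?H")
      case True
      then have y: "\<And>i. al $ i < y $ i \<and> y $ i < be $ i" by (auto simp: mem_box_cart)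
      define p where "p = (\<Prod>i\<in>UNIV. be $ i - y $ i)"
      have p: "0 < p" "p \<le> \<tau>" using y True by (auto simp: p_def intro!: prod_pos)
      have "(\<Prod>i\<in>UNIV. f i (y $ i)) = (\<Prod>i\<in>UNIV. ennreal ((be $ i - y $ i) powr (w - 1)))"
        using y by (simp add: f_def)
      also have "\<dots> = ennreal (\<Prod>i\<in>UNIV. (be $ i - y $ i) powr (w - 1))"
        by (simp add: prod_ennreal)
      also have "(\<Prod>i\<in>UNIV. (be $ i - y $ i) powr (w - 1)) = p powr (w - 1)"
        unfolding p_def by (subst prod_powr_distrib) (use y in \<open>auto simp: less_imp_le\<close>)
      also have "ennreal (\<tau> powr (1 - w)) * ennreal (p powr (w - 1)) = ennreal (\<tau> powr (1 - w) * p powr (w - 1))"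
        by (simp add: ennreal_mult)
      finally have e: "ennreal (\<tau> powr (1 - w)) * (\<Prod>i\<in>UNIV. f i (y $ i)) = ennreal (\<tau> powr (1 - w) * p powr (w - 1))"
        by (simp add: ennreal_mult)
      have "p powr (1 - w) \<le> \<tau> powr (1 - w)" by (rule powr_mono2) (use p w in auto)
      then have "p powr (1 - w) * p powr (w - 1) \<le> \<tau> powr (1 - w) * p powr (w - 1)"
        by (rule mult_right_mono) simp
      moreover have "p powr (1 - w) * p powr (w - 1) = 1"
        using p by (simp add: powr_add[symmetric])
      ultimately have "1 \<le> \<tau> powr (1 - w) * p powr (w - 1)" by simp
      then show ?thesis unfolding e using True by (simp add: ennreal_ge_1)
    qed simp
  qed
  also have "\<dots> = ennreal (\<tau> powr (1 - w)) * (\<Prod>i\<in>UNIV. \<integral>\<^sup>+t. f i t \<partial>lborel)"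
  proof -
    have [measurable]: "f i \<in> borel_measurable borel" for i unfolding f_def by measurable
    show ?thesis by (subst nn_integral_cmult) (auto simp: nn_integral_lborel_prod_cart)
  qed
  also have "(\<Prod>i\<in>UNIV. \<integral>\<^sup>+t. f i t \<partial>lborel) = (\<Prod>i\<in>UNIV. ennreal ((be $ i - al $ i) powr w / w))"
    unfolding f_def by (intro prod.cong refl nn_integral_powr_distance w ab)
  also have "\<dots> = ennreal (\<Prod>i\<in>UNIV. (be $ i - al $ i) powr w / w)"
    by (rule prod_ennreal) (use w in simp)
  also have "(\<Prod>i\<in>UNIV. (be $ i - al $ i) powr w / w) = (\<Prod>i\<in>UNIV. be $ i - al $ i) powr w * (1 / w) ^ CARD('d)"
    using ab by (simp add: prod_dividef prod_powr_distrib less_imp_le power_one_over divide_simps)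
  finally show ?thesis by (simp add: ennreal_mult' mult.assoc)
qed

section \<open>Chaining along dyadic cells\<close>

definition cell :: "('d \<Rightarrow> nat) \<Rightarrow> real ^ 'd \<Rightarrow> 'd \<Rightarrow> int" where
  "cell a x = (\<lambda>i. \<lfloor>2 ^ a i * x $ i\<rfloor>)"

definition corner :: "('d::finite \<Rightarrow> nat) \<Rightarrow> ('d \<Rightarrow> int) \<Rightarrow> real ^ 'd" where
  "corner a c = (\<chi> i. of_int (c i) / 2 ^ a i)"

definition ibox :: "('d::finite \<Rightarrow> int) \<Rightarrow> nat \<Rightarrow> ('d \<Rightarrow> int) set" where
  "ibox l N = (\<Pi>\<^sub>E i\<in>UNIV. {l i..<l i + int N})"

abbreviation refine :: "('d \<Rightarrow> nat) \<Rightarrow> nat \<Rightarrow> 'd \<Rightarrow> nat" where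
  "refine a j \<equiv> \<lambda>i. a i + j"

abbreviation subcells :: "('d::finite \<Rightarrow> int) \<Rightarrow> nat \<Rightarrow> ('d \<Rightarrow> int) set" where
  "subcells c j \<equiv> ibox (\<lambda>i. c i * 2 ^ j) (2 ^ j)"

lemma mem_ibox: "b \<in> ibox l N \<longleftrightarrow> (\<forall>i. l i \<le> b i \<and> b i < l i + int N)"
  by (auto simp: ibox_def PiE_iff)

lemma finite_ibox[simp]: "finite (ibox l N)"
  unfolding ibox_def by (intro finite_PiE) auto

lemma card_ibox[simp]: "card (ibox (l :: 'd::finite \<Rightarrow> int) N) = N ^ CARD('d)"
  unfolding ibox_def by (subst card_PiE) auto

lemma card_ibox_face:
  "card {b \<in> ibox (l :: 'd::finite \<Rightarrow> int) N. b i = v} \<le> N ^ (CARD('d) - 1)"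
proof -
  have "{b \<in> ibox l N. b i = v} \<subseteq> (\<Pi>\<^sub>E j\<in>UNIV. if j = i then {v} else {l j..<l j + int N})"
    by (auto simp: ibox_def PiE_iff)
  then have "card {b \<in> ibox l N. b i = v} \<le> card (\<Pi>\<^sub>E j\<in>UNIV. if j = i then {v} else {l j..<l j + int N})"
    by (intro card_mono finite_PiE) auto
  also have "\<dots> = (\<Prod>j\<in>UNIV. card (if j = i then {v} else {l j..<l j + int N}))"
    by (rule card_PiE) simp
  also have "\<dots> = (\<Prod>j\<in>UNIV - {i}. card (if j = i then {v} else {l j..<l j + int N}))"
    by (subst prod.remove[of _ i]) auto
  also have "\<dots> = (\<Prod>j\<in>UNIV - {i}. N)" by (intro prod.cong) auto
  also have "\<dots> = N ^ (CARD('d) - 1)" by (simp add: card_Diff_singleton)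
  finally show ?thesis .
qed

text \<open>A diagonal shift of the box only exchanges a boundary layer. The points gained lie on
  \<open>CARD('d)\<close> faces with at most \<open>N ^ (CARD('d) - 1)\<close> points each, and the
  values at the points lost enter with a negative sign.\<close>

lemma sum_increments_ibox:
  fixes G :: "('d::finite \<Rightarrow> int) \<Rightarrow> real"
  assumes G: "\<And>b. 0 \<le> G b" "\<And>b. G b \<le> H"
  shows "(\<Sum>b\<in>ibox l N. G (\<lambda>i. b i + 1) - G b) \<le> H * (real CARD('d) * real N ^ (CARD('d) - 1))"
proof -
  define B' where "B' = ibox (\<lambda>i. l i + 1) N"
  have H: "0 \<le> H" using G[of undefined] by linarith
  have "(\<Sum>b\<in>ibox l N. G (\<lambda>i. b i + 1)) = (\<Sum>b\<in>B'. G b)"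
    by (rule sum.reindex_bij_witness[of _ "\<lambda>b i. b i - 1" "\<lambda>b i. b i + 1"])
       (auto simp: B'_def mem_ibox algebra_simps)
  then have "(\<Sum>b\<in>ibox l N. G (\<lambda>i. b i + 1) - G b) = (\<Sum>b\<in>B'. G b) - (\<Sum>b\<in>ibox l N. G b)"
    by (simp add: sum_subtractf)
  also have "\<dots> = (\<Sum>b\<in>B' - ibox l N. G b) - (\<Sum>b\<in>ibox l N - B'. G b)"
  proof -
    have "(\<Sum>b\<in>B'. G b) = (\<Sum>b\<in>B' - ibox l N. G b) + (\<Sum>b\<in>B' \<inter> ibox l N. G b)"
      by (subst add.commute, rule sum.Int_Diff) (simp add: B'_def)
    moreover have "(\<Sum>b\<in>ibox l N. G b) = (\<Sum>b\<in>ibox l N - B'. G b) + (\<Sum>b\<in>B' \<inter> ibox l N. G b)"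
      by (subst add.commute, subst Int_commute, rule sum.Int_Diff) simp
    ultimately show ?thesis by simp
  qed
  also have "\<dots> \<le> (\<Sum>b\<in>B' - ibox l N. H)"
    using sum_mono[of "B' - ibox l N" G "\<lambda>_. H"] sum_nonneg[of "ibox l N - B'" G] G by auto
  also have "\<dots> = H * real (card (B' - ibox l N))" by simp
  also have "real (card (B' - ibox l N)) \<le> real CARD('d) * real N ^ (CARD('d) - 1)"
  proof -
    have "B' - ibox l N \<subseteq> (\<Union>i\<in>UNIV. {b \<in> B'. b i = l i + int N})"
    proof
      fix b assume b: "b \<in> B' - ibox l N"
      then obtain i where i: "\<not> (l i \<le> b i \<and> b i < l i + int N)" by (auto simp: mem_ibox)
      have "l i + 1 \<le> b i \<and> b i < l i + 1 + int N" using b by (auto simp: B'_def mem_ibox)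
      then have "b i = l i + int N" using i by linarith
      then show "b \<in> (\<Union>i\<in>UNIV. {b \<in> B'. b i = l i + int N})" using b by auto
    qed
    then have "card (B' - ibox l N) \<le> card (\<Union>i\<in>UNIV. {b \<in> B'. b i = l i + int N})"
      by (intro card_mono) (auto simp: B'_def)
    also have "\<dots> \<le> (\<Sum>i\<in>UNIV. card {b \<in> B'. b i = l i + int N})" by (rule card_UN_le) simp
    also have "\<dots> \<le> (\<Sum>i\<in>(UNIV::'d set). N ^ (CARD('d) - 1))"
      unfolding B'_def by (intro sum_mono card_ibox_face)
    also have "\<dots> = CARD('d) * N ^ (CARD('d) - 1)" by simp
    finally show ?thesis by (metis of_nat_le_iff of_nat_mult of_nat_power)
  qed
  finally show ?thesis using H by (simp add: mult_left_mono)
qed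

lemma corner_cell_le: "corner a (cell a x) \<le> x"
  by (simp add: less_eq_vec_def corner_def cell_def divide_le_eq mult.commute of_int_floor_le)

lemma le_corner_cell: "x \<le> corner a (\<lambda>i. cell a x i + 1)"
proof -
  have "2 ^ a i * x $ i \<le> of_int (\<lfloor>2 ^ a i * x $ i\<rfloor> + 1)" for i
    by linarith
  then show ?thesis
    by (simp add: less_eq_vec_def corner_def cell_def le_divide_eq mult.commute)
qed

lemma corner_mono: "(\<And>i. b i \<le> c i) \<Longrightarrow> corner a b \<le> corner a c"
  by (simp add: less_eq_vec_def corner_def divide_right_mono)

lemma cell_refine_mem: "cell (refine a j) x \<in> subcells (cell a x) j"
proof -
  have "\<lfloor>y\<rfloor> * 2 ^ j \<le> \<lfloor>2 ^ j * y\<rfloor> \<and> \<lfloor>2 ^ j * y\<rfloor> < \<lfloor>y\<rfloor> * 2 ^ j + 2 ^ j" for y :: real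
  proof
    have "of_int (\<lfloor>y\<rfloor> * 2 ^ j) \<le> 2 ^ j * y" by simp
    then show "\<lfloor>y\<rfloor> * 2 ^ j \<le> \<lfloor>2 ^ j * y\<rfloor>" by (simp only: le_floor_iff)
    have "2 ^ j * y < 2 ^ j * (of_int \<lfloor>y\<rfloor> + 1)" by simp
    then show "\<lfloor>2 ^ j * y\<rfloor> < \<lfloor>y\<rfloor> * 2 ^ j + 2 ^ j" by (simp add: floor_less_iff algebra_simps)
  qed
  from this[of "2 ^ a i * x $ i" for i] show ?thesis
    by (simp add: mem_ibox cell_def power_add mult.assoc mult.left_commute)
qed

lemma cell_refine_Suc: "cell (refine a j) x = (\<lambda>i. cell (refine a (Suc j)) x i div 2)"
proof
  fix i
  have "cell (refine a j) x i = \<lfloor>(2 ^ (a i + Suc j) * x $ i) / real_of_int 2\<rfloor>"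
    by (simp add: cell_def)
  also have "\<dots> = cell (refine a (Suc j)) x i div 2"
    by (subst floor_divide_real_eq_div) (simp_all add: cell_def)
  finally show "cell (refine a j) x i = cell (refine a (Suc j)) x i div 2" .
qed

text \<open>Chaining along dyadic subcells: the function is replaced by its values at the lower corners of
  ever smaller cells. Summed over the cells of one level, the increments telescope along diagonals, so
  they are bounded by a boundary count, and no entropy argument is needed.\<close>

lemma isotone_cell_sum:
  fixes x :: "'i \<Rightarrow> real ^ 'd::finite" and e h :: "'i \<Rightarrow> real"
  assumes S: "finite S" "\<And>i. i \<in> S \<Longrightarrow> cell a (x i) = c"
    and h: "\<And>i. i \<in> S \<Longrightarrow> 0 \<le> h i" "\<And>i. i \<in> S \<Longrightarrow> h i \<le> H" and H: "0 \<le> H"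
    and mono: "\<And>i j. i \<in> S \<Longrightarrow> j \<in> S \<Longrightarrow> x i \<le> x j \<Longrightarrow> h i \<le> h j"
    and z: "\<And>j b. j \<le> J \<Longrightarrow> b \<in> subcells c j \<Longrightarrow> \<bar>\<Sum>i | i \<in> S \<and> cell (refine a j) (x i) = b. e i\<bar> \<le> z j"
    and zA: "\<And>b. b \<in> subcells c J \<Longrightarrow> (\<Sum>i | i \<in> S \<and> cell (refine a J) (x i) = b. \<bar>e i\<bar>) \<le> zA"
  shows "(\<Sum>i\<in>S. e i * h i) \<le> H * ((\<Sum>j\<le>J. real CARD('d) * (2 ^ j) ^ (CARD('d) - 1) * z j)
    + real CARD('d) * (2 ^ J) ^ (CARD('d) - 1) * zA)"
proof -
  let ?d = "CARD('d)"
  define w where "w j = real ?d * (2 ^ j) ^ (?d - 1)" for j :: nat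
  \<comment> \<open>The smallest nonnegative isotone extension of \<open>h\<close> from the points
    \<open>x i\<close> to the whole space, so that it can be evaluated at the corners of
    cells.\<close>
  define g where "g y = Max (insert 0 (h ` {i \<in> S. x i \<le> y}))" for y
  have gfin: "finite (insert 0 (h ` {i \<in> S. x i \<le> y}))" for y using S by simp
  have g0: "0 \<le> g y" for y unfolding g_def using gfin by (intro Max_ge) auto
  have gH: "g y \<le> H" for y unfolding g_def using gfin h H by (subst Max_le_iff) auto
  have gm: "g y \<le> g y'" if "y \<le> y'" for y y'
    unfolding g_def by (rule Max_mono) (use that gfin in \<open>auto intro: order_trans\<close>)
  have gx: "g (x i) = h i" if i: "i \<in> S" for i
    unfolding g_def by (rule Max_eqI) (use gfin i h mono in auto)
  define G where "G j b = g (corner (refine a j) b)" for j b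
  define cl where "cl j i = cell (refine a j) (x i)" for j i
  define m where "m j i = G j (cl j i)" for j i
  have cl: "cl j i \<in> subcells c j" if "i \<in> S" for i j
    using cell_refine_mem[of a j "x i"] S(2)[OF that] by (simp add: cl_def)
  have G: "0 \<le> G j b" "G j b \<le> H" for j b using g0 gH by (auto simp: G_def)
  have group: "(\<Sum>i\<in>S. f i) = (\<Sum>b\<in>subcells c j. \<Sum>i | i \<in> S \<and> cl j i = b. f i)" for j and f :: "'i \<Rightarrow> real"
    by (rule sum.group[symmetric]) (use S cl in auto)
  have z0: "0 \<le> z j" if "j \<le> J" for j
  proof -
    have "(\<lambda>i. c i * 2 ^ j) \<in> subcells c j" by (simp add: mem_ibox)
    from z[OF that this] show ?thesis by linarith
  qed
  have zA0: "0 \<le> zA"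
  proof -
    have "(\<lambda>i. c i * 2 ^ J) \<in> subcells c J" by (simp add: mem_ibox)
    from zA[OF this] show ?thesis by (rule order_trans[rotated]) (simp add: sum_nonneg)
  qed
  have first: "(\<Sum>i\<in>S. e i * m 0 i) \<le> H * (w 0 * z 0)"
  proof -
    have cl0: "cl 0 i = c" if "i \<in> S" for i using S(2)[OF that] by (simp add: cl_def)
    have "(\<Sum>i\<in>S. e i * m 0 i) = (\<Sum>i\<in>S. e i * G 0 c)"
      by (intro sum.cong) (auto simp: m_def cl0)
    also have "\<dots> = (\<Sum>i\<in>S. e i) * G 0 c" by (simp add: sum_distrib_right)
    also have "(\<Sum>i\<in>S. e i) = (\<Sum>i | i \<in> S \<and> cl 0 i = c. e i)"
      by (intro sum.cong) (auto simp: cl0)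
    also have "\<dots> * G 0 c \<le> z 0 * H"
    proof (rule mult_mono)
      have "c \<in> subcells c 0" by (simp add: mem_ibox)
      from z[OF _ this] show "(\<Sum>i | i \<in> S \<and> cl 0 i = c. e i) \<le> z 0" by (simp add: cl_def)
    qed (use G z0 in auto)
    also have "\<dots> \<le> (w 0 * z 0) * H"
    proof -
      have "1 \<le> w 0" by (simp add: w_def Suc_leI)
      then have "1 * z 0 \<le> w 0 * z 0" by (rule mult_right_mono) (use z0 in auto)
      then show ?thesis using H by (simp add: mult_right_mono)
    qed
    finally show ?thesis by (simp add: mult.commute)
  qed
  have step: "(\<Sum>i\<in>S. e i * (m (Suc j) i - m j i)) \<le> H * (w (Suc j) * z (Suc j))" if j: "Suc j \<le> J" for j
  proof -
    let ?b' = "\<lambda>b :: 'd \<Rightarrow> int. \<lambda>i. b i div 2"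
    let ?pred = "\<lambda>b :: 'd \<Rightarrow> int. \<lambda>i. b i - 1"
    have par: "cl j i = ?b' (cl (Suc j) i)" for i
      unfolding cl_def by (rule cell_refine_Suc)
    \<comment> \<open>The lower corner of the parent dominates that of the diagonal predecessor of
      the child. Hence the increment between two levels is at most a diagonal increment on the finer
      level.\<close>
    have low: "G (Suc j) (?pred b) \<le> G j (?b' b)" for b
    proof -
      have "(of_int (b i - 1) :: real) / 2 ^ (a i + Suc j) \<le> of_int (b i div 2) / 2 ^ (a i + j)" for i
      proof -
        have "b i - 1 \<le> b i div 2 * 2" by presburger
        then have "(of_int (b i - 1) :: real) \<le> of_int (b i div 2 * 2)" by (rule of_int_le_iff[THEN iffD2])
        then have "(of_int (b i - 1) :: real) / 2 ^ (a i + Suc j) \<le> of_int (b i div 2 * 2) / 2 ^ (a i + Suc j)"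
          by (rule divide_right_mono) simp
        then show ?thesis by simp
      qed
      then show ?thesis unfolding G_def by (intro gm) (simp add: corner_def less_eq_vec_def)
    qed
    have up: "G j (?b' b) \<le> G (Suc j) b" for b
    proof -
      have "(of_int (b i div 2) :: real) / 2 ^ (a i + j) \<le> of_int (b i) / 2 ^ (a i + Suc j)" for i
      proof -
        have "b i div 2 * 2 \<le> b i" by presburger
        then have "(of_int (b i div 2 * 2) :: real) \<le> of_int (b i)" by (rule of_int_le_iff[THEN iffD2])
        then have "(of_int (b i div 2 * 2) :: real) / 2 ^ (a i + Suc j) \<le> of_int (b i) / 2 ^ (a i + Suc j)"
          by (rule divide_right_mono) simp
        then show ?thesis by simp
      qed
      then show ?thesis unfolding G_def by (intro gm) (simp add: corner_def less_eq_vec_def)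
    qed
    have "(\<Sum>i\<in>S. e i * (m (Suc j) i - m j i))
      = (\<Sum>b\<in>subcells c (Suc j). \<Sum>i | i \<in> S \<and> cl (Suc j) i = b. e i * (m (Suc j) i - m j i))"
      by (rule group)
    also have "\<dots> = (\<Sum>b\<in>subcells c (Suc j). (\<Sum>i | i \<in> S \<and> cl (Suc j) i = b. e i) * (G (Suc j) b - G j (?b' b)))"
      by (intro sum.cong refl) (auto simp: sum_distrib_right m_def par intro!: sum.cong)
    also have "\<dots> \<le> (\<Sum>b\<in>subcells c (Suc j). z (Suc j) * (G (Suc j) b - G (Suc j) (?pred b)))"
    proof (rule sum_mono, rule mult_mono)
      fix b assume b: "b \<in> subcells c (Suc j)"
      show "(\<Sum>i | i \<in> S \<and> cl (Suc j) i = b. e i) \<le> z (Suc j)"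
        using z[OF j b] by (simp add: cl_def)
    qed (use low up z0[OF j] in auto)
    also have "\<dots> = z (Suc j) * (\<Sum>b\<in>subcells c (Suc j). G (Suc j) b - G (Suc j) (?pred b))"
      by (simp add: sum_distrib_left)
    also have "\<dots> \<le> z (Suc j) * (H * w (Suc j))"
    proof (rule mult_left_mono)
      have "(\<Sum>b\<in>subcells c (Suc j). G (Suc j) (?pred (\<lambda>i. b i + 1)) - G (Suc j) (?pred b))
        \<le> H * (real ?d * real (2 ^ Suc j) ^ (?d - 1))"
        by (rule sum_increments_ibox) (use G in auto)
      then show "(\<Sum>b\<in>subcells c (Suc j). G (Suc j) b - G (Suc j) (?pred b)) \<le> H * w (Suc j)"
        by (simp add: w_def)
    qed (use z0[OF j] in auto)
    finally show ?thesis by (simp add: ac_simps)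
  qed
  \<comment> \<open>Below the finest level no cancellation of the noise is exploited: the remainder
    lies between 0 and a diagonal increment, so sums of absolute values suffice.\<close>
  have last: "(\<Sum>i\<in>S. e i * (h i - m J i)) \<le> H * (w J * zA)"
  proof -
    let ?succ = "\<lambda>b :: 'd \<Rightarrow> int. \<lambda>i. b i + 1"
    have lo: "m J i \<le> h i" if "i \<in> S" for i
      using gm[OF corner_cell_le[of "refine a J" "x i"]] gx[OF that] by (simp add: m_def G_def cl_def)
    have hi: "h i \<le> G J (?succ (cl J i))" if "i \<in> S" for i
      using gm[OF le_corner_cell[of "x i" "refine a J"]] gx[OF that] by (simp add: G_def cl_def)
    have incr: "0 \<le> G J (?succ b) - G J b" for b
      unfolding G_def by (simp add: gm corner_mono)
    have "(\<Sum>i\<in>S. e i * (h i - m J i)) \<le> (\<Sum>i\<in>S. \<bar>e i\<bar> * (G J (?succ (cl J i)) - G J (cl J i)))"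
    proof (rule sum_mono)
      fix i assume i: "i \<in> S"
      have "e i * (h i - m J i) \<le> \<bar>e i\<bar> * (h i - m J i)"
        by (rule mult_right_mono) (use lo[OF i] in auto)
      also have "\<dots> \<le> \<bar>e i\<bar> * (G J (?succ (cl J i)) - G J (cl J i))"
        by (rule mult_left_mono) (use hi[OF i] in \<open>auto simp: m_def\<close>)
      finally show "e i * (h i - m J i) \<le> \<bar>e i\<bar> * (G J (?succ (cl J i)) - G J (cl J i))" .
    qed
    also have "\<dots> = (\<Sum>b\<in>subcells c J. \<Sum>i | i \<in> S \<and> cl J i = b. \<bar>e i\<bar> * (G J (?succ (cl J i)) - G J (cl J i)))"
      by (rule group)
    also have "\<dots> = (\<Sum>b\<in>subcells c J. (\<Sum>i | i \<in> S \<and> cl J i = b. \<bar>e i\<bar>) * (G J (?succ b) - G J b))"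
      by (intro sum.cong refl) (auto simp: sum_distrib_right intro!: sum.cong)
    also have "\<dots> \<le> (\<Sum>b\<in>subcells c J. zA * (G J (?succ b) - G J b))"
      by (intro sum_mono mult_right_mono incr) (use zA in \<open>auto simp: cl_def\<close>)
    also have "\<dots> = zA * (\<Sum>b\<in>subcells c J. G J (?succ b) - G J b)" by (simp add: sum_distrib_left)
    also have "\<dots> \<le> zA * (H * w J)"
    proof (rule mult_left_mono)
      have "(\<Sum>b\<in>subcells c J. G J (?succ b) - G J b) \<le> H * (real ?d * real (2 ^ J) ^ (?d - 1))"
        by (rule sum_increments_ibox) (use G in auto)
      then show "(\<Sum>b\<in>subcells c J. G J (?succ b) - G J b) \<le> H * w J" by (simp add: w_def)
    qed (rule zA0)
    finally show ?thesis by (simp add: ac_simps)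
  qed
  have tele: "(\<Sum>i\<in>S. e i * m j i) \<le> H * (\<Sum>j'\<le>j. w j' * z j')" if "j \<le> J" for j
    using that
  proof (induction j)
    case 0
    then show ?case using first by simp
  next
    case (Suc j)
    have "(\<Sum>i\<in>S. e i * m (Suc j) i) = (\<Sum>i\<in>S. e i * m j i) + (\<Sum>i\<in>S. e i * (m (Suc j) i - m j i))"
      by (simp add: sum.distrib[symmetric] algebra_simps)
    also have "\<dots> \<le> H * (\<Sum>j'\<le>j. w j' * z j') + H * (w (Suc j) * z (Suc j))"
      by (intro add_mono Suc.IH step) (use Suc.prems in auto)
    finally show ?case by (simp add: algebra_simps)
  qed
  have "(\<Sum>i\<in>S. e i * h i) = (\<Sum>i\<in>S. e i * m J i) + (\<Sum>i\<in>S. e i * (h i - m J i))"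
    by (simp add: sum.distrib[symmetric] algebra_simps)
  also have "\<dots> \<le> H * (\<Sum>j\<le>J. w j * z j) + H * (w J * zA)"
    by (intro add_mono tele last) simp
  finally show ?thesis by (simp add: w_def algebra_simps)
qed

section \<open>Cells attached to the level boxes\<close>

abbreviation size_of :: "('d::finite \<Rightarrow> nat) \<Rightarrow> nat" where
  "size_of a \<equiv> sum a UNIV"

lemma cell_eq_iff: "cell a x = c \<longleftrightarrow> (\<forall>i. of_int (c i) \<le> 2 ^ a i * x $ i \<and> 2 ^ a i * x $ i < of_int (c i) + 1)"
  unfolding cell_def fun_eq_iff floor_eq_iff by auto

lemma cell_measurable[measurable]: "{x :: real ^ 'd::finite. cell a x = c} \<in> sets borel"
  unfolding cell_eq_iff by measurable

lemma emeasure_cell: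
  "emeasure lborel {x :: real ^ 'd::finite. cell a x = c} = ennreal ((1 / 2) ^ size_of a)"
proof (rule antisym)
  let ?l = "corner a c" and ?u = "corner a (\<lambda>i. c i + 1)"
  have lu: "?l $ i \<le> ?u $ i" for i by (simp add: corner_def divide_right_mono)
  have v: "(\<Prod>i\<in>UNIV. ?u $ i - ?l $ i) = (1 / 2) ^ size_of a"
    by (simp add: corner_def diff_divide_distrib[symmetric] power_sum power_one_over)
  have "{x. cell a x = c} \<subseteq> cbox ?l ?u"
    by (auto simp: cell_eq_iff mem_box_cart corner_def field_simps less_imp_le)
  then have "emeasure lborel {x. cell a x = c} \<le> emeasure lborel (cbox ?l ?u)"
    by (rule emeasure_mono) simp
  then show "emeasure lborel {x. cell a x = c} \<le> ennreal ((1 / 2) ^ size_of a)"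
    by (simp add: emeasure_lborel_box_cart(2)[OF lu] v)
  have "box ?l ?u \<subseteq> {x. cell a x = c}"
    by (auto simp: cell_eq_iff mem_box_cart corner_def field_simps less_imp_le)
  then have "emeasure lborel (box ?l ?u) \<le> emeasure lborel {x. cell a x = c}"
    by (rule emeasure_mono) simp
  then show "ennreal ((1 / 2) ^ size_of a) \<le> emeasure lborel {x. cell a x = c}"
    by (simp add: emeasure_lborel_box_cart(1)[OF lu] v)
qed

text \<open>The interiors of the closures of the pieces may overlap, but only where the values coincide.\<close>

locale level_boxes =
  fixes K :: "nat set" and al be :: "nat \<Rightarrow> real ^ 'd::finite" and col :: "nat \<Rightarrow> real"
    and f :: "real ^ 'd \<Rightarrow> real"
  assumes finite_K: "finite K"
    and al_less_be: "\<And>l i. l \<in> K \<Longrightarrow> al l $ i < be l $ i"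
    and al_ge_0: "\<And>l i. l \<in> K \<Longrightarrow> 0 \<le> al l $ i"
    and be_le_1: "\<And>l i. l \<in> K \<Longrightarrow> be l $ i \<le> 1"
    and f_mono: "mono_on unit_cube f"
    and f_col: "\<And>l x. l \<in> K \<Longrightarrow> x \<in> box (al l) (be l) \<Longrightarrow> f x = col l"
    and null: "unit_cube - (\<Union>l\<in>K. box (al l) (be l)) \<in> null_sets lborel"
begin

definition Omega :: "(real ^ 'd) set" where
  "Omega = (\<Union>l\<in>K. box (al l) (be l))"

text \<open>For \<open>x \<in> Omega\<close> and \<open>valid a x\<close>, the function is constant on the box of side lengths
  \<open>4 / 2 ^ a i\<close> with lower corner \<open>x\<close>.\<close>

definition valid :: "('d \<Rightarrow> nat) \<Rightarrow> real ^ 'd \<Rightarrow> bool" where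
  "valid a x \<longleftrightarrow> (\<exists>l\<in>K. f x = col l \<and> (\<forall>i. x $ i + 4 / 2 ^ a i < be l $ i))"

text \<open>A larger \<open>size_of\<close> means a smaller volume; \<open>to_nat\<close> breaks
  ties between shapes of equal volume, so that the assigned shape is unique.\<close>

definition precedes :: "('d \<Rightarrow> nat) \<Rightarrow> ('d \<Rightarrow> nat) \<Rightarrow> bool" where
  "precedes a b \<longleftrightarrow> size_of a < size_of b \<or> size_of a = size_of b \<and> to_nat a \<le> to_nat b"

text \<open>Every point is assigned a valid shape of maximal volume. This choice is what keeps the cells
  \<open>upcell\<close> from overlapping more than a bounded number of times.\<close>

definition assigned :: "('d \<Rightarrow> nat) \<Rightarrow> (real ^ 'd) set" where
  "assigned a = {x \<in> Omega. valid a x \<and> (\<forall>b. valid b x \<longrightarrow> precedes a b)}"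

text \<open>The box described by \<open>valid b\<close> has volume
  \<open>4 ^ CARD('d) / 2 ^ size_of b\<close>, so these are the points whose constancy boxes are all
  small, of volume at most a constant times \<open>1 / 2 ^ m\<close>. The measure of this set bounds
  both the number of cells of size \<open>m\<close> and the region left without cells.\<close>

definition thin :: "nat \<Rightarrow> (real ^ 'd) set" where
  "thin m = {x \<in> Omega. \<forall>b. valid b x \<longrightarrow> m \<le> size_of b}"

definition active :: "nat \<Rightarrow> (('d \<Rightarrow> nat) \<times> ('d \<Rightarrow> int)) set" where
  "active s = {(a, c). size_of a \<le> s \<and> assigned a \<inter> {x. cell a x = c} \<noteq> {}}"

text \<open>After a shift by two, every point of the shifted cell is more than one and less than
  three cell sides above every point of the original cell, in each coordinate. The box of four cell
  sides in \<open>valid\<close> contains it with one side to spare, and the spare side is what the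
  comparison of different shapes uses.\<close>

abbreviation upcell :: "('d \<Rightarrow> int) \<Rightarrow> 'd \<Rightarrow> int" where
  "upcell c \<equiv> \<lambda>i. c i + 2"

lemma Omega_bounds:
  assumes "x \<in> Omega"
  shows "0 < x $ i \<and> x $ i < 1"
proof -
  obtain l where l: "l \<in> K" "al l $ i < x $ i" "x $ i < be l $ i"
    using assms by (auto simp: Omega_def mem_box_cart)
  then show ?thesis using al_ge_0[OF l(1), of i] be_le_1[OF l(1), of i] by linarith
qed

lemma Omega_subset: "Omega \<subseteq> unit_cube"
  using Omega_bounds by (auto simp: mem_box_cart less_imp_le)

text \<open>The point \<open>x\<close> may lie outside the box of \<open>l\<close>, since
  \<open>valid\<close> restricts only the upper side. The join of \<open>y\<close> with the centre
  of that box lies in the box, so monotonicity squeezes \<open>f y\<close> between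
  \<open>f x\<close> and the value of the box, which are equal.\<close>

lemma valid_const:
  assumes x: "x \<in> unit_cube" "valid a x" and y: "y \<in> unit_cube" "x \<le> y" "\<And>i. y $ i \<le> x $ i + 4 / 2 ^ a i"
  shows "f y = f x"
proof -
  obtain l where l: "l \<in> K" "f x = col l" "\<And>i. x $ i + 4 / 2 ^ a i < be l $ i"
    using x by (auto simp: valid_def)
  define w where "w = (\<chi> i. max (y $ i) ((al l $ i + be l $ i) / 2))"
  have w: "w \<in> box (al l) (be l)"
  proof -
    have "al l $ i < w $ i \<and> w $ i < be l $ i" for i
      using al_less_be[OF l(1), of i] l(3)[of i] y(3)[of i] by (auto simp: w_def less_max_iff_disj)
    then show ?thesis by (simp add: mem_box_cart)
  qed
  then have "w \<in> unit_cube" using l(1) Omega_subset by (auto simp: Omega_def)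
  then have "f y \<le> f w" by (intro mono_onD[OF f_mono] y(1)) (simp_all add: w_def less_eq_vec_def)
  also have "f w = f x" using f_col[OF l(1) w] l(2) by simp
  finally have "f y \<le> f x" .
  moreover have "f x \<le> f y" by (rule mono_onD[OF f_mono x(1) y(1) y(2)])
  ultimately show ?thesis by simp
qed

text \<open>Validity passes to lower points of the same value because it asks for no lower bound by
  \<open>al l\<close>. This makes shapes comparable that were chosen at different points, in
  possibly different overlapping boxes.\<close>

lemma valid_down:
  assumes "valid b y" "x \<le> y" "f x = f y"
  shows "valid b x"
proof -
  obtain l where l: "l \<in> K" "f y = col l" "\<And>i. y $ i + 4 / 2 ^ b i < be l $ i"
    using assms(1) by (auto simp: valid_def)
  have "x $ i + 4 / 2 ^ b i < be l $ i" for i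
  proof -
    have "x $ i \<le> y $ i" using assms(2) by (simp add: less_eq_vec_def)
    then show ?thesis using l(3)[of i] by linarith
  qed
  then show ?thesis using l assms(3) by (auto simp: valid_def)
qed

text \<open>The least admissible exponent in each coordinate loses at most a factor 2 per side, so
  the volume of the resulting box is comparable to the product of the distances to the upper faces.
  Thus points of \<open>thin\<close> lie in hyperbolic corners.\<close>

lemma valid_exists:
  assumes x: "x \<in> box (al l) (be l)" and l: "l \<in> K"
  obtains b where "valid b x" "(\<Prod>i\<in>UNIV. be l $ i - x $ i) \<le> 8 ^ CARD('d) / 2 ^ size_of b"
proof -
  have "\<exists>r. 4 / 2 ^ r < be l $ i - x $ i" for i
  proof -
    have "0 < (be l $ i - x $ i) / 4" using x by (simp add: mem_box_cart)
    then obtain r where "(1 / 2) ^ r < (be l $ i - x $ i) / 4"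
      using real_arch_pow_inv[of "(be l $ i - x $ i) / 4" "1 / 2 :: real"] by auto
    then have "4 / 2 ^ r < be l $ i - x $ i" by (simp add: power_one_over field_simps)
    then show ?thesis ..
  qed
  then have ex: "\<And>i. \<exists>r. 4 / 2 ^ r < be l $ i - x $ i" by blast
  define b where "b i = (LEAST r. 4 / 2 ^ r < be l $ i - x $ i)" for i
  have b: "4 / 2 ^ b i < be l $ i - x $ i" for i
    unfolding b_def by (rule LeastI_ex) (rule ex)
  have up: "be l $ i - x $ i \<le> 8 / 2 ^ b i" for i
  proof (cases "b i")
    case 0
    have "al l $ i < x $ i" using x by (simp add: mem_box_cart)
    then have "be l $ i - x $ i < 1" using al_ge_0[OF l, of i] be_le_1[OF l, of i] by linarith
    then show ?thesis using b[of i] 0 by simp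
  next
    case (Suc r)
    have "\<not> 4 / 2 ^ r < be l $ i - x $ i"
      using Suc unfolding b_def by (intro not_less_Least) simp
    then show ?thesis using Suc by simp
  qed
  have "valid b x"
    unfolding valid_def using l f_col[OF l x] b by (auto simp: algebra_simps intro!: bexI[of _ l])
  moreover have "(\<Prod>i\<in>UNIV. be l $ i - x $ i) \<le> (\<Prod>i\<in>UNIV. 8 / 2 ^ b i)"
    by (rule prod_mono) (use up x in \<open>auto simp: mem_box_cart less_imp_le\<close>)
  then have "(\<Prod>i\<in>UNIV. be l $ i - x $ i) \<le> 8 ^ CARD('d) / 2 ^ size_of b"
    by (simp add: prod_dividef power_sum)
  ultimately show ?thesis by (rule that)
qed

lemma assigned_exists:
  assumes "x \<in> Omega"
  obtains a where "x \<in> assigned a"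
proof -
  obtain b where b: "valid b x" using assms valid_exists unfolding Omega_def by blast
  define m where "m = (LEAST m. \<exists>a. valid a x \<and> size_of a = m)"
  have "\<exists>a. valid a x \<and> size_of a = m" unfolding m_def by (rule LeastI_ex) (use b in auto)
  then have ex: "\<exists>k a. valid a x \<and> size_of a = m \<and> to_nat a = k" by auto
  have mle: "m \<le> size_of a" if "valid a x" for a
    unfolding m_def by (rule Least_le) (use that in auto)
  define k where "k = (LEAST k. \<exists>a. valid a x \<and> size_of a = m \<and> to_nat a = k)"
  have "\<exists>a. valid a x \<and> size_of a = m \<and> to_nat a = k" unfolding k_def by (rule LeastI_ex) (use ex in auto)
  then obtain a where a: "valid a x" "size_of a = m" "to_nat a = k" by auto
  have kle: "k \<le> to_nat a'" if "valid a' x" "size_of a' = m" for a'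
    unfolding k_def by (rule Least_le) (use that in auto)
  have "precedes a b" if "valid b x" for b
    using mle[OF that] kle[OF that] a by (auto simp: precedes_def)
  then show ?thesis using that[of a] a assms by (simp add: assigned_def)
qed

lemma assigned_unique: "x \<in> assigned a \<Longrightarrow> x \<in> assigned b \<Longrightarrow> a = b"
proof -
  assume "x \<in> assigned a" "x \<in> assigned b"
  then have "precedes a b" "precedes b a" by (auto simp: assigned_def)
  then have "to_nat a = to_nat b" by (auto simp: precedes_def)
  then show "a = b" by simp
qed

lemma assigned_valid: "x \<in> assigned a \<Longrightarrow> valid a x" and assigned_Omega: "x \<in> assigned a \<Longrightarrow> x \<in> Omega"
  and assigned_min: "x \<in> assigned a \<Longrightarrow> valid b x \<Longrightarrow> size_of a \<le> size_of b"
  by (auto simp: assigned_def precedes_def)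

lemma assigned_subset_thin: "x \<in> assigned a \<Longrightarrow> m \<le> size_of a \<Longrightarrow> x \<in> thin m"
  using assigned_min assigned_Omega by (fastforce simp: thin_def)

lemma upcell_bounds:
  assumes "cell a x = c" "cell a y = upcell c"
  shows "x $ i + 1 / 2 ^ a i < y $ i" "y $ i < x $ i + 3 / 2 ^ a i"
proof -
  have "of_int (c i) \<le> 2 ^ a i * x $ i" "2 ^ a i * x $ i < of_int (c i) + 1"
    "of_int (c i) + 2 \<le> 2 ^ a i * y $ i" "2 ^ a i * y $ i < of_int (c i) + 3"
    using assms(1)[unfolded cell_eq_iff, rule_format, of i] assms(2)[unfolded cell_eq_iff, rule_format, of i]
    by simp_all
  then show "x $ i + 1 / 2 ^ a i < y $ i" "y $ i < x $ i + 3 / 2 ^ a i"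
    by (simp_all add: field_simps)
qed

lemma upcell_const:
  assumes x: "x \<in> assigned a" "cell a x = c" and y: "cell a y = upcell c"
  shows "y \<in> unit_cube" "x \<le> y" "f y = f x"
proof -
  obtain l where l: "l \<in> K" "\<And>i. x $ i + 4 / 2 ^ a i < be l $ i"
    using assigned_valid[OF x(1)] by (auto simp: valid_def)
  have pos: "(0::real) < 1 / 2 ^ a i" for i by simp
  have lt: "x $ i < y $ i" for i
    using upcell_bounds(1)[OF x(2) y, of i] pos[of i] by linarith
  then show le: "x \<le> y" by (simp add: less_eq_vec_def less_imp_le)
  have up: "y $ i \<le> x $ i + 4 / 2 ^ a i" for i
    using upcell_bounds(2)[OF x(2) y, of i] pos[of i] by (simp add: field_simps)
  have x01: "0 < x $ i" for i using Omega_bounds[OF assigned_Omega[OF x(1)], of i] by simp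
  show yc: "y \<in> unit_cube"
  proof -
    have "0 \<le> y $ i \<and> y $ i \<le> 1" for i
      using lt[of i] up[of i] l(2)[of i] be_le_1[OF l(1), of i] x01[of i] by linarith
    then show ?thesis by (simp add: mem_box_cart)
  qed
  show "f y = f x"
    by (rule valid_const[OF _ assigned_valid[OF x(1)] yc le up]) (use assigned_Omega[OF x(1)] Omega_subset in auto)
qed

text \<open>Both points lie below a common point of the shifted cell and share its value. Hence a
  function that is isotone between points of equal value of \<open>f\<close> is isotone on the
  assigned points of a cell.\<close>

lemma assigned_cell_const:
  assumes "x \<in> assigned a" "x' \<in> assigned a" "cell a x = cell a x'"
  shows "f x = f x'"
proof -
  define y where "y = corner a (upcell (cell a x))"
  have "cell a y = upcell (cell a x)"
    by (simp add: y_def cell_def corner_def)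
  then show ?thesis using upcell_const(3)[OF assms(1) refl] upcell_const(3)[OF assms(2) refl] assms(3) by metis
qed

text \<open>If the shifted cells of \<open>x\<close> and \<open>x'\<close> meet in \<open>y\<close>,
  then \<open>f\<close> agrees at all three points. A box at \<open>x'\<close> whose sides are a
  quarter of the longer of the two sides in each coordinate then still ends below the upper faces of
  the box belonging to \<open>x\<close>, so it is valid. Maximality of the shape at
  \<open>x'\<close> prevents it from being much smaller in any coordinate.\<close>

lemma upcell_shapes_close:
  assumes x: "x \<in> assigned a" "cell a x = c" "cell a y = upcell c"
    and x': "x' \<in> assigned a'" "cell a' x' = c'" "cell a' y = upcell c'"
  shows "a' i \<le> a i + 2 * CARD('d)"
proof -
  obtain l where l: "l \<in> K" "f x = col l" "\<And>i. x $ i + 4 / 2 ^ a i < be l $ i"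
    using assigned_valid[OF x(1)] by (auto simp: valid_def)
  define b where "b i = min (a i) (a' i) + 2" for i
  have "f x' = f x" using upcell_const(3)[OF x] upcell_const(3)[OF x'] by simp
  moreover have "x' $ i + 4 / 2 ^ b i < be l $ i" for i
  proof -
    have "4 / 2 ^ b i = (1 / 2 ^ min (a i) (a' i) :: real)" by (simp add: b_def)
    also have "\<dots> \<le> 1 / 2 ^ a i + 1 / 2 ^ a' i" by (simp add: min_def)
    finally have "x' $ i + 4 / 2 ^ b i \<le> x' $ i + 1 / 2 ^ a' i + 1 / 2 ^ a i" by simp
    also have "\<dots> < y $ i + 1 / 2 ^ a i" using upcell_bounds(1)[OF x'(2,3), of i] by simp
    also have "\<dots> < x $ i + 3 / 2 ^ a i + 1 / 2 ^ a i" using upcell_bounds(2)[OF x(2,3), of i] by simp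
    also have "\<dots> = x $ i + 4 / 2 ^ a i" by (simp add: field_simps)
    finally show ?thesis using l(3)[of i] by simp
  qed
  ultimately have "valid b x'" using l by (auto simp: valid_def)
  moreover have "size_of b = (\<Sum>i\<in>UNIV. min (a i) (a' i)) + 2 * CARD('d)"
  proof -
    have "size_of b = (\<Sum>i\<in>UNIV. b i)" by simp
    then show ?thesis unfolding b_def sum.distrib by simp
  qed
  ultimately have "size_of a' \<le> (\<Sum>i\<in>UNIV. min (a i) (a' i)) + 2 * CARD('d)"
    using assigned_min[OF x'(1)] by metis
  moreover have "size_of a' = (\<Sum>i\<in>UNIV. min (a i) (a' i)) + (\<Sum>i\<in>UNIV. a' i - min (a i) (a' i))"
    by (simp add: sum.distrib[symmetric])
  moreover have "a' i - min (a i) (a' i) \<le> (\<Sum>i\<in>UNIV. a' i - min (a i) (a' i))"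
    by (rule member_le_sum) auto
  ultimately show ?thesis by linarith
qed

lemma finite_shapes: "finite {a :: 'd \<Rightarrow> nat. size_of a \<le> s}"
proof (rule finite_subset)
  show "{a :: 'd \<Rightarrow> nat. size_of a \<le> s} \<subseteq> (\<Pi>\<^sub>E i\<in>UNIV. {0..s})"
  proof
    fix a :: "'d \<Rightarrow> nat" assume a: "a \<in> {a. size_of a \<le> s}"
    have "a i \<le> size_of a" for i by (rule member_le_sum) auto
    then show "a \<in> (\<Pi>\<^sub>E i\<in>UNIV. {0..s})" using a order_trans by fastforce
  qed
qed (simp add: finite_PiE)

lemma finite_act: "finite (active s)"
proof (rule finite_subset)
  show "active s \<subseteq> (SIGMA a:{a. size_of a \<le> s}. (\<Pi>\<^sub>E i\<in>UNIV. {0..2 ^ a i}))"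
  proof
    fix p assume p: "p \<in> active s"
    obtain a c x where ac: "p = (a, c)" "size_of a \<le> s" "x \<in> assigned a" "cell a x = c"
      using p by (auto simp: active_def)
    have "c i \<in> {0..2 ^ a i}" for i
    proof -
      have "0 < x $ i" "x $ i < 1" using Omega_bounds[OF assigned_Omega[OF ac(3)], of i] by auto
      then have "0 \<le> 2 ^ a i * x $ i" "2 ^ a i * x $ i \<le> 2 ^ a i" by auto
      then have "0 \<le> \<lfloor>2 ^ a i * x $ i\<rfloor>" "\<lfloor>2 ^ a i * x $ i\<rfloor> \<le> \<lfloor>2 ^ a i :: real\<rfloor>"
        by (simp, intro floor_mono)
      moreover have "\<lfloor>2 ^ a i :: real\<rfloor> = 2 ^ a i"
        by (metis floor_of_int of_int_numeral of_int_power)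
      ultimately show ?thesis using ac(4) by (auto simp: cell_def)
    qed
    then show "p \<in> (SIGMA a:{a. size_of a \<le> s}. (\<Pi>\<^sub>E i\<in>UNIV. {0..2 ^ a i}))"
      using ac by auto
  qed
qed (intro finite_SigmaI finite_shapes finite_PiE; simp)

text \<open>For a given shape, \<open>y\<close> determines the index of its cell, so only shapes
  have to be counted, and their exponents differ from those of any one of them by at most
  \<open>2 * CARD('d)\<close> in each coordinate.\<close>

lemma upcell_multiplicity:
  "card {(a, c) \<in> active s. cell a y = upcell c} \<le> (4 * CARD('d) + 1) ^ CARD('d)"
proof -
  let ?M = "{(a, c) \<in> active s. cell a y = upcell c}"
  have fin: "finite ?M" using finite_act by (rule finite_subset[rotated]) auto
  show ?thesis
  proof (cases "?M = {}")
    case False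
    then obtain a0 c0 where p0: "(a0, c0) \<in> ?M" by auto
    let ?d = "CARD('d)"
    have inj: "inj_on fst ?M"
    proof (rule inj_onI)
      fix p q assume pq: "p \<in> ?M" "q \<in> ?M" "fst p = fst q"
      obtain a c c' where e: "p = (a, c)" "q = (a, c')" using pq(3) by (metis prod.collapse)
      have "upcell c = upcell c'" using pq(1,2) unfolding e by auto
      then have "c = c'" by (auto simp: fun_eq_iff)
      then show "p = q" by (simp add: e)
    qed
    have "fst ` ?M \<subseteq> (\<Pi>\<^sub>E i\<in>UNIV. {a0 i - 2 * ?d..a0 i + 2 * ?d})"
    proof
      fix a assume "a \<in> fst ` ?M"
      then obtain c where c: "(a, c) \<in> ?M" by auto
      obtain x where x: "x \<in> assigned a" "cell a x = c" "cell a y = upcell c" using c by (auto simp: active_def)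
      obtain x0 where x0: "x0 \<in> assigned a0" "cell a0 x0 = c0" "cell a0 y = upcell c0" using p0 by (auto simp: active_def)
      have "a i \<le> a0 i + 2 * ?d" "a0 i \<le> a i + 2 * ?d" for i
        using upcell_shapes_close[OF x0 x] upcell_shapes_close[OF x x0] by auto
      then show "a \<in> (\<Pi>\<^sub>E i\<in>UNIV. {a0 i - 2 * ?d..a0 i + 2 * ?d})"
        by (auto simp: PiE_iff) (metis add.commute diff_le_mono le_diff_conv)
    qed
    then have "card (fst ` ?M) \<le> card (\<Pi>\<^sub>E i\<in>UNIV. {a0 i - 2 * ?d..a0 i + 2 * ?d})"
      by (intro card_mono finite_PiE) auto
    also have "\<dots> = (\<Prod>i\<in>UNIV. card {a0 i - 2 * ?d..a0 i + 2 * ?d})" by (rule card_PiE) simp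
    also have "\<dots> \<le> (\<Prod>i\<in>(UNIV::'d set). 4 * ?d + 1)" by (rule prod_mono) auto
    also have "\<dots> = (4 * ?d + 1) ^ ?d" by simp
    finally show ?thesis using card_image[OF inj] by simp
  next
    case True
    show ?thesis unfolding True by simp
  qed
qed

section \<open>Measurability and volume of the assigned and the thin sets\<close>

lemma Omega_measurable[measurable]: "Omega \<in> sets borel"
  unfolding Omega_def using finite_K by (intro sets.finite_UN) auto

text \<open>\<open>f\<close> itself need not be Borel, but on \<open>Omega\<close> its value is the
  colour of any box containing the point, which leaves a finite union of Borel sets.\<close>

lemma valid_measurable[measurable]: "{x \<in> Omega. valid a x} \<in> sets borel"
proof -
  have "{x \<in> Omega. valid a x} = (\<Union>l\<in>K. \<Union>l'\<in>{l' \<in> K. col l = col l'}.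
      box (al l) (be l) \<inter> {x. \<forall>i. x $ i + 4 / 2 ^ a i < be l' $ i})"
    unfolding Omega_def valid_def using f_col by fastforce
  also have "\<dots> \<in> sets borel"
    using finite_K by (intro sets.finite_UN sets.Int) measurable
  finally show ?thesis .
qed

lemma assigned_measurable[measurable]: "assigned a \<in> sets borel"
proof -
  have "assigned a = {x \<in> Omega. valid a x} - (\<Union>b\<in>{b. \<not> precedes a b}. {x \<in> Omega. valid b x})"
    by (auto simp: assigned_def)
  also have "\<dots> \<in> sets borel" by (intro sets.Diff sets.countable_UN' valid_measurable) auto
  finally show ?thesis .
qed

lemma thin_measurable[measurable]: "thin m \<in> sets borel"
proof -
  have "thin m = Omega - (\<Union>b\<in>{b. \<not> m \<le> size_of b}. {x \<in> Omega. valid b x})"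
    by (auto simp: thin_def)
  also have "\<dots> \<in> sets borel" by (intro sets.Diff sets.countable_UN' valid_measurable Omega_measurable) auto
  finally show ?thesis .
qed

lemma thin_subset: "thin m \<subseteq> unit_cube"
  using Omega_subset by (auto simp: thin_def)

lemma emeasure_cube[simp]: "emeasure lborel (unit_cube :: (real ^ 'd) set) = 1"
  by (subst emeasure_lborel_box_cart(2)) auto

lemma thin_le_1: "emeasure lborel (thin m) \<le> 1"
  using emeasure_mono[OF thin_subset, of lborel m] by simp

text \<open>A volume count with the shifted cells: each has volume \<open>(1 / 2) ^ m\<close>, they
  overlap boundedly often, and up to a null set they lie in \<open>thin m\<close>, because a shape
  valid at a point of the shifted cell is also valid at the assigned point below it.\<close>

lemma card_act_level:
  "ennreal (real (card {(a, c) \<in> active s. size_of a = m}) * (1 / 2) ^ m)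
    \<le> of_nat ((4 * CARD('d) + 1) ^ CARD('d)) * emeasure lborel (thin m)"
proof -
  let ?A = "{(a, c) \<in> active s. size_of a = m}"
  let ?C = "\<lambda>p. {y :: real ^ 'd. cell (fst p) y = upcell (snd p)}"
  let ?k = "of_nat ((4 * CARD('d) + 1) ^ CARD('d)) :: ennreal"
  have fin: "finite ?A" using finite_act by (rule finite_subset[rotated]) auto
  have Cs: "?C p \<in> sets borel" for p by simp
  have "ennreal (real (card ?A) * (1 / 2) ^ m) = (\<Sum>p\<in>?A. ennreal ((1 / 2) ^ m))"
    by (simp add: ennreal_mult ennreal_of_nat_eq_real_of_nat)
  also have "\<dots> = (\<Sum>p\<in>?A. emeasure lborel (?C p))"
    by (intro sum.cong refl) (auto simp: emeasure_cell)
  also have "\<dots> = (\<Sum>p\<in>?A. \<integral>\<^sup>+y. indicator (?C p) y \<partial>lborel)"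
    using Cs by (intro sum.cong refl nn_integral_indicator[symmetric]) simp
  also have "\<dots> = (\<integral>\<^sup>+y. (\<Sum>p\<in>?A. indicator (?C p) y) \<partial>lborel)"
    using Cs by (intro nn_integral_sum[symmetric] borel_measurable_indicator) simp
  also have "\<dots> \<le> (\<integral>\<^sup>+y. ?k * indicator (thin m \<union> (unit_cube - Omega)) y \<partial>lborel)"
  proof (rule nn_integral_mono)
    fix y :: "real ^ 'd"
    have "(\<Sum>p\<in>?A. indicator (?C p) y) = (of_nat (card {p \<in> ?A. y \<in> ?C p}) :: ennreal)"
      using fin by (simp add: indicator_def sum.If_cases Int_def)
    also have "\<dots> \<le> ?k * indicator (thin m \<union> (unit_cube - Omega)) y"
    proof (cases "{p \<in> ?A. y \<in> ?C p} = {}")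
      case True
      show ?thesis unfolding True by simp
    next
      case False
      then obtain a c where ac: "(a, c) \<in> ?A" "cell a y = upcell c" by auto
      then obtain x where x: "x \<in> assigned a" "cell a x = c" by (auto simp: active_def)
      note uc = upcell_const[OF x ac(2)]
      have "m \<le> size_of b" if "valid b y" for b
        using assigned_min[OF x(1) valid_down[OF that uc(2)]] uc(3) ac(1) by auto
      then have mem: "y \<in> thin m \<union> (unit_cube - Omega)" using uc(1) by (auto simp: thin_def)
      have "card {p \<in> ?A. y \<in> ?C p} \<le> card {(a, c) \<in> active s. cell a y = upcell c}"
        by (rule card_mono) (auto intro: finite_subset[OF _ finite_act])
      also have "\<dots> \<le> (4 * CARD('d) + 1) ^ CARD('d)" by (rule upcell_multiplicity)
      finally have "(of_nat (card {p \<in> ?A. y \<in> ?C p}) :: ennreal) \<le> ?k" by (rule of_nat_mono)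
      then show ?thesis using mem by simp
    qed
    finally show "(\<Sum>p\<in>?A. indicator (?C p) y) \<le> ?k * indicator (thin m \<union> (unit_cube - Omega)) y" .
  qed
  also have "\<dots> = ?k * emeasure lborel (thin m \<union> (unit_cube - Omega))"
    by (rule nn_integral_cmult_indicator) auto
  also have "emeasure lborel (thin m \<union> (unit_cube - Omega)) = emeasure lborel (thin m)"
    by (rule emeasure_Un_null_set) (use null in \<open>auto simp: Omega_def\<close>)
  finally show ?thesis .
qed

text \<open>The threshold \<open>\<tau> * B\<close> splits the boxes by volume. For the small ones
  the union bound costs a factor \<open>card K\<close> and a power of \<open>ln B\<close>. For the
  large ones it is too weak, because overlapping boxes may have a total volume far above 1; there
  the thin set has density at most \<open>\<theta>\<close> in each box, and
  \<open>low_density_cube\<close> bounds the union regardless of overlaps.\<close>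

lemma thin_volume:
  assumes B: "1 \<le> B"
  shows "emeasure lborel (thin m) \<le> ennreal (real (card K) * (exp 1 * (8 ^ CARD('d) / 2 ^ m) * (1 + ln B) ^ CARD('d))
    + (2 * real CARD('d) + 1) * (2 ^ CARD('d) * B powr (- 1 / 2)) powr (1 / 2 ^ CARD('d)))"
proof -
  let ?d = "CARD('d)"
  define \<tau> :: real where "\<tau> = 8 ^ ?d / 2 ^ m"
  have \<tau>: "0 < \<tau>" by (simp add: \<tau>_def)
  define V where "V l = (\<Prod>i\<in>UNIV. be l $ i - al l $ i)" for l
  have V: "0 < V l" if "l \<in> K" for l
    unfolding V_def using al_less_be[OF that] by (intro prod_pos) simp
  define S where "S = {l \<in> K. V l \<le> \<tau> * B}"
  define L where "L = {l \<in> K. \<not> V l \<le> \<tau> * B}"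
  let ?H = "\<lambda>l. {y \<in> box (al l) (be l). (\<Prod>i\<in>UNIV. be l $ i - y $ i) \<le> \<tau>}"
  have sub: "thin m \<inter> box (al l) (be l) \<subseteq> ?H l" if l: "l \<in> K" for l
  proof
    fix y assume y: "y \<in> thin m \<inter> box (al l) (be l)"
    then obtain b where b: "valid b y" "(\<Prod>i\<in>UNIV. be l $ i - y $ i) \<le> 8 ^ ?d / 2 ^ size_of b"
      using valid_exists[OF _ l] by blast
    have "m \<le> size_of b" using y b(1) by (auto simp: thin_def)
    then have "(8 ^ ?d / 2 ^ size_of b :: real) \<le> \<tau>"
      unfolding \<tau>_def by (intro divide_left_mono power_increasing) auto
    then show "y \<in> ?H l" using y b by auto
  qed
  have Hm: "?H l \<in> sets borel" for l by measurable
  have hyp: "emeasure lborel (thin m \<inter> box (al l) (be l)) \<le> ennreal (\<tau> powr (1 - w) * V l powr w * (1 / w) ^ ?d)"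
    if "l \<in> K" "0 < w" "w \<le> 1" for l w
  proof -
    have "emeasure lborel (thin m \<inter> box (al l) (be l)) \<le> emeasure lborel (?H l)"
      by (rule emeasure_mono[OF sub[OF that(1)]]) (use Hm in simp)
    also have "\<dots> \<le> ennreal (\<tau> powr (1 - w) * V l powr w * (1 / w) ^ ?d)"
      unfolding V_def by (rule hyperbolic_corner_volume) (use al_less_be that \<tau> in auto)
    finally show ?thesis .
  qed
  define X where "X = exp 1 * \<tau> * (1 + ln B) ^ ?d"
  have lnB: "0 \<le> ln B" using B by simp
  have small: "emeasure lborel (thin m \<inter> box (al l) (be l)) \<le> ennreal X" if l: "l \<in> S" for l
  proof -
    \<comment> \<open>This choice keeps \<open>B powr w\<close> below \<open>exp 1\<close>, at the
      price of the factor \<open>(1 + ln B) ^ CARD('d)\<close> coming from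
      \<open>1 / w\<close>.\<close>
    define w where "w = 1 / (1 + ln B)"
    have w: "0 < w" "w \<le> 1" using lnB by (auto simp: w_def)
    have lK: "l \<in> K" using l by (simp add: S_def)
    have "V l powr w \<le> (\<tau> * B) powr w"
      by (rule powr_mono2) (use l w V[OF lK] in \<open>auto simp: S_def\<close>)
    also have "\<dots> = \<tau> powr w * B powr w" using \<tau> B by (simp add: powr_mult)
    also have "B powr w \<le> exp 1"
    proof -
      have "w * ln B \<le> 1" using lnB by (simp add: w_def)
      then show ?thesis using B by (simp add: powr_def)
    qed
    finally have "V l powr w \<le> \<tau> powr w * exp 1" by (simp add: mult_left_mono)
    then have "\<tau> powr (1 - w) * V l powr w * (1 / w) ^ ?d \<le> \<tau> powr (1 - w) * (\<tau> powr w * exp 1) * (1 / w) ^ ?d"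
      by (intro mult_right_mono mult_left_mono) (use w in auto)
    also have "\<dots> = (\<tau> powr (1 - w) * \<tau> powr w) * exp 1 * (1 / w) ^ ?d" by simp
    also have "\<tau> powr (1 - w) * \<tau> powr w = \<tau>" using \<tau> by (simp add: powr_add[symmetric])
    finally have "\<tau> powr (1 - w) * V l powr w * (1 / w) ^ ?d \<le> X" by (simp add: X_def w_def ac_simps)
    with hyp[OF lK w] show ?thesis by (meson ennreal_leI order_trans)
  qed
  \<comment> \<open>The bound of \<open>hyperbolic_corner_volume\<close> at
    \<open>w = 1 / 2\<close>, relative to the volume of a box above the threshold.\<close>
  define \<theta> where "\<theta> = 2 ^ ?d * B powr (- 1 / 2)"
  have \<theta>: "0 < \<theta>" using B by (simp add: \<theta>_def)
  have X: "0 \<le> X" using lnB \<tau> by (simp add: X_def)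
  let ?R = "(2 * real ?d + 1) * \<theta> powr (1 / 2 ^ ?d)"
  have big: "emeasure lborel (thin m \<inter> (\<Union>l\<in>L. box (al l) (be l))) \<le> ennreal ?R"
  proof (cases "\<theta> \<le> 1")
    case True
    show ?thesis
    proof (rule low_density_cube)
      show "finite L" using finite_K by (simp add: L_def)
      show "emeasure lborel (thin m \<inter> box (al l) (be l)) \<le> ennreal \<theta> * emeasure lborel (box (al l) (be l))"
        if l: "l \<in> L" for l
      proof -
        have lK: "l \<in> K" using l by (simp add: L_def)
        have VB: "\<tau> * B \<le> V l" using l by (simp add: L_def)
        have Vl: "0 < V l" by (rule V[OF lK])
        have "\<tau> powr (1 / 2) \<le> (V l / B) powr (1 / 2)"
          by (rule powr_mono2) (use VB \<tau> B in \<open>auto simp: field_simps\<close>)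
        also have "\<dots> = V l powr (1 / 2) * B powr (- 1 / 2)"
          using Vl B by (simp add: powr_divide powr_minus_divide)
        finally have "\<tau> powr (1 - 1 / 2) * V l powr (1 / 2) * (1 / (1 / 2)) ^ ?d
          \<le> V l powr (1 / 2) * B powr (- 1 / 2) * V l powr (1 / 2) * (1 / (1 / 2)) ^ ?d"
          by (intro mult_right_mono) auto
        also have "\<dots> = (V l powr (1 / 2) * V l powr (1 / 2)) * \<theta>" by (simp add: \<theta>_def)
        also have "V l powr (1 / 2) * V l powr (1 / 2) = V l" using Vl by (simp add: powr_add[symmetric])
        finally have le: "\<tau> powr (1 - 1 / 2) * V l powr (1 / 2) * (1 / (1 / 2)) ^ ?d \<le> V l * \<theta>" .
        have "emeasure lborel (thin m \<inter> box (al l) (be l)) \<le> ennreal (V l * \<theta>)"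
          using hyp[OF lK, of "1 / 2"] ennreal_leI[OF le] by (auto intro: order_trans)
        also have "\<dots> = ennreal \<theta> * ennreal (V l)" using Vl \<theta> by (simp add: ennreal_mult mult.commute)
        also have "ennreal (V l) = emeasure lborel (box (al l) (be l))"
          unfolding V_def by (rule emeasure_lborel_box_cart(1)[symmetric]) (use al_less_be[OF lK] in \<open>simp add: less_imp_le\<close>)
        finally show ?thesis .
      qed
    qed (use al_ge_0 be_le_1 thin_subset True \<theta> in \<open>auto simp: L_def\<close>)
  next
    case False
    have "1 \<le> \<theta> powr (1 / 2 ^ ?d)" using False by (intro ge_one_powr_ge_zero) auto
    then have "1 * 1 \<le> (2 * real ?d + 1) * \<theta> powr (1 / 2 ^ ?d)" by (intro mult_mono) auto
    then have "(1 :: ennreal) \<le> ennreal ?R" by simp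
    moreover have "emeasure lborel (thin m \<inter> (\<Union>l\<in>L. box (al l) (be l))) \<le> emeasure lborel (thin m)"
      by (rule emeasure_mono) auto
    ultimately show ?thesis using thin_le_1[of m] by (meson order_trans)
  qed
  have fS: "finite S" and fL: "finite L" using finite_K by (auto simp: S_def L_def)
  have "emeasure lborel (\<Union>l\<in>S. thin m \<inter> box (al l) (be l)) \<le> (\<Sum>l\<in>S. emeasure lborel (thin m \<inter> box (al l) (be l)))"
    by (rule emeasure_subadditive_finite) (use fS in auto)
  also have "\<dots> \<le> (\<Sum>l\<in>S. ennreal X)" by (intro sum_mono small)
  also have "\<dots> = ennreal (real (card S) * X)" using X by (simp add: ennreal_mult ennreal_of_nat_eq_real_of_nat)
  also have "\<dots> \<le> ennreal (real (card K) * X)"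
    by (intro ennreal_leI mult_right_mono X) (auto simp: S_def intro!: card_mono finite_K)
  finally have sumS: "emeasure lborel (\<Union>l\<in>S. thin m \<inter> box (al l) (be l)) \<le> ennreal (real (card K) * X)" .
  have "thin m = (\<Union>l\<in>S. thin m \<inter> box (al l) (be l)) \<union> (thin m \<inter> (\<Union>l\<in>L. box (al l) (be l)))"
    by (auto simp: S_def L_def thin_def Omega_def)
  then have "emeasure lborel (thin m) = emeasure lborel ((\<Union>l\<in>S. thin m \<inter> box (al l) (be l)) \<union> (thin m \<inter> (\<Union>l\<in>L. box (al l) (be l))))"
    by simp
  also have "\<dots> \<le> emeasure lborel (\<Union>l\<in>S. thin m \<inter> box (al l) (be l)) + emeasure lborel (thin m \<inter> (\<Union>l\<in>L. box (al l) (be l)))"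
    by (intro emeasure_subadditive) (intro sets.finite_UN sets.Int fS fL; simp)+
  also have "\<dots> \<le> ennreal (real (card K) * X) + ennreal ?R"
    by (intro add_mono sumS big)
  also have "\<dots> = ennreal (real (card K) * X + ?R)"
    using X by (intro ennreal_plus[symmetric] mult_nonneg_nonneg) auto
  finally show ?thesis by (simp add: X_def \<tau>_def \<theta>_def)
qed

text \<open>The deterministic core. With \<open>H\<close> the maximum of \<open>u\<close> on the
  assigned points of a cell, the noise costs \<open>H * W\<close>, and by monotonicity
  \<open>u\<close> is at least \<open>H\<close> on the shifted cell, so the quadratic term pays for
  \<open>H\<close>. Half of that term is spent on the cells, the other half on the remaining points,
  all of which lie in \<open>thin (Suc s)\<close>.\<close>

lemma weighted_sum_bound:
  fixes x :: "nat \<Rightarrow> real ^ 'd" and e u :: "nat \<Rightarrow> real"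
  assumes x: "\<And>i. i < n \<Longrightarrow> x i \<in> Omega"
    and u0: "\<And>i. i < n \<Longrightarrow> 0 \<le> u i"
    and u_mono: "\<And>i j. i < n \<Longrightarrow> j < n \<Longrightarrow> x i \<le> x j \<Longrightarrow> f (x i) = f (x j) \<Longrightarrow> u i \<le> u j"
    and W: "\<And>a c H. (a, c) \<in> active s \<Longrightarrow> 0 \<le> H \<Longrightarrow>
      (\<And>i. i < n \<Longrightarrow> x i \<in> assigned a \<Longrightarrow> cell a (x i) = c \<Longrightarrow> u i \<le> H) \<Longrightarrow>
      (\<Sum>i | i < n \<and> x i \<in> assigned a \<and> cell a (x i) = c. e i * u i) \<le> H * W (a, c)"
    and Q: "Q = real ((4 * CARD('d) + 1) ^ CARD('d)) + 1"
  shows "2 * (\<Sum>i<n. e i * u i) - (\<Sum>i<n. (u i)\<^sup>2)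
    \<le> 2 * (\<Sum>i | i < n \<and> x i \<in> thin (Suc s). (e i)\<^sup>2)
      + (\<Sum>(a, c)\<in>active s. 2 * Q * ((W (a, c))\<^sup>2 / (1 + real (card {i. i < n \<and> cell a (x i) = upcell c}))))"
proof -
  define S where "S p = {i. i < n \<and> x i \<in> assigned (fst p) \<and> cell (fst p) (x i) = snd p}" for p
  define C where "C p = {i. i < n \<and> cell (fst p) (x i) = upcell (snd p)}" for p
  define G where "G = {i. i < n \<and> (\<exists>a. x i \<in> assigned a \<and> size_of a \<le> s)}"
  define R where "R = {i. i < n \<and> x i \<in> thin (Suc s)}"
  define H where "H p = Max (insert 0 (u ` S p))" for p
  have fin: "finite (S p)" "finite (C p)" for p by (auto simp: S_def C_def)
  have finG: "finite G" "finite R" by (auto simp: G_def R_def)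
  have H0: "0 \<le> H p" for p unfolding H_def using fin by (intro Max_ge) auto
  have Hu: "u i \<le> H p" if "i \<in> S p" for i p unfolding H_def using fin that by (intro Max_ge) auto
  have Q0: "0 < Q" unfolding Q by (intro add_nonneg_pos) auto
  have nR: "i \<in> R" if i: "i < n" "i \<notin> G" for i
  proof -
    obtain a where a: "x i \<in> assigned a" using assigned_exists[OF x[OF i(1)]] by blast
    then have "Suc s \<le> size_of a" using i by (auto simp: G_def not_less_eq_eq)
    then show ?thesis using assigned_subset_thin[OF a] i by (simp add: R_def)
  qed
  \<comment> \<open>Uniqueness of the assigned shape puts every point of \<open>G\<close> into
    exactly one active cell.\<close>
  define kap where "kap i = (let a = (SOME a. x i \<in> assigned a) in (a, cell a (x i)))" for i
  have kap: "kap i = (a, cell a (x i))" if "x i \<in> assigned a" for i a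
  proof -
    have "(SOME a. x i \<in> assigned a) = a" using that assigned_unique by blast
    then show ?thesis by (simp add: kap_def)
  qed
  have group: "(\<Sum>i\<in>G. g i) = (\<Sum>p\<in>active s. \<Sum>i\<in>S p. g i)" for g :: "nat \<Rightarrow> real"
  proof -
    have "kap ` G \<subseteq> active s" by (auto simp: G_def active_def kap)
    then have "(\<Sum>i\<in>G. g i) = (\<Sum>p\<in>active s. \<Sum>i\<in>{i \<in> G. kap i = p}. g i)"
      using finG finite_act by (subst sum.group) auto
    also have "\<dots> = (\<Sum>p\<in>active s. \<Sum>i\<in>S p. g i)"
    proof (intro sum.cong refl)
      fix p i assume p: "p \<in> active s"
      show "{i \<in> G. kap i = p} = S p"
        using p by (auto simp: G_def S_def active_def kap)
    qed
    finally show ?thesis .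
  qed
  have Wp: "(\<Sum>i\<in>S p. e i * u i) \<le> H p * W p" if p: "p \<in> active s" for p
  proof -
    obtain a c where ac: "p = (a, c)" by (cases p)
    have "(\<Sum>i | i < n \<and> x i \<in> assigned a \<and> cell a (x i) = c. e i * u i) \<le> H p * W (a, c)"
      by (rule W) (use p ac H0 Hu in \<open>auto simp: S_def\<close>)
    then show ?thesis by (simp add: ac S_def)
  qed
  \<comment> \<open>The summand 1 stands for the design point that attains the maximum. It keeps the
    later denominator positive when the shifted cell contains no design point.\<close>
  have HS: "(H p)\<^sup>2 * (1 + real (card (C p))) \<le> (\<Sum>i\<in>S p. (u i)\<^sup>2) + (\<Sum>i\<in>C p. (u i)\<^sup>2)"
    if p: "p \<in> active s" for p
  proof (cases "H p = 0")
    case True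
    then show ?thesis by (simp add: sum_nonneg)
  next
    case False
    have "H p \<in> insert 0 (u ` S p)" unfolding H_def using fin by (intro Max_in) auto
    then obtain i where i: "i \<in> S p" "H p = u i" using False by auto
    obtain a c where ac: "p = (a, c)" by (cases p)
    have iT: "i < n" "x i \<in> assigned a" "cell a (x i) = c" using i by (auto simp: S_def ac)
    have "u i \<le> u j" if j: "j \<in> C p" for j
    proof (rule u_mono)
      have cj: "cell a (x j) = upcell c" using j by (simp add: C_def ac)
      show "x i \<le> x j" "f (x i) = f (x j)" using upcell_const[OF iT(2,3) cj] by auto
    qed (use iT j in \<open>auto simp: C_def\<close>)
    then have "(\<Sum>j\<in>C p. (H p)\<^sup>2) \<le> (\<Sum>j\<in>C p. (u j)\<^sup>2)"
      unfolding i(2) by (intro sum_mono power_mono) (use u0 iT in auto)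
    moreover have "(u i)\<^sup>2 \<le> (\<Sum>i\<in>S p. (u i)\<^sup>2)" by (rule member_le_sum) (use i fin in auto)
    ultimately show ?thesis by (simp add: i(2) algebra_simps)
  qed
  have CC: "(\<Sum>p\<in>active s. \<Sum>i\<in>C p. (u i)\<^sup>2) \<le> (Q - 1) * (\<Sum>i<n. (u i)\<^sup>2)"
  proof -
    have "(\<Sum>p\<in>active s. \<Sum>i\<in>C p. (u i)\<^sup>2) = (\<Sum>p\<in>active s. \<Sum>i | i \<in> {..<n} \<and> cell (fst p) (x i) = upcell (snd p). (u i)\<^sup>2)"
      by (simp add: C_def)
    also have "\<dots> = (\<Sum>i<n. \<Sum>p | p \<in> active s \<and> cell (fst p) (x i) = upcell (snd p). (u i)\<^sup>2)"
      by (rule sum.swap_restrict) (use finite_act in auto)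
    also have "\<dots> \<le> (\<Sum>i<n. (Q - 1) * (u i)\<^sup>2)"
    proof (rule sum_mono)
      fix i
      have "{p. p \<in> active s \<and> cell (fst p) (x i) = upcell (snd p)} = {(a, c) \<in> active s. cell a (x i) = upcell c}" by auto
      then have "real (card {p. p \<in> active s \<and> cell (fst p) (x i) = upcell (snd p)}) \<le> Q - 1"
        using upcell_multiplicity[of s "x i"] by (simp add: Q del: of_nat_power)
      then show "(\<Sum>p | p \<in> active s \<and> cell (fst p) (x i) = upcell (snd p). (u i)\<^sup>2) \<le> (Q - 1) * (u i)\<^sup>2"
        by (simp add: mult_right_mono)
    qed
    finally show ?thesis by (simp add: sum_distrib_left)
  qed
  have GU: "(\<Sum>i\<in>G. (u i)\<^sup>2) \<le> (\<Sum>i<n. (u i)\<^sup>2)" by (rule sum_mono2) (auto simp: G_def)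
  define Z where "Z p = (W p)\<^sup>2 / (1 + real (card (C p)))" for p
  \<comment> \<open>The weight \<open>2 * Q\<close> is chosen so that the first terms add up to half
    of the quadratic term. In \<open>Q\<close>, the multiplicity accounts for the shifted cells and
    the additional 1 for the cells themselves.\<close>
  have amgm: "2 * (H p * W p) \<le> (H p)\<^sup>2 * (1 + real (card (C p))) / (2 * Q) + 2 * Q * Z p" for p
  proof -
    define N where "N = 1 + real (card (C p))"
    have N: "0 < N" by (simp add: N_def)
    have "0 \<le> (H p * N - 2 * Q * W p)\<^sup>2 / (2 * Q * N)" using N Q0 by simp
    also have "\<dots> = (H p)\<^sup>2 * N / (2 * Q) + 2 * Q * ((W p)\<^sup>2 / N) - 2 * (H p * W p)"
      using N Q0 by (simp add: field_simps power2_eq_square)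
    finally show ?thesis by (simp add: Z_def N_def)
  qed
  have "2 * (\<Sum>i\<in>G. e i * u i) = (\<Sum>p\<in>active s. 2 * (\<Sum>i\<in>S p. e i * u i))"
    by (simp add: group sum_distrib_left)
  also have "\<dots> \<le> (\<Sum>p\<in>active s. (H p)\<^sup>2 * (1 + real (card (C p))) / (2 * Q) + 2 * Q * Z p)"
  proof (rule sum_mono)
    fix p assume "p \<in> active s"
    then show "2 * (\<Sum>i\<in>S p. e i * u i) \<le> (H p)\<^sup>2 * (1 + real (card (C p))) / (2 * Q) + 2 * Q * Z p"
      using Wp[of p] amgm[of p] by linarith
  qed
  also have "\<dots> = (\<Sum>p\<in>active s. (H p)\<^sup>2 * (1 + real (card (C p)))) / (2 * Q) + (\<Sum>p\<in>active s. 2 * Q * Z p)"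
    by (simp add: sum.distrib sum_divide_distrib)
  also have "\<dots> \<le> (Q * (\<Sum>i<n. (u i)\<^sup>2)) / (2 * Q) + (\<Sum>p\<in>active s. 2 * Q * Z p)"
  proof (intro add_right_mono divide_right_mono)
    have "(\<Sum>p\<in>active s. (H p)\<^sup>2 * (1 + real (card (C p)))) \<le> (\<Sum>p\<in>active s. (\<Sum>i\<in>S p. (u i)\<^sup>2) + (\<Sum>i\<in>C p. (u i)\<^sup>2))"
      by (rule sum_mono) (rule HS)
    also have "\<dots> = (\<Sum>i\<in>G. (u i)\<^sup>2) + (\<Sum>p\<in>active s. \<Sum>i\<in>C p. (u i)\<^sup>2)" by (simp add: sum.distrib group)
    also have "\<dots> \<le> (\<Sum>i<n. (u i)\<^sup>2) + (Q - 1) * (\<Sum>i<n. (u i)\<^sup>2)" by (rule add_mono[OF GU CC])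
    finally show "(\<Sum>p\<in>active s. (H p)\<^sup>2 * (1 + real (card (C p)))) \<le> Q * (\<Sum>i<n. (u i)\<^sup>2)"
      by (simp add: algebra_simps)
  qed (use Q0 in auto)
  finally have partG: "2 * (\<Sum>i\<in>G. e i * u i) \<le> (\<Sum>i<n. (u i)\<^sup>2) / 2 + (\<Sum>p\<in>active s. 2 * Q * Z p)"
    using Q0 by simp
  have "2 * (\<Sum>i\<in>{..<n} - G. e i * u i) = (\<Sum>i\<in>{..<n} - G. 2 * (e i * u i))" by (simp add: sum_distrib_left)
  also have "\<dots> \<le> (\<Sum>i\<in>{..<n} - G. (u i)\<^sup>2 / 2 + 2 * (e i)\<^sup>2)"
  proof (rule sum_mono)
    fix i
    have "0 \<le> (u i - 2 * e i)\<^sup>2 / 2" by simp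
    also have "\<dots> = (u i)\<^sup>2 / 2 + 2 * (e i)\<^sup>2 - 2 * (e i * u i)" by (simp add: power2_eq_square field_simps)
    finally show "2 * (e i * u i) \<le> (u i)\<^sup>2 / 2 + 2 * (e i)\<^sup>2" by simp
  qed
  also have "\<dots> = (\<Sum>i\<in>{..<n} - G. (u i)\<^sup>2) / 2 + 2 * (\<Sum>i\<in>{..<n} - G. (e i)\<^sup>2)"
    by (simp add: sum.distrib sum_divide_distrib sum_distrib_left)
  also have "\<dots> \<le> (\<Sum>i<n. (u i)\<^sup>2) / 2 + 2 * (\<Sum>i\<in>R. (e i)\<^sup>2)"
    using sum_mono2[of "{..<n}" "{..<n} - G" "\<lambda>i. (u i)\<^sup>2"] sum_mono2[OF finG(2), of "{..<n} - G" "\<lambda>i. (e i)\<^sup>2"] nR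
    by fastforce
  finally have partR: "2 * (\<Sum>i\<in>{..<n} - G. e i * u i) \<le> (\<Sum>i<n. (u i)\<^sup>2) / 2 + 2 * (\<Sum>i\<in>R. (e i)\<^sup>2)" .
  have "(\<Sum>i<n. e i * u i) = (\<Sum>i\<in>{..<n} - G. e i * u i) + (\<Sum>i\<in>G. e i * u i)"
    by (rule sum.subset_diff) (auto simp: G_def)
  then have "2 * (\<Sum>i<n. e i * u i) - (\<Sum>i<n. (u i)\<^sup>2) \<le> 2 * (\<Sum>i\<in>R. (e i)\<^sup>2) + (\<Sum>p\<in>active s. 2 * Q * Z p)"
    using partG partR by simp
  also have "(\<Sum>p\<in>active s. 2 * Q * Z p) = (\<Sum>(a, c)\<in>active s. 2 * Q * ((W (a, c))\<^sup>2 / (1 + real (card {i. i < n \<and> cell a (x i) = upcell c}))))"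
    by (intro sum.cong refl) (auto simp: Z_def C_def)
  finally show ?thesis by (simp add: R_def)
qed

end

section \<open>Expectations of products over the sample\<close>

lemma prob_space_std_normal: "prob_space std_normal"
  by (rule prob_space_normal_density) simp

lemma nn_integral_exp_std_normal:
  "(\<integral>\<^sup>+x. ennreal (exp (t * x)) \<partial>std_normal) = ennreal (exp (t\<^sup>2 / 2))"
proof -
  have "(\<integral>\<^sup>+x. ennreal (exp (t * x)) \<partial>std_normal) = (\<integral>\<^sup>+x. ennreal (std_normal_density x) * ennreal (exp (t * x)) \<partial>lborel)"
    by (rule nn_integral_density) auto
  also have "\<dots> = (\<integral>\<^sup>+x. ennreal (exp (t\<^sup>2 / 2)) * ennreal (normal_density t 1 x) \<partial>lborel)"
  proof (rule nn_integral_cong)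
    fix x :: real
    have "- x\<^sup>2 / 2 + t * x = t\<^sup>2 / 2 + - (x - t)\<^sup>2 / 2" by (simp add: power2_eq_square field_simps)
    then have "exp (- x\<^sup>2 / 2) * exp (t * x) = exp (t\<^sup>2 / 2) * exp (- (x - t)\<^sup>2 / 2)"
      by (metis exp_add)
    then have "std_normal_density x * exp (t * x) = exp (t\<^sup>2 / 2) * normal_density t 1 x"
      by (simp add: normal_density_def field_simps)
    then show "ennreal (std_normal_density x) * ennreal (exp (t * x)) = ennreal (exp (t\<^sup>2 / 2)) * ennreal (normal_density t 1 x)"
      by (simp add: ennreal_mult[symmetric])
  qed
  also have "\<dots> = ennreal (exp (t\<^sup>2 / 2)) * (\<integral>\<^sup>+x. ennreal (normal_density t 1 x) \<partial>lborel)"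
    by (rule nn_integral_cmult) simp
  also have "(\<integral>\<^sup>+x. ennreal (normal_density t 1 x) \<partial>lborel) = 1"
    using prob_space.emeasure_space_1[OF prob_space_normal_density[of 1 t]] by (simp add: emeasure_density)
  finally show ?thesis by simp
qed

lemma nn_integral_exp_abs_std_normal:
  "(\<integral>\<^sup>+x. ennreal (exp \<bar>x\<bar>) \<partial>std_normal) \<le> ennreal (2 * exp (1 / 2))"
proof -
  have "(\<integral>\<^sup>+x. ennreal (exp \<bar>x\<bar>) \<partial>std_normal) \<le> (\<integral>\<^sup>+x. ennreal (exp (1 * x)) + ennreal (exp ((- 1) * x)) \<partial>std_normal)"
    by (intro nn_integral_mono) (auto simp: ennreal_plus[symmetric] abs_if intro!: ennreal_leI simp del: ennreal_plus)
  also have "\<dots> = (\<integral>\<^sup>+x. ennreal (exp (1 * x)) \<partial>std_normal) + (\<integral>\<^sup>+x. ennreal (exp ((- 1) * x)) \<partial>std_normal)"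
    by (rule nn_integral_add) auto
  also have "\<dots> = ennreal (2 * exp (1 / 2))"
    unfolding nn_integral_exp_std_normal by (simp add: ennreal_plus[symmetric] del: ennreal_plus)
  finally show ?thesis .
qed

lemma square_le_exp_abs: "x\<^sup>2 \<le> 2 * exp \<bar>x :: real\<bar>"
proof -
  have "1 + \<bar>x\<bar> + \<bar>x\<bar>\<^sup>2 / 2 \<le> exp \<bar>x\<bar>" by (rule exp_lower_Taylor_quadratic) simp
  moreover have "\<bar>x\<bar>\<^sup>2 = x\<^sup>2" by simp
  ultimately show ?thesis using abs_ge_zero[of x] by linarith
qed

lemma exp_half_le: "exp (1 / 2 :: real) \<le> 2"
proof -
  have "exp (1 / 2 :: real) \<le> 1 + 1 / 2 + (1 / 2)\<^sup>2" by (rule exp_bound) auto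
  also have "\<dots> \<le> (2 :: real)" by (simp add: power2_eq_square)
  finally show ?thesis .
qed

lemma nn_integral_square_std_normal:
  "(\<integral>\<^sup>+x. ennreal (x\<^sup>2) \<partial>std_normal) \<le> ennreal 8"
proof -
  have "(\<integral>\<^sup>+x. ennreal (x\<^sup>2) \<partial>std_normal) \<le> (\<integral>\<^sup>+x. ennreal 2 * ennreal (exp \<bar>x\<bar>) \<partial>std_normal)"
    by (intro nn_integral_mono) (simp add: ennreal_mult[symmetric] square_le_exp_abs ennreal_leI del: ennreal_numeral)
  also have "\<dots> = ennreal 2 * (\<integral>\<^sup>+x. ennreal (exp \<bar>x\<bar>) \<partial>std_normal)"
    by (rule nn_integral_cmult) auto
  also have "\<dots> \<le> ennreal 2 * ennreal (2 * exp (1 / 2))"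
    by (rule mult_left_mono[OF nn_integral_exp_abs_std_normal]) simp
  also have "\<dots> = ennreal (4 * exp (1 / 2))" by (simp add: ennreal_mult[symmetric] del: ennreal_numeral)
  also have "\<dots> \<le> ennreal 8" using exp_half_le by (intro ennreal_leI) simp
  finally show ?thesis .
qed

section \<open>Means of products over an independent sample\<close>

locale design =
  fixes P :: "(real ^ 'd::finite) measure" and n :: nat
  assumes prob_P: "prob_space P"
begin

sublocale P: prob_space P by (rule prob_P)
sublocale N: prob_space std_normal by (rule prob_space_std_normal)

abbreviation law :: "((nat \<Rightarrow> real ^ 'd) \<times> (nat \<Rightarrow> real)) measure" where
  "law \<equiv> sample_law P n"

text \<open>Tonelli's theorem, with the noise integrated first for a fixed design. Functions of
  position and noise are treated jointly, so no conditioning on the number of points in a cell is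
  ever required.\<close>

lemma nn_integral_sample_prod:
  fixes g :: "nat \<Rightarrow> (real ^ 'd) \<times> real \<Rightarrow> ennreal"
  assumes g[measurable]: "\<And>i. i < n \<Longrightarrow> g i \<in> borel_measurable (P \<Otimes>\<^sub>M std_normal)"
  shows "(\<lambda>\<omega>. \<Prod>i<n. g i (fst \<omega> i, snd \<omega> i)) \<in> borel_measurable law"
    and "(\<integral>\<^sup>+\<omega>. (\<Prod>i<n. g i (fst \<omega> i, snd \<omega> i)) \<partial>law) = (\<Prod>i<n. \<integral>\<^sup>+x. \<integral>\<^sup>+t. g i (x, t) \<partial>std_normal \<partial>P)"
proof -
  interpret pP: product_prob_space "\<lambda>_::nat. P" "{..<n}" ..
  interpret pN: product_prob_space "\<lambda>_::nat. std_normal" "{..<n}" ..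
  have sfN: "sigma_finite_measure (\<Pi>\<^sub>M i\<in>{..<n}. std_normal)"
    by (intro prob_space_imp_sigma_finite prob_space_PiM prob_space_std_normal)
  have pm: "(\<lambda>\<omega>. (fst \<omega> i, snd \<omega> i)) \<in> measurable ((\<Pi>\<^sub>M i\<in>{..<n}. P) \<Otimes>\<^sub>M (\<Pi>\<^sub>M i\<in>{..<n}. std_normal)) (P \<Otimes>\<^sub>M std_normal)"
    if "i < n" for i
    using that by (intro measurable_Pair measurable_compose[OF measurable_fst] measurable_compose[OF measurable_snd]
        measurable_component_singleton) auto
  have gm: "(\<lambda>\<omega>. g i (fst \<omega> i, snd \<omega> i)) \<in> borel_measurable ((\<Pi>\<^sub>M i\<in>{..<n}. P) \<Otimes>\<^sub>M (\<Pi>\<^sub>M i\<in>{..<n}. std_normal))"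
    if "i < n" for i
    by (rule measurable_compose[OF pm[OF that] g[OF that]])
  show m: "(\<lambda>\<omega>. \<Prod>i<n. g i (fst \<omega> i, snd \<omega> i)) \<in> borel_measurable law"
    unfolding sample_law_def by (intro borel_measurable_prod_ennreal gm) auto
  have gx: "(\<lambda>t. g i (x, t)) \<in> borel_measurable std_normal" if "i < n" "x \<in> space P" for i x
    using measurable_compose[OF measurable_Pair1'[OF that(2)] g[OF that(1)]] .
  have gI: "(\<lambda>x. \<integral>\<^sup>+t. g i (x, t) \<partial>std_normal) \<in> borel_measurable P" if "i < n" for i
    using g[OF that] by (intro N.borel_measurable_nn_integral) simp
  have "(\<integral>\<^sup>+\<omega>. (\<Prod>i<n. g i (fst \<omega> i, snd \<omega> i)) \<partial>law)
    = (\<integral>\<^sup>+x. \<integral>\<^sup>+e. (\<Prod>i<n. g i (x i, e i)) \<partial>(\<Pi>\<^sub>M i\<in>{..<n}. std_normal) \<partial>(\<Pi>\<^sub>M i\<in>{..<n}. P))"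
    using sigma_finite_measure.nn_integral_fst[OF sfN m[unfolded sample_law_def]] by (simp add: sample_law_def)
  also have "\<dots> = (\<integral>\<^sup>+x. (\<Prod>i<n. \<integral>\<^sup>+t. g i (x i, t) \<partial>std_normal) \<partial>(\<Pi>\<^sub>M i\<in>{..<n}. P))"
  proof (rule nn_integral_cong)
    fix x assume "x \<in> space (\<Pi>\<^sub>M i\<in>{..<n}. P)"
    then have "x i \<in> space P" if "i < n" for i using that by (auto simp: space_PiM PiE_iff)
    then show "(\<integral>\<^sup>+e. (\<Prod>i<n. g i (x i, e i)) \<partial>(\<Pi>\<^sub>M i\<in>{..<n}. std_normal)) = (\<Prod>i<n. \<integral>\<^sup>+t. g i (x i, t) \<partial>std_normal)"
      by (intro pN.product_nn_integral_prod) (use gx in auto)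
  qed
  also have "\<dots> = (\<Prod>i<n. \<integral>\<^sup>+x. \<integral>\<^sup>+t. g i (x, t) \<partial>std_normal \<partial>P)"
    by (rule pP.product_nn_integral_prod) (use gI in auto)
  finally show "(\<integral>\<^sup>+\<omega>. (\<Prod>i<n. g i (fst \<omega> i, snd \<omega> i)) \<partial>law) = (\<Prod>i<n. \<integral>\<^sup>+x. \<integral>\<^sup>+t. g i (x, t) \<partial>std_normal \<partial>P)" .
qed

lemma emeasure_law: "emeasure law (space law) = 1"
  using nn_integral_sample_prod(2)[of "\<lambda>_ _. 1"] P.emeasure_space_1 N.emeasure_space_1
  by simp

text \<open>A calculus of measurable majorants. Quantities that depend on the estimator, or on all
  isotone functions at once, are bounded pointwise by such an \<open>F\<close>, so their own
  measurability never has to be established.\<close>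

definition mean_le :: "((nat \<Rightarrow> real ^ 'd) \<times> (nat \<Rightarrow> real) \<Rightarrow> real) \<Rightarrow> real \<Rightarrow> bool" where
  "mean_le F v \<longleftrightarrow> F \<in> borel_measurable law \<and> (\<forall>\<omega>. 0 \<le> F \<omega>) \<and> 0 \<le> v \<and> (\<integral>\<^sup>+\<omega>. ennreal (F \<omega>) \<partial>law) \<le> ennreal v"

lemma mean_le_mono: "mean_le F v \<Longrightarrow> v \<le> v' \<Longrightarrow> mean_le F v'"
  unfolding mean_le_def using ennreal_leI order_trans by fastforce

lemma mean_le_const: "0 \<le> c \<Longrightarrow> mean_le (\<lambda>_. c) c"
  unfolding mean_le_def using emeasure_law by simp

lemma mean_le_add:
  assumes "mean_le F v" "mean_le G w"
  shows "mean_le (\<lambda>\<omega>. F \<omega> + G \<omega>) (v + w)"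
proof -
  have "(\<integral>\<^sup>+\<omega>. ennreal (F \<omega> + G \<omega>) \<partial>law) = (\<integral>\<^sup>+\<omega>. ennreal (F \<omega>) + ennreal (G \<omega>) \<partial>law)"
    using assms by (intro nn_integral_cong ennreal_plus) (auto simp: mean_le_def)
  also have "\<dots> = (\<integral>\<^sup>+\<omega>. ennreal (F \<omega>) \<partial>law) + (\<integral>\<^sup>+\<omega>. ennreal (G \<omega>) \<partial>law)"
    using assms by (intro nn_integral_add) (auto simp: mean_le_def)
  also have "\<dots> \<le> ennreal v + ennreal w" using assms by (intro add_mono) (auto simp: mean_le_def)
  also have "\<dots> = ennreal (v + w)" using assms by (simp add: mean_le_def)
  finally show ?thesis using assms by (auto simp: mean_le_def)
qed

lemma mean_le_cmult:
  assumes "mean_le F v" "0 \<le> c"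
  shows "mean_le (\<lambda>\<omega>. c * F \<omega>) (c * v)"
proof -
  have "(\<integral>\<^sup>+\<omega>. ennreal (c * F \<omega>) \<partial>law) = (\<integral>\<^sup>+\<omega>. ennreal c * ennreal (F \<omega>) \<partial>law)"
    using assms by (intro nn_integral_cong ennreal_mult) (auto simp: mean_le_def)
  also have "\<dots> = ennreal c * (\<integral>\<^sup>+\<omega>. ennreal (F \<omega>) \<partial>law)"
    using assms by (intro nn_integral_cmult) (auto simp: mean_le_def)
  also have "\<dots> \<le> ennreal c * ennreal v" using assms by (intro mult_left_mono) (auto simp: mean_le_def)
  also have "\<dots> = ennreal (c * v)" using assms by (simp add: mean_le_def ennreal_mult)
  finally show ?thesis using assms by (auto simp: mean_le_def)
qed

lemma mean_le_sum:
  assumes "\<And>i. i \<in> I \<Longrightarrow> mean_le (F i) (v i)"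
  shows "mean_le (\<lambda>\<omega>. \<Sum>i\<in>I. F i \<omega>) (\<Sum>i\<in>I. v i)"
  using assms
proof (induction I rule: infinite_finite_induct)
  case (insert i I)
  then show ?case using mean_le_add[of "F i" "v i"] by simp
qed (simp_all add: mean_le_const)

lemma mean_le_prod:
  assumes g: "\<And>i. i < n \<Longrightarrow> g i \<in> borel_measurable (P \<Otimes>\<^sub>M std_normal)" "\<And>i p. i < n \<Longrightarrow> 0 \<le> g i p"
    and F: "\<And>\<omega>. F \<omega> = (\<Prod>i<n. g i (fst \<omega> i, snd \<omega> i))"
    and v: "\<And>i. i < n \<Longrightarrow> (\<integral>\<^sup>+x. \<integral>\<^sup>+t. ennreal (g i (x, t)) \<partial>std_normal \<partial>P) \<le> ennreal (v i)" "\<And>i. i < n \<Longrightarrow> 0 \<le> v i"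
  shows "mean_le F (\<Prod>i<n. v i)"
proof -
  have e: "(\<lambda>\<omega>. ennreal (F \<omega>)) = (\<lambda>\<omega>. \<Prod>i<n. ennreal (g i (fst \<omega> i, snd \<omega> i)))"
    unfolding F by (intro ext prod_ennreal[symmetric]) (use g(2) in auto)
  have "(\<integral>\<^sup>+\<omega>. ennreal (F \<omega>) \<partial>law) = (\<Prod>i<n. \<integral>\<^sup>+x. \<integral>\<^sup>+t. ennreal (g i (x, t)) \<partial>std_normal \<partial>P)"
    unfolding e by (rule nn_integral_sample_prod(2)) (use g(1) in auto)
  also have "\<dots> \<le> (\<Prod>i<n. ennreal (v i))"
    by (rule prod_mono_ennreal) (use v in auto)
  also have "\<dots> = ennreal (\<Prod>i<n. v i)" by (rule prod_ennreal) (use v in auto)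
  finally have le: "(\<integral>\<^sup>+\<omega>. ennreal (F \<omega>) \<partial>law) \<le> ennreal (\<Prod>i<n. v i)" .
  \<comment> \<open>Measurability is available for the product in \<open>ennreal\<close> and is
    carried back to the real-valued \<open>F\<close>, which is nonnegative.\<close>
  have "(\<lambda>\<omega>. enn2real (ennreal (F \<omega>))) \<in> borel_measurable law"
    unfolding fun_cong[OF e] using nn_integral_sample_prod(1)[of "\<lambda>i p. ennreal (g i p)"] g(1)
    by (intro measurable_compose[OF _ borel_measurable_enn2real]) auto
  moreover have "0 \<le> F \<omega>" for \<omega> unfolding F using g(2) by (intro prod_nonneg) auto
  ultimately show ?thesis using le v(2) by (auto simp: mean_le_def intro!: prod_nonneg)
qed

lemma mean_le_single:
  assumes i: "i < n" and g: "g \<in> borel_measurable (P \<Otimes>\<^sub>M std_normal)" "\<And>p. 0 \<le> g p"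
    and v: "(\<integral>\<^sup>+x. \<integral>\<^sup>+t. ennreal (g (x, t)) \<partial>std_normal \<partial>P) \<le> ennreal v" "0 \<le> v"
  shows "mean_le (\<lambda>\<omega>. g (fst \<omega> i, snd \<omega> i)) v"
proof -
  have "mean_le (\<lambda>\<omega>. g (fst \<omega> i, snd \<omega> i)) (\<Prod>j<n. if j = i then v else 1)"
  proof (rule mean_le_prod[where g = "\<lambda>j p. if j = i then g p else 1"])
    show "g (fst \<omega> i, snd \<omega> i) = (\<Prod>j<n. if j = i then g (fst \<omega> j, snd \<omega> j) else 1)" for \<omega>
      using i by (simp add: prod.delta)
    show "(\<integral>\<^sup>+x. \<integral>\<^sup>+t. ennreal (if j = i then g (x, t) else 1) \<partial>std_normal \<partial>P) \<le> ennreal (if j = i then v else 1)" for j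
      using v P.emeasure_space_1 N.emeasure_space_1 by (cases "j = i") auto
  qed (use g v in auto)
  then show ?thesis using i by (simp add: prod.delta)
qed

end

text \<open>The pair \<open>rho\<close>, \<open>sg\<close> will be the identity with 1 or the
  reflection of the cube with -1, so that both signs of \<open>h\<close> are covered by the same
  lemmas. Of the density only the two-sided comparison with Lebesgue measure is kept.\<close>

locale mapped_design = design P n for P :: "(real ^ 'd::finite) measure" and n +
  fixes rho :: "real ^ 'd \<Rightarrow> real ^ 'd" and sg m0 M0 :: real
  assumes rho: "rho \<in> measurable P borel" and sg: "\<bar>sg\<bar> = 1" and m0: "0 < m0" "m0 \<le> M0"
    and upper: "\<And>Q. Q \<in> sets borel \<Longrightarrow> emeasure P {x \<in> space P. rho x \<in> Q} \<le> ennreal M0 * emeasure lborel Q"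
    and lower: "\<And>Q. Q \<in> sets borel \<Longrightarrow> Q \<subseteq> unit_cube \<Longrightarrow>
      ennreal m0 * emeasure lborel Q \<le> emeasure P {x \<in> space P. rho x \<in> Q}"
begin

definition mass :: "(real ^ 'd) set \<Rightarrow> real" where
  "mass Q = measure P {x \<in> space P. rho x \<in> Q}"

lemma preimage: "Q \<in> sets borel \<Longrightarrow> {x \<in> space P. rho x \<in> Q} \<in> sets P"
  using measurable_sets[OF rho] by (simp add: vimage_def Int_def conj_commute)

lemma mass_le:
  assumes "Q \<in> sets borel" "emeasure lborel Q \<le> ennreal v" "0 \<le> v"
  shows "mass Q \<le> M0 * v"
proof -
  have "ennreal (mass Q) \<le> ennreal M0 * ennreal v"
    unfolding mass_def using upper[OF assms(1)] mult_left_mono[OF assms(2), of "ennreal M0"]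
    by (simp add: P.emeasure_eq_measure)
  then show ?thesis using assms m0 by (simp add: ennreal_mult[symmetric])
qed

lemma mass_ge:
  assumes "Q \<in> sets borel" "Q \<subseteq> unit_cube" "ennreal v \<le> emeasure lborel Q" "0 \<le> v"
  shows "m0 * v \<le> mass Q"
proof -
  have "ennreal m0 * ennreal v \<le> ennreal (mass Q)"
    unfolding mass_def using lower[OF assms(1,2)] mult_left_mono[OF assms(3), of "ennreal m0"]
    by (simp add: P.emeasure_eq_measure)
  then show ?thesis using assms m0 by (simp add: ennreal_mult[symmetric] mass_def)
qed

lemma mass_bounds: "0 \<le> mass Q" "mass Q \<le> 1"
  by (auto simp: mass_def)

text \<open>Independence gives \<open>(1 + mass Q * (\<Phi> - 1)) ^ n\<close>, which is at most the
  corresponding value for a Poisson number of points with mean \<open>n * mass Q\<close>. Sums of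
  noise, sums of its absolute values and counts are all instances.\<close>

lemma mean_le_factors:
  assumes Q: "Q \<in> sets borel" and \<phi>: "\<phi> \<in> borel_measurable borel" "\<And>t. 0 \<le> \<phi> t"
    and \<Phi>: "(\<integral>\<^sup>+t. ennreal (\<phi> t) \<partial>std_normal) \<le> ennreal \<Phi>" "0 \<le> \<Phi>"
    and F: "\<And>\<omega>. F \<omega> = (\<Prod>i<n. if rho (fst \<omega> i) \<in> Q then \<phi> (snd \<omega> i) else 1)"
  shows "mean_le F (exp (real n * mass Q * (\<Phi> - 1)))"
proof -
  define g where "g p = (if rho (fst p) \<in> Q then \<phi> (snd p) else 1)" for p :: "(real ^ 'd) \<times> real"
  have m: "(\<lambda>p. rho (fst p)) \<in> measurable (P \<Otimes>\<^sub>M std_normal) borel"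
    by (rule measurable_compose[OF measurable_fst rho])
  have [measurable]: "g \<in> borel_measurable (P \<Otimes>\<^sub>M std_normal)"
    unfolding g_def
  proof (rule measurable_If)
    show "(\<lambda>p. \<phi> (snd p)) \<in> borel_measurable (P \<Otimes>\<^sub>M std_normal)"
      by (rule measurable_compose[OF measurable_snd]) (use \<phi> in simp)
    show "{p \<in> space (P \<Otimes>\<^sub>M std_normal). rho (fst p) \<in> Q} \<in> sets (P \<Otimes>\<^sub>M std_normal)"
      using measurable_sets[OF m Q] by (simp add: vimage_def Int_def conj_commute)
  qed simp
  have q: "mass Q \<le> 1" "0 \<le> mass Q" by (rule mass_bounds)+
  have val: "0 \<le> 1 + mass Q * (\<Phi> - 1)"
  proof -
    have "0 \<le> mass Q * \<Phi>" using q \<Phi> by simp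
    then show ?thesis using q by (simp add: right_diff_distrib)
  qed
  let ?A = "{x \<in> space P. rho x \<in> Q}"
  have "(\<integral>\<^sup>+x. \<integral>\<^sup>+t. ennreal (g (x, t)) \<partial>std_normal \<partial>P) \<le> (\<integral>\<^sup>+x. ennreal \<Phi> * indicator ?A x + 1 * indicator (space P - ?A) x \<partial>P)"
    by (intro nn_integral_mono) (use \<Phi> N.emeasure_space_1 in \<open>auto simp: g_def indicator_def\<close>)
  also have "\<dots> = (\<integral>\<^sup>+x. ennreal \<Phi> * indicator ?A x \<partial>P) + (\<integral>\<^sup>+x. 1 * indicator (space P - ?A) x \<partial>P)"
    using preimage[OF Q] by (intro nn_integral_add) auto
  also have "\<dots> = ennreal \<Phi> * emeasure P ?A + emeasure P (space P - ?A)"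
    using preimage[OF Q] by (simp add: nn_integral_cmult_indicator)
  also have "\<dots> = ennreal (\<Phi> * mass Q + (1 - mass Q))"
    using preimage[OF Q] \<Phi>(2) q by (simp add: P.emeasure_eq_measure P.prob_compl mass_def ennreal_mult)
  also have "\<Phi> * mass Q + (1 - mass Q) = 1 + mass Q * (\<Phi> - 1)" by (simp add: algebra_simps)
  finally have one: "(\<integral>\<^sup>+x. \<integral>\<^sup>+t. ennreal (g (x, t)) \<partial>std_normal \<partial>P) \<le> ennreal (1 + mass Q * (\<Phi> - 1))" .
  have "mean_le F (\<Prod>i<n. 1 + mass Q * (\<Phi> - 1))"
  proof (rule mean_le_prod[where g = "\<lambda>_. g"])
    show "F \<omega> = (\<Prod>i<n. g (fst \<omega> i, snd \<omega> i))" for \<omega>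
      unfolding F g_def fst_conv snd_conv by (rule refl)
  qed (use one val \<phi> in \<open>auto simp: g_def[of "(_, _)"]\<close>)
  then show ?thesis
  proof (rule mean_le_mono)
    have "(\<Prod>i<n. 1 + mass Q * (\<Phi> - 1)) = (1 + mass Q * (\<Phi> - 1)) ^ n" by simp
    also have "\<dots> \<le> exp (mass Q * (\<Phi> - 1)) ^ n"
      by (rule power_mono) (use val in \<open>auto simp: exp_ge_add_one_self\<close>)
    also have "\<dots> = exp (real n * mass Q * (\<Phi> - 1))" by (simp add: exp_of_nat_mult[symmetric] mult.assoc)
    finally show "(\<Prod>i<n. 1 + mass Q * (\<Phi> - 1)) \<le> exp (real n * mass Q * (\<Phi> - 1))" .
  qed
qed

definition piece_sum :: "(real ^ 'd) set \<Rightarrow> (nat \<Rightarrow> real) \<Rightarrow> (nat \<Rightarrow> real ^ 'd) \<Rightarrow> real" where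
  "piece_sum Q e x = (\<Sum>i | i < n \<and> x i \<in> Q. e i)"

lemma exp_csum: "exp (piece_sum Q e x) = (\<Prod>i<n. if x i \<in> Q then exp (e i) else 1)"
proof -
  have "piece_sum Q e x = (\<Sum>i<n. if x i \<in> Q then e i else 0)"
    unfolding piece_sum_def by (subst sum.inter_filter[symmetric]) (auto intro: sum.cong)
  then show ?thesis by (simp add: exp_sum if_distrib[of exp] cong: if_cong)
qed

lemma mean_exp_csum:
  assumes Q: "Q \<in> sets borel"
  shows "mean_le (\<lambda>\<omega>. exp (t * piece_sum Q (\<lambda>i. sg * snd \<omega> i) (\<lambda>i. rho (fst \<omega> i))))
    (exp (real n * mass Q * (exp (t\<^sup>2 / 2) - 1)))"
proof (rule mean_le_factors[OF Q, where \<phi> = "\<lambda>u. exp (t * sg * u)"])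
  have "(t * sg)\<^sup>2 = t\<^sup>2" using sg by (metis abs_mult mult.right_neutral power2_abs)
  then show "(\<integral>\<^sup>+u. ennreal (exp (t * sg * u)) \<partial>std_normal) \<le> ennreal (exp (t\<^sup>2 / 2))"
    unfolding nn_integral_exp_std_normal by simp
  fix \<omega> :: "(nat \<Rightarrow> real ^ 'd) \<times> (nat \<Rightarrow> real)"
  have "t * piece_sum Q (\<lambda>i. sg * snd \<omega> i) (\<lambda>i. rho (fst \<omega> i)) = piece_sum Q (\<lambda>i. t * sg * snd \<omega> i) (\<lambda>i. rho (fst \<omega> i))"
    by (simp add: piece_sum_def sum_distrib_left mult.assoc)
  then show "exp (t * piece_sum Q (\<lambda>i. sg * snd \<omega> i) (\<lambda>i. rho (fst \<omega> i)))
    = (\<Prod>i<n. if rho (fst \<omega> i) \<in> Q then exp (t * sg * snd \<omega> i) else 1)"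
    by (simp only: exp_csum)
qed auto

lemma mean_exp_csum_abs:
  assumes Q: "Q \<in> sets borel"
  shows "mean_le (\<lambda>\<omega>. exp (piece_sum Q (\<lambda>i. \<bar>sg * snd \<omega> i\<bar>) (\<lambda>i. rho (fst \<omega> i)))) (exp (real n * mass Q * 3))"
proof (rule mean_le_mono)
  show "mean_le (\<lambda>\<omega>. exp (piece_sum Q (\<lambda>i. \<bar>sg * snd \<omega> i\<bar>) (\<lambda>i. rho (fst \<omega> i)))) (exp (real n * mass Q * (2 * exp (1 / 2) - 1)))"
    by (rule mean_le_factors[OF Q, where \<phi> = "\<lambda>u. exp \<bar>u\<bar>"])
       (use nn_integral_exp_abs_std_normal sg in \<open>auto simp: exp_csum abs_mult\<close>)
  show "exp (real n * mass Q * (2 * exp (1 / 2) - 1)) \<le> exp (real n * mass Q * 3)"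
    using exp_half_le mass_bounds(1)[of Q] by (simp add: mult_left_mono)
qed

lemma mean_exp_count:
  assumes Q: "Q \<in> sets borel"
  shows "mean_le (\<lambda>\<omega>. exp (- real (card {i. i < n \<and> rho (fst \<omega> i) \<in> Q}))) (exp (real n * mass Q * (exp (- 1) - 1)))"
proof (rule mean_le_factors[OF Q, where \<phi> = "\<lambda>u. exp (- 1)"])
  fix \<omega> :: "(nat \<Rightarrow> real ^ 'd) \<times> (nat \<Rightarrow> real)"
  have "- real (card {i. i < n \<and> rho (fst \<omega> i) \<in> Q}) = piece_sum Q (\<lambda>i. - 1) (\<lambda>i. rho (fst \<omega> i))"
    by (simp add: piece_sum_def)
  then show "exp (- real (card {i. i < n \<and> rho (fst \<omega> i) \<in> Q})) = (\<Prod>i<n. if rho (fst \<omega> i) \<in> Q then exp (- 1) else 1)"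
    by (simp only: exp_csum)
qed (use N.emeasure_space_1 in auto)

lemma mean_rest:
  assumes Q: "Q \<in> sets borel"
  shows "mean_le (\<lambda>\<omega>. \<Sum>i | i < n \<and> rho (fst \<omega> i) \<in> Q. (sg * snd \<omega> i)\<^sup>2) (real n * (8 * mass Q))"
proof -
  define g where "g p = indicator Q (rho (fst p)) * (sg * snd p)\<^sup>2" for p :: "(real ^ 'd) \<times> real"
  have sg2: "(sg * t)\<^sup>2 = t\<^sup>2" for t using sg by (metis abs_mult mult.left_neutral power2_abs)
  have m: "(\<lambda>p. rho (fst p)) \<in> measurable (P \<Otimes>\<^sub>M std_normal) borel"
    by (rule measurable_compose[OF measurable_fst rho])
  have gm: "g \<in> borel_measurable (P \<Otimes>\<^sub>M std_normal)"
    unfolding g_def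
    by (intro borel_measurable_times borel_measurable_power measurable_compose[OF m borel_measurable_indicator[OF Q]]
        measurable_compose[OF measurable_snd]) auto
  have "(\<integral>\<^sup>+x. \<integral>\<^sup>+t. ennreal (g (x, t)) \<partial>std_normal \<partial>P) \<le> (\<integral>\<^sup>+x. ennreal 8 * indicator {x \<in> space P. rho x \<in> Q} x \<partial>P)"
    by (intro nn_integral_mono) (use nn_integral_square_std_normal in \<open>auto simp: g_def indicator_def sg2\<close>)
  also have "\<dots> = ennreal (8 * mass Q)"
    using preimage[OF Q] by (simp add: nn_integral_cmult_indicator P.emeasure_eq_measure mass_def ennreal_mult)
  finally have one: "(\<integral>\<^sup>+x. \<integral>\<^sup>+t. ennreal (g (x, t)) \<partial>std_normal \<partial>P) \<le> ennreal (8 * mass Q)" .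
  have "mean_le (\<lambda>\<omega>. \<Sum>i<n. g (fst \<omega> i, snd \<omega> i)) (\<Sum>i<n. 8 * mass Q)"
  proof (rule mean_le_sum)
    fix i assume "i \<in> {..<n}"
    then show "mean_le (\<lambda>\<omega>. g (fst \<omega> i, snd \<omega> i)) (8 * mass Q)"
      by (intro mean_le_single one gm) (use mass_bounds(1)[of Q] in \<open>auto simp: g_def\<close>)
  qed
  moreover have "(\<Sum>i<n. g (fst \<omega> i, snd \<omega> i)) = (\<Sum>i | i < n \<and> rho (fst \<omega> i) \<in> Q. (sg * snd \<omega> i)\<^sup>2)" for \<omega>
  proof -
    have "(\<Sum>i<n. g (fst \<omega> i, snd \<omega> i)) = (\<Sum>i<n. if rho (fst \<omega> i) \<in> Q then (sg * snd \<omega> i)\<^sup>2 else 0)"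
      by (intro sum.cong) (auto simp: g_def)
    also have "\<dots> = (\<Sum>i | i \<in> {..<n} \<and> rho (fst \<omega> i) \<in> Q. (sg * snd \<omega> i)\<^sup>2)"
      by (rule sum.inter_filter[symmetric]) simp
    finally show ?thesis by simp
  qed
  ultimately show ?thesis by simp
qed

end

section \<open>Expected cost of one cell\<close>

lemma pow4_add_le: "(b + v) ^ 4 \<le> 8 * (b ^ 4 + (v :: real) ^ 4)"
proof -
  have sq: "(b + v)\<^sup>2 \<le> 2 * (b\<^sup>2 + v\<^sup>2)" for b v :: real
  proof -
    have "0 \<le> (b - v)\<^sup>2" by simp
    then show ?thesis by (simp add: power2_eq_square algebra_simps)
  qed
  have "(b + v) ^ 4 = ((b + v)\<^sup>2)\<^sup>2" by simp
  also have "\<dots> \<le> (2 * (b\<^sup>2 + v\<^sup>2))\<^sup>2" by (rule power_mono[OF sq]) simp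
  also have "\<dots> = 4 * (b\<^sup>2 + v\<^sup>2)\<^sup>2" by (simp only: power_mult_distrib) simp
  also have "\<dots> \<le> 4 * (2 * ((b\<^sup>2)\<^sup>2 + (v\<^sup>2)\<^sup>2))" using sq[of "b\<^sup>2" "v\<^sup>2"] by simp
  finally show ?thesis by simp
qed

text \<open>Meant for a maximum of many variables: with \<open>b\<close> at least the logarithm of
  their number, the exponentials summed over all of them contribute a constant after multiplication
  by \<open>exp (- b)\<close>, and \<open>8 * b ^ 4\<close> is polylogarithmic. The constant 2048 is
  \<open>8 * 4 ^ 4\<close>.\<close>

lemma pow4_le_exp:
  assumes "0 \<le> w" "0 \<le> (b :: real)"
  shows "w ^ 4 \<le> 8 * b ^ 4 + 2048 * exp (w - b)"
proof (cases "w \<le> b")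
  case True
  then have "w ^ 4 \<le> b ^ 4" by (intro power_mono assms)
  moreover have "0 \<le> b ^ 4" "0 \<le> exp (w - b)" by simp_all
  ultimately show ?thesis by linarith
next
  case False
  define v where "v = w - b"
  have v: "0 \<le> v" "w = b + v" using False by (auto simp: v_def)
  have "v / 4 \<le> exp (v / 4)" using exp_ge_add_one_self[of "v / 4"] by linarith
  then have "(v / 4) ^ 4 \<le> exp (v / 4) ^ 4" by (rule power_mono) (use v in simp)
  also have "\<dots> = exp v" by (simp add: exp_of_nat_mult[symmetric])
  finally have "v ^ 4 \<le> 256 * exp v" by (simp add: power_divide)
  then show ?thesis using pow4_add_le[of b v] by (simp add: v_def)
qed

lemma sum_pow4_le:
  fixes g :: "'i \<Rightarrow> real"
  shows "(\<Sum>i\<in>I. g i) ^ 4 \<le> real (card I) ^ 3 * (\<Sum>i\<in>I. g i ^ 4)"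
proof -
  have cs: "(\<Sum>i\<in>I. h i)\<^sup>2 \<le> real (card I) * (\<Sum>i\<in>I. (h i)\<^sup>2)" for h :: "'i \<Rightarrow> real"
    using sum_squared_le_sum_of_squares[of h I] by (simp add: mult.commute)
  have "(\<Sum>i\<in>I. g i) ^ 4 = ((\<Sum>i\<in>I. g i)\<^sup>2)\<^sup>2" by simp
  also have "\<dots> \<le> (real (card I) * (\<Sum>i\<in>I. (g i)\<^sup>2))\<^sup>2" by (rule power_mono[OF cs]) simp
  also have "\<dots> = (real (card I))\<^sup>2 * (\<Sum>i\<in>I. (g i)\<^sup>2)\<^sup>2" by (simp add: power_mult_distrib)
  also have "\<dots> \<le> (real (card I))\<^sup>2 * (real (card I) * (\<Sum>i\<in>I. ((g i)\<^sup>2)\<^sup>2))"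
    by (rule mult_left_mono[OF cs]) simp
  finally show ?thesis by (simp add: power3_eq_cube power2_eq_square mult.assoc power4_eq_xxxx)
qed

text \<open>Either the count reaches a quarter of \<open>\<mu>\<close>, or the exponential term
  exceeds 1. The bound is linear in \<open>exp (- N)\<close>, which has an explicit mean for a
  random count.\<close>

lemma inverse_count_le:
  assumes "0 < \<mu>" "0 \<le> (N :: real)"
  shows "(1 / (1 + N))\<^sup>2 \<le> 16 / \<mu>\<^sup>2 + exp (\<mu> / 4) * exp (- N)"
proof (cases "\<mu> / 4 \<le> N")
  case True
  have "1 / (1 + N) \<le> 4 / \<mu>" using True assms by (simp add: field_simps)
  then have "(1 / (1 + N))\<^sup>2 \<le> (4 / \<mu>)\<^sup>2" by (rule power_mono) (use assms in simp)
  also have "\<dots> = 16 / \<mu>\<^sup>2" by (simp add: power_divide)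
  finally show ?thesis by (rule order_trans) simp
next
  case False
  have "(1 / (1 + N))\<^sup>2 \<le> 1" using assms by (intro power_le_one) auto
  also have "1 \<le> exp (\<mu> / 4 - N)" using False by simp
  also have "\<dots> = exp (\<mu> / 4) * exp (- N)" by (simp add: exp_add[symmetric])
  finally show ?thesis by (rule order_trans) simp
qed

lemma mem_subcells_unique:
  assumes "cell (refine a j) y \<in> subcells c j"
  shows "cell a y = c"
proof
  fix i
  let ?b = "cell (refine a j) y i" and ?q = "2 ^ j :: int"
  have *: "cell a y i * ?q \<le> ?b \<and> ?b < cell a y i * ?q + ?q" "c i * ?q \<le> ?b \<and> ?b < c i * ?q + ?q"
    using cell_refine_mem[of a j y] assms by (simp_all add: mem_ibox)
  then have "cell a y i * ?q < (c i + 1) * ?q" "c i * ?q < (cell a y i + 1) * ?q"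
    by (simp_all add: algebra_simps)
  then show "cell a y i = c i" by simp
qed

lemma size_refine: "size_of (refine (a :: 'd::finite \<Rightarrow> nat) j) = size_of a + j * CARD('d)"
  unfolding sum.distrib by simp

text \<open>Dominates 1, \<open>M0\<close> and \<open>2 ^ d\<close> simultaneously. The factor
  \<open>2 ^ d\<close> keeps \<open>level_variance\<close> at least 1 down to the last level, which
  may overshoot the cell rate by this factor.\<close>

definition mass_factor :: "nat \<Rightarrow> real \<Rightarrow> real" where
  "mass_factor d M0 = max 1 M0 * 2 ^ d"

text \<open>Half the sum of the two means balanced in \<open>mean_cell\<close>: that of the fourth
  power of the chaining bound and that of the squared inverse count.\<close>

definition cell_bound :: "nat \<Rightarrow> real \<Rightarrow> real \<Rightarrow> real" where
  "cell_bound d m0 M0 = (real d ^ 4 * (mass_factor d M0)\<^sup>2 *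
     (8 * real d ^ 4 + 12288 + 2048 * exp (3 * mass_factor d M0)) + 48 / m0\<^sup>2) / 2"

context mapped_design
begin

text \<open>The number of design points expected in a cell of shape \<open>a\<close> under the
  uniform density.\<close>

definition cell_rate :: "('d \<Rightarrow> nat) \<Rightarrow> real" where
  "cell_rate a = real n / 2 ^ size_of a"

definition mass_bound :: real where
  "mass_bound = mass_factor CARD('d) M0"

text \<open>An upper bound for the expected number of design points in a subcell of level
  \<open>j\<close>, and thus for the variance of the noise summed over it.\<close>

definition level_variance :: "('d \<Rightarrow> nat) \<Rightarrow> nat \<Rightarrow> real" where
  "level_variance a j = mass_bound * cell_rate a / 2 ^ (j * CARD('d))"

definition piece :: "(real ^ 'd) set \<Rightarrow> ('d \<Rightarrow> nat) \<Rightarrow> nat \<Rightarrow> ('d \<Rightarrow> int) \<Rightarrow> (real ^ 'd) set" where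
  "piece T a j b = T \<inter> {y. cell (refine a j) y = b}"

text \<open>Exceeds the logarithm of the number \<open>2 ^ (j * CARD('d))\<close> of subcells; it
  plays the role of \<open>b\<close> in \<open>pow4_le_exp\<close>.\<close>

definition level_exponent :: "nat \<Rightarrow> real" where
  "level_exponent j = real (j * CARD('d))"

text \<open>Measurable upper bounds for the fourth powers of
  \<open>max \<bar>piece_sum (piece T a j b) e x\<bar>\<close> and \<open>max (piece_sum (piece T a j b) \<bar>e\<bar> x)\<close> over \<open>b\<close>, linear in exponential
  moments.\<close>

definition level_bound where
  "level_bound T a c j e x = (level_variance a j)\<^sup>2 * (8 * level_exponent j ^ 4 + 2048 * exp (- level_exponent j) *
     (\<Sum>b\<in>subcells c j. exp (1 / sqrt (level_variance a j) * piece_sum (piece T a j b) e x)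
        + exp (- 1 / sqrt (level_variance a j) * piece_sum (piece T a j b) e x)))"

definition abs_level_bound where
  "abs_level_bound T a c j e x = 8 * level_exponent j ^ 4 + 2048 * exp (- level_exponent j) *
     (\<Sum>b\<in>subcells c j. exp (piece_sum (piece T a j b) (\<lambda>i. \<bar>e i\<bar>) x))"

text \<open>The boundary count of \<open>sum_increments_ibox\<close> for the subcells of level
  \<open>j\<close>.\<close>

definition level_weight :: "nat \<Rightarrow> real" where
  "level_weight j = real CARD('d) * (2 ^ j) ^ (CARD('d) - 1)"

definition chain_bound where
  "chain_bound T a c J e x = (\<Sum>j\<le>J. level_weight j * root 4 (level_bound T a c j e x)) + level_weight J * root 4 (abs_level_bound T a c J e x)"

lemma level_exponent_nonneg: "0 \<le> level_exponent j" by (simp add: level_exponent_def)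
lemma mass_bound_ge: "1 \<le> mass_bound" "M0 \<le> mass_bound" "2 ^ CARD('d) \<le> mass_bound"
proof -
  have "1 * 1 \<le> max 1 M0 * 2 ^ CARD('d)" by (intro mult_mono) auto
  then show "1 \<le> mass_bound" by (simp add: mass_bound_def mass_factor_def)
  have "max 1 M0 * 1 \<le> max 1 M0 * 2 ^ CARD('d)" by (intro mult_left_mono) auto
  then show "M0 \<le> mass_bound" by (simp add: mass_bound_def mass_factor_def)
  have "1 * 2 ^ CARD('d) \<le> max 1 M0 * 2 ^ CARD('d)" by (intro mult_right_mono) auto
  then show "2 ^ CARD('d) \<le> mass_bound" by (simp add: mass_bound_def mass_factor_def)
qed
lemma level_bound_nonneg: "0 \<le> level_bound T a c j e x"
  unfolding level_bound_def by (intro mult_nonneg_nonneg add_nonneg_nonneg sum_nonneg) auto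
lemma abs_level_bound_nonneg: "0 \<le> abs_level_bound T a c j e x"
  unfolding abs_level_bound_def by (intro mult_nonneg_nonneg add_nonneg_nonneg sum_nonneg) auto

text \<open>The sum is normalised by the square root of its variance bound before
  \<open>pow4_le_exp\<close> is applied. Replacing its exponential by the sum over all subcells and
  both signs makes the bound uniform in \<open>b\<close>.\<close>

lemma piece_sum_le_Rz:
  assumes b: "b \<in> subcells c j" and t: "0 < level_variance a j"
  shows "\<bar>piece_sum (piece T a j b) e x\<bar> \<le> root 4 (level_bound T a c j e x)"
proof -
  define v where "v = piece_sum (piece T a j b) e x"
  define t where "t = sqrt (level_variance a j)"
  have t: "0 < t" "level_variance a j = t\<^sup>2" using assms by (auto simp: t_def)
  have "(\<bar>v\<bar> / t) ^ 4 \<le> 8 * level_exponent j ^ 4 + 2048 * exp (\<bar>v\<bar> / t - level_exponent j)"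
    by (rule pow4_le_exp) (use t level_exponent_nonneg in auto)
  also have "exp (\<bar>v\<bar> / t - level_exponent j) = exp (- level_exponent j) * exp (\<bar>v\<bar> / t)" by (simp add: exp_add[symmetric])
  also have "exp (\<bar>v\<bar> / t) \<le> exp (1 / t * v) + exp (- 1 / t * v)"
    by (cases "0 \<le> v") (auto simp: abs_if)
  also have "\<dots> \<le> (\<Sum>b\<in>subcells c j. exp (1 / t * piece_sum (piece T a j b) e x) + exp (- 1 / t * piece_sum (piece T a j b) e x))"
    unfolding v_def by (rule member_le_sum[of b _ "\<lambda>b. exp (1 / t * piece_sum (piece T a j b) e x) + exp (- 1 / t * piece_sum (piece T a j b) e x)"])
      (use b in auto)
  finally have "(\<bar>v\<bar> / t) ^ 4 \<le> 8 * level_exponent j ^ 4 + 2048 * exp (- level_exponent j) *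
     (\<Sum>b\<in>subcells c j. exp (1 / t * piece_sum (piece T a j b) e x) + exp (- 1 / t * piece_sum (piece T a j b) e x))"
    by (simp add: mult.assoc)
  moreover have tt: "(level_variance a j)\<^sup>2 = t ^ 4" by (simp add: t(2))
  ultimately have "t ^ 4 * (\<bar>v\<bar> / t) ^ 4 \<le> level_bound T a c j e x"
    unfolding level_bound_def tt t_def[symmetric] by (intro mult_left_mono) auto
  then have "\<bar>v\<bar> ^ 4 \<le> level_bound T a c j e x" using t by (simp add: power_divide)
  then have "root 4 (\<bar>v\<bar> ^ 4) \<le> root 4 (level_bound T a c j e x)" by (intro real_root_le_mono) auto
  moreover have "root 4 (\<bar>v\<bar> ^ 4) = \<bar>v\<bar>" by (rule real_root_power_cancel) auto
  ultimately show ?thesis unfolding v_def by (simp only:)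
qed

lemma piece_sum_abs_le_RA:
  assumes b: "b \<in> subcells c j"
  shows "piece_sum (piece T a j b) (\<lambda>i. \<bar>e i\<bar>) x \<le> root 4 (abs_level_bound T a c j e x)"
proof -
  define v where "v = piece_sum (piece T a j b) (\<lambda>i. \<bar>e i\<bar>) x"
  have v: "0 \<le> v" unfolding v_def piece_sum_def by (rule sum_nonneg) simp
  have "v ^ 4 \<le> 8 * level_exponent j ^ 4 + 2048 * exp (v - level_exponent j)"
    by (rule pow4_le_exp) (use v level_exponent_nonneg in auto)
  also have "exp (v - level_exponent j) = exp (- level_exponent j) * exp v" by (simp add: exp_add[symmetric])
  also have "exp v \<le> (\<Sum>b\<in>subcells c j. exp (piece_sum (piece T a j b) (\<lambda>i. \<bar>e i\<bar>) x))"
    unfolding v_def by (rule member_le_sum[of b _ "\<lambda>b. exp (piece_sum (piece T a j b) (\<lambda>i. \<bar>e i\<bar>) x)"]) (use b in auto)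
  finally have "v ^ 4 \<le> abs_level_bound T a c j e x" by (simp add: abs_level_bound_def mult.assoc)
  then have "root 4 (v ^ 4) \<le> root 4 (abs_level_bound T a c j e x)" by simp
  then show ?thesis using v by (simp add: v_def[symmetric] real_root_power_cancel)
qed

lemma chain_bound_bounds_sum:
  assumes n: "0 < n" and H: "0 \<le> H"
    and u: "\<And>i. i < n \<Longrightarrow> 0 \<le> u i" "\<And>i. i < n \<Longrightarrow> x i \<in> T \<Longrightarrow> cell a (x i) = c \<Longrightarrow> u i \<le> H"
    and mono: "\<And>i j. i < n \<Longrightarrow> j < n \<Longrightarrow> x i \<in> T \<Longrightarrow> x j \<in> T \<Longrightarrow> cell a (x i) = c \<Longrightarrow> cell a (x j) = c \<Longrightarrow>
      x i \<le> x j \<Longrightarrow> u i \<le> u j"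
  shows "(\<Sum>i | i < n \<and> x i \<in> T \<and> cell a (x i) = c. e i * u i) \<le> H * chain_bound T a c J e x"
proof -
  let ?S = "{i. i < n \<and> x i \<in> T \<and> cell a (x i) = c}"
  have level_variance: "0 < level_variance a j" for j using n mass_bound_ge(1) by (simp add: level_variance_def cell_rate_def)
  have set: "{i. i \<in> ?S \<and> cell (refine a j) (x i) = b} = {i. i < n \<and> x i \<in> piece T a j b}"
    if "b \<in> subcells c j" for j b
    using that mem_subcells_unique[of a j _ c] by (auto simp: piece_def)
  show ?thesis
    unfolding chain_bound_def level_weight_def
  proof (rule isotone_cell_sum)
    show "\<bar>\<Sum>i | i \<in> ?S \<and> cell (refine a j) (x i) = b. e i\<bar> \<le> root 4 (level_bound T a c j e x)"
      if "j \<le> J" "b \<in> subcells c j" for j b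
      unfolding set[OF that(2)] using piece_sum_le_Rz[OF that(2) level_variance] by (simp add: piece_sum_def)
    show "(\<Sum>i | i \<in> ?S \<and> cell (refine a J) (x i) = b. \<bar>e i\<bar>) \<le> root 4 (abs_level_bound T a c J e x)"
      if "b \<in> subcells c J" for b
      unfolding set[OF that] using piece_sum_abs_le_RA[OF that] by (simp add: piece_sum_def)
  qed (use u mono H in auto)
qed

lemma mass_piece:
  assumes "T \<in> sets borel"
  shows "piece T a j b \<in> sets borel" "real n * mass (piece T a j b) \<le> M0 * cell_rate a / 2 ^ (j * CARD('d))"
proof -
  show m: "piece T a j b \<in> sets borel" using assms by (simp add: piece_def)
  have "emeasure lborel (piece T a j b) \<le> emeasure lborel {y. cell (refine a j) y = b}"
    by (rule emeasure_mono) (auto simp: piece_def)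
  then have "mass (piece T a j b) \<le> M0 * (1 / 2) ^ (size_of a + j * CARD('d))"
    by (intro mass_le m) (simp_all add: emeasure_cell size_refine del: sum.distrib)
  then have "real n * mass (piece T a j b) \<le> real n * (M0 * (1 / 2) ^ (size_of a + j * CARD('d)))"
    by (rule mult_left_mono) simp
  then show "real n * mass (piece T a j b) \<le> M0 * cell_rate a / 2 ^ (j * CARD('d))"
    by (simp add: cell_rate_def power_add power_one_over mult.commute)
qed

lemma mean_Rz:
  assumes T: "T \<in> sets borel" and t: "1 \<le> level_variance a j"
  shows "mean_le (\<lambda>\<omega>. level_bound T a c j (\<lambda>i. sg * snd \<omega> i) (\<lambda>i. rho (fst \<omega> i)))
    ((level_variance a j)\<^sup>2 * (8 * level_exponent j ^ 4 + 12288))"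
proof -
  let ?t = "1 / sqrt (level_variance a j)"
  have each: "mean_le (\<lambda>\<omega>. exp (r * piece_sum (piece T a j b) (\<lambda>i. sg * snd \<omega> i) (\<lambda>i. rho (fst \<omega> i)))) (exp 1)"
    if r: "r\<^sup>2 = 1 / level_variance a j" for r b
  proof (rule mean_le_mono[OF mean_exp_csum[OF mass_piece(1)[OF T]]])
    have "real n * mass (piece T a j b) \<le> M0 * cell_rate a / 2 ^ (j * CARD('d))" by (rule mass_piece(2)[OF T])
    also have "\<dots> \<le> level_variance a j"
      unfolding level_variance_def using mass_bound_ge by (intro divide_right_mono mult_right_mono) (auto simp: cell_rate_def)
    finally have q: "real n * mass (piece T a j b) \<le> level_variance a j" .
    \<comment> \<open>A variance bound of at least 1 keeps \<open>r\<close> bounded, so the excess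
      of the Gaussian moment over 1 is at most \<open>r\<^sup>2\<close>, and the exponent of the
      moment stays below 1.\<close>
    have u: "0 \<le> r\<^sup>2 / 2" "r\<^sup>2 / 2 \<le> 1 / 2" using t by (auto simp: r)
    have "exp (r\<^sup>2 / 2) \<le> 1 + r\<^sup>2 / 2 + (r\<^sup>2 / 2)\<^sup>2" by (rule exp_bound) (use u in auto)
    also have "(r\<^sup>2 / 2)\<^sup>2 \<le> r\<^sup>2 / 2 * 1" unfolding power2_eq_square[of "r\<^sup>2 / 2"] by (rule mult_left_mono) (use u in auto)
    finally have "exp (r\<^sup>2 / 2) - 1 \<le> r\<^sup>2" by simp
    then have "real n * mass (piece T a j b) * (exp (r\<^sup>2 / 2) - 1) \<le> level_variance a j * r\<^sup>2"
      by (intro mult_mono q) (use t in auto)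
    also have "\<dots> = 1" using t by (simp add: r)
    finally show "exp (real n * mass (piece T a j b) * (exp (r\<^sup>2 / 2) - 1)) \<le> exp 1" by simp
  qed
  have r1: "?t\<^sup>2 = 1 / level_variance a j" "(- 1 / sqrt (level_variance a j))\<^sup>2 = 1 / level_variance a j" using t by (simp_all add: power_divide)
  have "mean_le (\<lambda>\<omega>. level_bound T a c j (\<lambda>i. sg * snd \<omega> i) (\<lambda>i. rho (fst \<omega> i)))
    ((level_variance a j)\<^sup>2 * (8 * level_exponent j ^ 4 + 2048 * exp (- level_exponent j) * (\<Sum>b\<in>subcells c j. exp 1 + exp 1)))"
    unfolding level_bound_def
    by (intro mean_le_cmult mean_le_add mean_le_const mean_le_sum each r1) (auto simp: level_exponent_nonneg)
  then show ?thesis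
  proof (rule mean_le_mono)
    \<comment> \<open>The factor \<open>exp (- level_exponent j)\<close> cancels the number of
      subcells. Together with \<open>2 * exp 1 \<le> 6\<close> this leaves
      \<open>6 * 2048 = 12288\<close>.\<close>
    have "(\<Sum>b\<in>subcells c j. exp 1 + exp 1 :: real) = 2 ^ (j * CARD('d)) * (2 * exp 1)"
      by (simp add: power_mult)
    also have "\<dots> \<le> exp (level_exponent j) * 6"
    proof (rule mult_mono)
      have "(2 :: real) ^ (j * CARD('d)) \<le> exp 1 ^ (j * CARD('d))"
        by (rule power_mono) (use exp_ge_add_one_self[of 1] in auto)
      also have "\<dots> = exp (level_exponent j)" by (simp add: level_exponent_def exp_of_nat_mult[symmetric])
      finally show "(2 :: real) ^ (j * CARD('d)) \<le> exp (level_exponent j)" .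
      show "2 * exp 1 \<le> (6 :: real)" using exp_le by simp
    qed auto
    finally have "exp (- level_exponent j) * (\<Sum>b\<in>subcells c j. exp 1 + exp 1) \<le> exp (- level_exponent j) * (exp (level_exponent j) * 6)"
      by (rule mult_left_mono) simp
    also have "\<dots> = 6" by (simp add: exp_minus)
    finally have "2048 * exp (- level_exponent j) * (\<Sum>b\<in>subcells c j. exp 1 + exp 1) \<le> 12288" by simp
    then show "(level_variance a j)\<^sup>2 * (8 * level_exponent j ^ 4 + 2048 * exp (- level_exponent j) * (\<Sum>b\<in>subcells c j. exp 1 + exp 1))
      \<le> (level_variance a j)\<^sup>2 * (8 * level_exponent j ^ 4 + 12288)"
      by (intro mult_left_mono) auto
  qed
qed

text \<open>At the last level a subcell has at most \<open>M0\<close> expected points, so even the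
  sum of the absolute values of the noise has a bounded exponential moment without any
  normalisation.\<close>

lemma mean_RA:
  assumes T: "T \<in> sets borel" and J: "cell_rate a \<le> 2 ^ (J * CARD('d))"
  shows "mean_le (\<lambda>\<omega>. abs_level_bound T a c J (\<lambda>i. sg * snd \<omega> i) (\<lambda>i. rho (fst \<omega> i)))
    (8 * level_exponent J ^ 4 + 2048 * exp (3 * mass_bound))"
proof -
  have each: "mean_le (\<lambda>\<omega>. exp (piece_sum (piece T a J b) (\<lambda>i. \<bar>sg * snd \<omega> i\<bar>) (\<lambda>i. rho (fst \<omega> i)))) (exp (3 * mass_bound))" for b
  proof (rule mean_le_mono[OF mean_exp_csum_abs[OF mass_piece(1)[OF T]]])
    have "real n * mass (piece T a J b) \<le> M0 * cell_rate a / 2 ^ (J * CARD('d))" by (rule mass_piece(2)[OF T])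
    also have "\<dots> \<le> M0" using J m0 by (simp add: divide_le_eq mult_left_mono)
    also have "\<dots> \<le> mass_bound" by (rule mass_bound_ge)
    finally show "exp (real n * mass (piece T a J b) * 3) \<le> exp (3 * mass_bound)" by simp
  qed
  have "mean_le (\<lambda>\<omega>. abs_level_bound T a c J (\<lambda>i. sg * snd \<omega> i) (\<lambda>i. rho (fst \<omega> i)))
    (8 * level_exponent J ^ 4 + 2048 * exp (- level_exponent J) * (\<Sum>b\<in>subcells c J. exp (3 * mass_bound)))"
    unfolding abs_level_bound_def
    by (intro mean_le_cmult mean_le_add mean_le_const mean_le_sum each) (auto simp: level_exponent_nonneg)
  then show ?thesis
  proof (rule mean_le_mono)
    have "(\<Sum>b\<in>subcells c J. exp (3 * mass_bound)) = 2 ^ (J * CARD('d)) * exp (3 * mass_bound)"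
      by (simp add: power_mult)
    also have "\<dots> \<le> exp (level_exponent J) * exp (3 * mass_bound)"
    proof (rule mult_right_mono)
      have "(2 :: real) ^ (J * CARD('d)) \<le> exp 1 ^ (J * CARD('d))"
        by (rule power_mono) (use exp_ge_add_one_self[of 1] in auto)
      also have "\<dots> = exp (level_exponent J)" by (simp add: level_exponent_def exp_of_nat_mult[symmetric])
      finally show "(2 :: real) ^ (J * CARD('d)) \<le> exp (level_exponent J)" .
    qed auto
    finally have "exp (- level_exponent J) * (\<Sum>b\<in>subcells c J. exp (3 * mass_bound)) \<le> exp (- level_exponent J) * (exp (level_exponent J) * exp (3 * mass_bound))"
      by (rule mult_left_mono) simp
    also have "\<dots> = exp (3 * mass_bound)" by (simp add: exp_minus)
    finally show "8 * level_exponent J ^ 4 + 2048 * exp (- level_exponent J) * (\<Sum>b\<in>subcells c J. exp (3 * mass_bound)) \<le> 8 * level_exponent J ^ 4 + 2048 * exp (3 * mass_bound)"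
      by simp
  qed
qed

definition cell_const :: real where
  "cell_const = cell_bound CARD('d) m0 M0"

lemma cell_const_nonneg: "0 \<le> cell_const"
  by (simp add: cell_const_def cell_bound_def)

text \<open>The noise in the cell and the count in the shifted cell are dependent. Young's
  inequality separates the quotient into a fourth power and a squared inverse count, which are
  averaged separately; this is why the chaining bounds are built on fourth moments.\<close>

lemma mean_cell:
  assumes d: "2 \<le> CARD('d)" and T: "T \<in> sets borel" and l1: "1 \<le> cell_rate a"
    and J: "cell_rate a \<le> 2 ^ (J * CARD('d))" "2 ^ (J * CARD('d)) \<le> 2 ^ CARD('d) * cell_rate a"
    and C: "{y. cell a y = c'} \<subseteq> unit_cube"
  obtains G where "mean_le G (cell_const * real (J + 2) ^ 4 * 2 ^ (J * (CARD('d) - 2)))"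
    "\<And>\<omega>. (chain_bound T a c J (\<lambda>i. sg * snd \<omega> i) (\<lambda>i. rho (fst \<omega> i)))\<^sup>2
      / (1 + real (card {i. i < n \<and> cell a (rho (fst \<omega> i)) = c'})) \<le> G \<omega>"
proof -
  let ?d = "CARD('d)"
  define X :: real where "X = 2 ^ (J * (?d - 2))"
  define L where "L = cell_rate a"
  have X: "1 \<le> X" by (simp add: X_def)
  have L: "1 \<le> L" using l1 by (simp add: L_def)
  define \<mu> where "\<mu> = m0 * L"
  have \<mu>: "0 < \<mu>" using m0 L by (simp add: \<mu>_def)
  \<comment> \<open>The weight that balances the two means, which are of order
    \<open>L\<^sup>2 * (J + 2) ^ 8 * X\<^sup>2\<close> for the fourth power and
    \<open>1 / L\<^sup>2\<close> for the squared inverse count.\<close>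
  define s where "s = 1 / (L\<^sup>2 * real (J + 2) ^ 4 * X)"
  have s: "0 < s" using L X by (auto simp: s_def intro!: divide_pos_pos mult_pos_pos)
  define Rzw where "Rzw j \<omega> = level_bound T a c j (\<lambda>i. sg * snd \<omega> i) (\<lambda>i. rho (fst \<omega> i))" for j \<omega>
  define RAw where "RAw \<omega> = abs_level_bound T a c J (\<lambda>i. sg * snd \<omega> i) (\<lambda>i. rho (fst \<omega> i))" for \<omega>
  define N where "N \<omega> = real (card {i. i < n \<and> rho (fst \<omega> i) \<in> {y. cell a y = c'}})" for \<omega> :: "(nat \<Rightarrow> real ^ 'd) \<times> (nat \<Rightarrow> real)"
  define G where "G \<omega> = s / 2 * real (J + 2) ^ 3 * ((\<Sum>j\<le>J. level_weight j ^ 4 * Rzw j \<omega>) + level_weight J ^ 4 * RAw \<omega>)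
    + 1 / (2 * s) * (16 / \<mu>\<^sup>2 + exp (\<mu> / 4) * exp (- N \<omega>))" for \<omega>
  show thesis
  proof (rule that[of G])
    fix \<omega>
    define w where "w = chain_bound T a c J (\<lambda>i. sg * snd \<omega> i) (\<lambda>i. rho (fst \<omega> i))"
    define g where "g j = (if j \<le> J then level_weight j * root 4 (Rzw j \<omega>) else level_weight J * root 4 (RAw \<omega>))" for j
    have "w = (\<Sum>j\<le>Suc J. g j)"
      by (simp add: w_def chain_bound_def g_def Rzw_def RAw_def)
    \<comment> \<open>The remainder with absolute values counts as one more level, which makes
      \<open>J + 2\<close> summands.\<close>
    then have "w ^ 4 \<le> real (card {..Suc J}) ^ 3 * (\<Sum>j\<le>Suc J. g j ^ 4)"
      by (simp only: sum_pow4_le)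
    also have "(\<Sum>j\<le>Suc J. g j ^ 4) = (\<Sum>j\<le>J. level_weight j ^ 4 * Rzw j \<omega>) + level_weight J ^ 4 * RAw \<omega>"
      by (simp add: g_def power_mult_distrib Rzw_def RAw_def level_bound_nonneg abs_level_bound_nonneg real_root_pow_pos2)
    finally have w4: "w ^ 4 \<le> real (J + 2) ^ 3 * ((\<Sum>j\<le>J. level_weight j ^ 4 * Rzw j \<omega>) + level_weight J ^ 4 * RAw \<omega>)" by simp
    have N0: "0 \<le> N \<omega>" by (simp add: N_def)
    define i where "i = 1 / (1 + N \<omega>)"
    have "0 \<le> (s * w\<^sup>2 - i)\<^sup>2 / (2 * s)" using s by simp
    also have "\<dots> = s / 2 * w ^ 4 + 1 / (2 * s) * i\<^sup>2 - w\<^sup>2 * i"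
      using s by (simp add: field_simps power2_eq_square power4_eq_xxxx)
    finally have "w\<^sup>2 * i \<le> s / 2 * w ^ 4 + 1 / (2 * s) * i\<^sup>2" by simp
    also have "\<dots> \<le> s / 2 * (real (J + 2) ^ 3 * ((\<Sum>j\<le>J. level_weight j ^ 4 * Rzw j \<omega>) + level_weight J ^ 4 * RAw \<omega>))
      + 1 / (2 * s) * (16 / \<mu>\<^sup>2 + exp (\<mu> / 4) * exp (- N \<omega>))"
      unfolding i_def using s by (intro add_mono mult_left_mono w4 inverse_count_le \<mu> N0) auto
    also have "\<dots> = G \<omega>" by (simp add: G_def mult.assoc)
    finally show "(chain_bound T a c J (\<lambda>i. sg * snd \<omega> i) (\<lambda>i. rho (fst \<omega> i)))\<^sup>2
      / (1 + real (card {i. i < n \<and> cell a (rho (fst \<omega> i)) = c'})) \<le> G \<omega>"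
      by (simp add: w_def i_def N_def)
  next
    have tau1: "1 \<le> level_variance a j" if "j \<le> J" for j
    proof -
      have "(2 :: real) ^ (j * ?d) \<le> 2 ^ (J * ?d)" using that by (intro power_increasing mult_right_mono) auto
      also have "\<dots> \<le> 2 ^ ?d * cell_rate a" by (rule J)
      also have "\<dots> \<le> mass_bound * cell_rate a" using mass_bound_ge l1 by (intro mult_right_mono) auto
      finally show ?thesis by (simp add: level_variance_def)
    qed
    have mE: "real n * mass {y. cell a y = c'} \<ge> \<mu>"
    proof -
      have "m0 * (1 / 2) ^ size_of a \<le> mass {y. cell a y = c'}"
        by (rule mass_ge) (use C in \<open>simp_all add: emeasure_cell\<close>)
      then have "real n * (m0 * (1 / 2) ^ size_of a) \<le> real n * mass {y. cell a y = c'}"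
        by (rule mult_left_mono) simp
      then show ?thesis by (simp add: \<mu>_def L_def cell_rate_def power_one_over mult.commute)
    qed
    have meanN: "mean_le (\<lambda>\<omega>. exp (- N \<omega>)) (exp (- \<mu> / 2))"
      unfolding N_def
    proof (rule mean_le_mono[OF mean_exp_count])
      have "exp (- 1 :: real) \<le> 1 / 2"
        using exp_ge_add_one_self[of 1] by (simp add: exp_minus field_simps)
      then have "real n * mass {y. cell a y = c'} * (exp (- 1) - 1) \<le> real n * mass {y. cell a y = c'} * (- 1 / 2)"
        using mass_bounds by (intro mult_left_mono) auto
      also have "\<dots> \<le> - \<mu> / 2" using mE by simp
      finally show "exp (real n * mass {y. cell a y = c'} * (exp (- 1) - 1)) \<le> exp (- \<mu> / 2)" by simp
    qed simp
    define D where "D = 8 * real ?d ^ 4 + 12288 + 2048 * exp (3 * mass_bound)"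
    define A where "A = real ?d ^ 4 * (mass_bound\<^sup>2 * L\<^sup>2 * X\<^sup>2)"
    have A: "0 \<le> A" by (simp add: A_def)
    have J1: "real J ^ 4 \<le> real (J + 2) ^ 4" by (intro power_mono) auto
    have one: "1 \<le> real (J + 2) ^ 4" by (intro one_le_power) auto
    have bnd: "8 * level_exponent j ^ 4 + y \<le> real (J + 2) ^ 4 * D" if j: "j \<le> J" and y: "0 \<le> y" "y \<le> 12288 + 2048 * exp (3 * mass_bound)" for j y
    proof -
      have "level_exponent j ^ 4 \<le> (real (J + 2) * real ?d) ^ 4"
        unfolding level_exponent_def of_nat_mult by (intro power_mono mult_right_mono) (use j in auto)
      also have "\<dots> = real (J + 2) ^ 4 * real ?d ^ 4" by (rule power_mult_distrib)
      finally have "8 * level_exponent j ^ 4 \<le> real (J + 2) ^ 4 * (8 * real ?d ^ 4)" by simp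
      moreover have "y \<le> real (J + 2) ^ 4 * (12288 + 2048 * exp (3 * mass_bound))"
      proof -
        have "1 * y \<le> real (J + 2) ^ 4 * (12288 + 2048 * exp (3 * mass_bound))" by (intro mult_mono one y) auto
        then show ?thesis by simp
      qed
      ultimately show ?thesis by (simp add: D_def distrib_left)
    qed
    \<comment> \<open>The first square cancels against the squared level variance, and what is left
      is \<open>2 ^ (2 * j * (d - 2))\<close>. Apart from the power of \<open>j\<close> in the level
      bounds, all levels thus cost the same for \<open>d = 2\<close>, and the finest one costs most
      for larger \<open>d\<close>.\<close>
    have wt4: "level_weight j ^ 4 = real ?d ^ 4 * (2 ^ (j * ?d))\<^sup>2 * (2 ^ (j * (?d - 2)))\<^sup>2" for j
    proof -
      have "(?d - 1) * 4 = 2 * ?d + 2 * (?d - 2)" using d by simp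
      then have "((2 ^ j) ^ (?d - 1)) ^ 4 = (2 ^ j :: real) ^ (2 * ?d + 2 * (?d - 2))"
        by (simp add: power_mult[symmetric])
      also have "\<dots> = (2 ^ (j * ?d))\<^sup>2 * (2 ^ (j * (?d - 2)))\<^sup>2"
        by (simp only: power_add power_mult) (simp only: power_mult[symmetric] ac_simps)
      finally show ?thesis by (simp add: level_weight_def power_mult_distrib)
    qed
    have Xj: "(2 ^ (j * (?d - 2)))\<^sup>2 \<le> X\<^sup>2" if "j \<le> J" for j
      unfolding X_def by (intro power_mono power_increasing mult_right_mono) (use that in auto)
    have tj: "level_weight j ^ 4 * ((level_variance a j)\<^sup>2 * (8 * level_exponent j ^ 4 + 12288)) \<le> A * (real (J + 2) ^ 4 * D)" if j: "j \<le> J" for j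
    proof -
      have "level_weight j ^ 4 * (level_variance a j)\<^sup>2 = real ?d ^ 4 * (mass_bound\<^sup>2 * L\<^sup>2) * (2 ^ (j * (?d - 2)))\<^sup>2"
        unfolding wt4 level_variance_def L_def by (simp add: power_mult_distrib power_divide)
      also have "\<dots> \<le> real ?d ^ 4 * (mass_bound\<^sup>2 * L\<^sup>2) * X\<^sup>2"
        by (intro mult_left_mono Xj j) auto
      also have "\<dots> = A" by (simp add: A_def)
      finally have "(level_weight j ^ 4 * (level_variance a j)\<^sup>2) * (8 * level_exponent j ^ 4 + 12288) \<le> A * (real (J + 2) ^ 4 * D)"
        by (intro mult_mono bnd j A) (auto simp: level_exponent_nonneg)
      then show ?thesis by (simp add: mult.assoc)
    qed
    have tA: "level_weight J ^ 4 * (8 * level_exponent J ^ 4 + 2048 * exp (3 * mass_bound)) \<le> A * (real (J + 2) ^ 4 * D)"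
    proof -
      have "(2 ^ (J * ?d))\<^sup>2 \<le> (mass_bound * L)\<^sup>2"
      proof (rule power_mono)
        have "2 ^ (J * ?d) \<le> 2 ^ ?d * L" using J by (simp add: L_def)
        also have "\<dots> \<le> mass_bound * L" using mass_bound_ge L by (intro mult_right_mono) auto
        finally show "2 ^ (J * ?d) \<le> mass_bound * L" .
      qed simp
      then have "real ?d ^ 4 * (2 ^ (J * ?d))\<^sup>2 * X\<^sup>2 \<le> real ?d ^ 4 * (mass_bound * L)\<^sup>2 * X\<^sup>2"
        by (intro mult_right_mono mult_left_mono) auto
      then have "level_weight J ^ 4 \<le> A" by (simp add: wt4 X_def[symmetric] A_def power_mult_distrib mult.assoc)
      then show ?thesis by (intro mult_mono bnd A) (auto simp: level_exponent_nonneg)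
    qed
    \<comment> \<open>The mean of \<open>exp (- N)\<close> decays faster than the factor
      \<open>exp (\<mu> / 4)\<close> of \<open>inverse_count_le\<close> grows. The 32 obtained here
      and the 16 of that lemma add up to the 48 in \<open>cell_bound\<close>.\<close>
    have ex: "exp (\<mu> / 4) * exp (- \<mu> / 2) \<le> 32 / \<mu>\<^sup>2"
    proof -
      have "1 + \<mu> / 4 + (\<mu> / 4)\<^sup>2 / 2 \<le> exp (\<mu> / 4)" by (rule exp_lower_Taylor_quadratic) (use \<mu> in simp)
      then have "\<mu>\<^sup>2 / 32 \<le> exp (\<mu> / 4)" using \<mu> by (simp add: power_divide)
      moreover have "0 < \<mu>\<^sup>2 / 32" using \<mu> by simp
      ultimately have "1 / exp (\<mu> / 4) \<le> 1 / (\<mu>\<^sup>2 / 32)" by (intro divide_left_mono) auto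
      moreover have "exp (\<mu> / 4) * exp (- \<mu> / 2) = 1 / exp (\<mu> / 4)"
      proof -
        have "exp (\<mu> / 4) * exp (- \<mu> / 2) = exp (\<mu> / 4 + - \<mu> / 2)" by (simp only: exp_add)
        also have "\<mu> / 4 + - \<mu> / 2 = - (\<mu> / 4)" by simp
        finally show ?thesis by (simp add: exp_minus inverse_eq_divide)
      qed
      ultimately show ?thesis by simp
    qed
    have "mean_le G (s / 2 * real (J + 2) ^ 3 * ((\<Sum>j\<le>J. level_weight j ^ 4 * ((level_variance a j)\<^sup>2 * (8 * level_exponent j ^ 4 + 12288)))
        + level_weight J ^ 4 * (8 * level_exponent J ^ 4 + 2048 * exp (3 * mass_bound))) + 1 / (2 * s) * (16 / \<mu>\<^sup>2 + exp (\<mu> / 4) * exp (- \<mu> / 2)))"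
      unfolding G_def Rzw_def RAw_def
      by (intro mean_le_add mean_le_cmult mean_le_const mean_le_sum mean_Rz mean_RA meanN T tau1 J)
         (use s in auto)
    then have "mean_le G (s / 2 * real (J + 2) ^ 3 * ((\<Sum>j\<le>J. A * (real (J + 2) ^ 4 * D)) + A * (real (J + 2) ^ 4 * D))
       + 1 / (2 * s) * (16 / \<mu>\<^sup>2 + 32 / \<mu>\<^sup>2))"
    proof (rule mean_le_mono)
      show "s / 2 * real (J + 2) ^ 3 * ((\<Sum>j\<le>J. level_weight j ^ 4 * ((level_variance a j)\<^sup>2 * (8 * level_exponent j ^ 4 + 12288)))
        + level_weight J ^ 4 * (8 * level_exponent J ^ 4 + 2048 * exp (3 * mass_bound))) + 1 / (2 * s) * (16 / \<mu>\<^sup>2 + exp (\<mu> / 4) * exp (- \<mu> / 2))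
        \<le> s / 2 * real (J + 2) ^ 3 * ((\<Sum>j\<le>J. A * (real (J + 2) ^ 4 * D)) + A * (real (J + 2) ^ 4 * D))
       + 1 / (2 * s) * (16 / \<mu>\<^sup>2 + 32 / \<mu>\<^sup>2)"
        using s by (intro add_mono mult_left_mono sum_mono tj tA ex) auto
    qed
    also have "(\<Sum>j\<le>J. A * (real (J + 2) ^ 4 * D)) + A * (real (J + 2) ^ 4 * D) = real (J + 2) * (A * (real (J + 2) ^ 4 * D))"
      by (simp add: algebra_simps)
    also have "s / 2 * real (J + 2) ^ 3 * (real (J + 2) * (A * (real (J + 2) ^ 4 * D))) + 1 / (2 * s) * (16 / \<mu>\<^sup>2 + 32 / \<mu>\<^sup>2)
      = cell_const * real (J + 2) ^ 4 * X"
    proof -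
      define y where "y = real (J + 2)"
      have y: "0 < y" by (simp add: y_def)
      have nz: "L \<noteq> 0" "X \<noteq> 0" "m0 \<noteq> 0" "y \<noteq> 0" using L X m0 y by auto
      have "s / 2 * y ^ 3 * (y * (A * (y ^ 4 * D))) = (real ?d ^ 4 * mass_bound\<^sup>2 * D) / 2 * y ^ 4 * X"
        using nz unfolding s_def A_def y_def[symmetric]
        by (simp add: divide_simps) (simp add: power2_eq_square power3_eq_cube power4_eq_xxxx)
      moreover have "1 / (2 * s) * (16 / \<mu>\<^sup>2 + 32 / \<mu>\<^sup>2) = 48 / m0\<^sup>2 / 2 * y ^ 4 * X"
        using nz unfolding s_def \<mu>_def y_def[symmetric]
        by (simp add: divide_simps power_mult_distrib)
      ultimately show ?thesis unfolding y_def[symmetric]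
        by (simp add: cell_const_def cell_bound_def mass_bound_def[symmetric] D_def distrib_right add_divide_distrib)
    qed
    finally show "mean_le G (cell_const * real (J + 2) ^ 4 * 2 ^ (J * (?d - 2)))" by (simp add: X_def)
  qed
qed

end

section \<open>Summation over the cells\<close>

lemma log_plus_ge_1: "1 \<le> log_plus x"
proof -
  have "ln (exp 1) \<le> ln (max x (exp 1))" by (subst ln_le_cancel_iff) (auto simp: less_max_iff_disj)
  then show ?thesis by (simp add: log_plus_def)
qed

lemma ln_le_log_plus: "0 < x \<Longrightarrow> ln x \<le> log_plus x"
  unfolding log_plus_def by (subst ln_le_cancel_iff) (auto simp: less_max_iff_disj)

text \<open>The index \<open>p\<close> counts how often the expected number of points in a cell
  doubles beyond \<open>n / k\<close>; the fourth power is the chaining factor.\<close>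

definition geom_const :: "nat \<Rightarrow> real" where
  "geom_const d = (\<Sum>p. (2 powr (- 2 / real d)) ^ p * (1 + real p) ^ 4)"

text \<open>Comparison with a geometric series whose ratio \<open>t\<close> lies strictly between
  \<open>q\<close> and 1: the power \<open>(q / t) ^ p\<close> outweighs the polynomial
  factor.\<close>

lemma summable_geom_const:
  assumes "0 < d"
  shows "summable (\<lambda>p. (2 powr (- 2 / real d)) ^ p * (1 + real p) ^ 4)"
proof -
  define q where "q = (2 :: real) powr (- 2 / real d)"
  have q: "0 < q" "q < 1" using assms by (auto simp: q_def powr_less_one)
  define t where "t = (q + 1) / 2"
  have t: "q < t" "t < 1" "0 < t" using q by (auto simp: t_def)
  have lim: "(\<lambda>p. (1 + real p) ^ 4 * (q / t) ^ p) \<longlonglongrightarrow> 0"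
  proof -
    define y where "y = root 4 (q / t)"
    have y: "0 \<le> y" "y < 1" "y ^ 4 = q / t" using q t by (auto simp: y_def real_root_pow_pos2)
    have "(\<lambda>p. y ^ p + real p * y ^ p) \<longlonglongrightarrow> 0 + 0"
      by (intro tendsto_add LIMSEQ_power_zero powser_times_n_limit_0) (use y in auto)
    then have "(\<lambda>p. (y ^ p + real p * y ^ p) ^ 4) \<longlonglongrightarrow> (0 + 0) ^ 4" by (rule tendsto_power)
    moreover have "(y ^ p + real p * y ^ p) ^ 4 = (1 + real p) ^ 4 * (q / t) ^ p" for p
    proof -
      have "(y ^ p + real p * y ^ p) ^ 4 = ((1 + real p) * y ^ p) ^ 4" by (simp add: algebra_simps)
      also have "\<dots> = (1 + real p) ^ 4 * (y ^ 4) ^ p"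
        by (simp only: power_mult_distrib power_mult[symmetric] mult.commute)
      finally show ?thesis by (simp add: y)
    qed
    ultimately show ?thesis by simp
  qed
  then have "eventually (\<lambda>p. (1 + real p) ^ 4 * (q / t) ^ p < 1) sequentially"
    by (rule order_tendstoD) simp
  then have "eventually (\<lambda>p. norm (q ^ p * (1 + real p) ^ 4) \<le> t ^ p) sequentially"
  proof eventually_elim
    case (elim p)
    then have "(1 + real p) ^ 4 * (q / t) ^ p * t ^ p \<le> 1 * t ^ p" by (intro mult_right_mono) (use t in auto)
    moreover have "(1 + real p) ^ 4 * (q / t) ^ p * t ^ p = q ^ p * (1 + real p) ^ 4" using t by (simp add: power_divide)
    ultimately show ?case using q by simp
  qed
  moreover have "summable (\<lambda>p. t ^ p)" using t by (intro summable_geometric) auto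
  ultimately show ?thesis unfolding q_def[symmetric] by (rule summable_comparison_test_ev)
qed

lemma geom_const_nonneg: "0 \<le> geom_const d" if "0 < d"
  unfolding geom_const_def by (rule suminf_nonneg[OF summable_geom_const[OF that]]) auto

text \<open>The cost of a level is bounded by the number of its cells, of which there are at most \<open>2 ^ m\<close>
  and at most \<open>D k (ln r) ^ d\<close>. The two bounds cross at cells with \<open>r = n / k\<close> expected points.\<close>

lemma sum_over_levels:
  fixes n k s d :: nat and D :: real
  assumes d: "2 \<le> d" and k: "1 \<le> k" "k \<le> n" and s: "2 ^ s \<le> n" "n < 2 ^ Suc s" and D: "0 \<le> D"
    and r: "r = real n / real k" and L: "L = log_plus r"
    and N: "\<And>m. m \<le> s \<Longrightarrow> N m \<le> 2 ^ m" "\<And>m. m \<le> s \<Longrightarrow> N m \<le> D * real k * L ^ d" "\<And>m. 0 \<le> N m"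
  shows "(\<Sum>m\<le>s. N m * (real (s - m + 3) ^ 4 * (real n / 2 ^ m) powr (1 - 2 / real d)))
    \<le> (6250 * D + 1296 * geom_const d) * (real n * r powr (- 2 / real d) * L ^ (d + 5))"
proof -
  have r1: "1 \<le> r" using k by (simp add: r)
  have L1: "1 \<le> L" by (simp add: L log_plus_ge_1)
  have n0: "0 < real n" using k by simp
  define R where "R = r powr (- 2 / real d)"
  have R: "0 < R" using r1 by (simp add: R_def)
  define lam where "lam m = real n / 2 ^ m" for m :: nat
  define i0 where "i0 = nat \<lfloor>log 2 r\<rfloor>"
  have lr: "0 \<le> log 2 r" using r1 by simp
  have i0: "2 ^ i0 \<le> r" "r < 2 ^ Suc i0" "real i0 \<le> log 2 r"
  proof -
    have a: "real i0 \<le> log 2 r" "log 2 r < real i0 + 1" using lr by (auto simp: i0_def)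
    have e: "2 powr (log 2 r) = r" using r1 by simp
    have "2 powr real i0 \<le> 2 powr (log 2 r)" using a by simp
    then show "2 ^ i0 \<le> r" unfolding e by (simp add: powr_realpow)
    have "2 powr (log 2 r) < 2 powr real (Suc i0)" using a by simp
    then show "r < 2 ^ Suc i0" unfolding e by (simp only: powr_realpow)
    show "real i0 \<le> log 2 r" by (rule a)
  qed
  have i0L: "real i0 \<le> 2 * L"
  proof -
    have "1 / 2 \<le> ln (2::real)" using exp_half_le by (subst ln_ge_iff) auto
    then have "ln r / ln 2 \<le> ln r / (1 / 2)" using r1 by (intro divide_left_mono) auto
    then have "log 2 r \<le> 2 * ln r" by (simp add: log_def)
    also have "\<dots> \<le> 2 * L" using ln_le_log_plus[of r] r1 by (simp add: L)
    finally show ?thesis using i0(3) by simp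
  qed
  define ex where "ex = 1 - 2 / real d"
  have ex: "0 \<le> ex" "ex \<le> 1" using d by (auto simp: ex_def field_simps)
  define t where "t m = N m * (real (s - m + 3) ^ 4 * lam m powr ex)" for m
  \<comment> \<open>The levels of small cells, with at most \<open>2 * r\<close> expected points.
    There are only logarithmically many of them, so the bound on the number of cells that is linear
    in \<open>k\<close> may be used for each; on \<open>I'\<close> the bound \<open>2 ^ m\<close> is
    used.\<close>
  define I where "I = {m. m \<le> s \<and> s - m \<le> i0}"
  define I' where "I' = {m. m \<le> s \<and> i0 < s - m}"
  have lam: "2 ^ (s - m) \<le> lam m" "lam m < 2 ^ Suc (s - m)" if "m \<le> s" for m
  proof -
    have p: "(2::real) ^ s = 2 ^ (s - m) * 2 ^ m" using that by (simp add: power_add[symmetric])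
    have "(2::real) ^ s \<le> real n" using s(1) by (metis of_nat_le_iff of_nat_numeral of_nat_power)
    then show "2 ^ (s - m) \<le> lam m" unfolding lam_def p by (simp add: le_divide_eq)
    have "real n < 2 ^ Suc s" using s(2) by (metis of_nat_less_iff of_nat_numeral of_nat_power)
    then show "lam m < 2 ^ Suc (s - m)" unfolding lam_def by (simp add: p divide_less_eq)
  qed
  have sI: "(\<Sum>m\<in>I. t m) \<le> 6250 * D * (real n * R * L ^ (d + 5))"
  proof -
    have tm: "t m \<le> D * real k * L ^ d * ((5 * L) ^ 4 * (2 * r powr ex))" if m: "m \<in> I" for m
    proof -
      have ms: "m \<le> s" "s - m \<le> i0" using m by (auto simp: I_def)
      have "real (s - m + 3) \<le> 5 * L" using ms(2) i0L L1 by simp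
      then have a: "real (s - m + 3) ^ 4 \<le> (5 * L) ^ 4" by (rule power_mono) simp
      have "lam m \<le> 2 ^ Suc (s - m)" using lam(2)[OF ms(1)] by simp
      also have "\<dots> \<le> (2::real) ^ Suc i0" by (rule power_increasing) (use ms in auto)
      also have "\<dots> \<le> 2 * r" using i0(1) by simp
      finally have "lam m powr ex \<le> (2 * r) powr ex" by (intro powr_mono2 ex) (auto simp: lam_def)
      also have "\<dots> = 2 powr ex * r powr ex" using r1 by (simp add: powr_mult)
      also have "\<dots> \<le> 2 * r powr ex"
        using powr_mono[of ex 1 "2::real"] ex by (intro mult_right_mono) auto
      finally have b: "lam m powr ex \<le> 2 * r powr ex" .
      show ?thesis unfolding t_def
        by (intro mult_mono N(2) a b) (use ms D k L1 in auto)
    qed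
    have "card I \<le> i0 + 1"
    proof -
      have "I \<subseteq> (\<lambda>i. s - i) ` {..i0}"
      proof
        fix m assume "m \<in> I"
        then show "m \<in> (\<lambda>i. s - i) ` {..i0}" by (intro image_eqI[of _ _ "s - m"]) (auto simp: I_def)
      qed
      then have "card I \<le> card ((\<lambda>i. s - i) ` {..i0})" by (rule card_mono[rotated]) simp
      also have "\<dots> \<le> card {..i0}" by (rule card_image_le) simp
      finally show ?thesis by simp
    qed
    then have cI: "real (card I) \<le> 5 * L" using i0L L1 by linarith
    have "(\<Sum>m\<in>I. t m) \<le> real (card I) * (D * real k * L ^ d * ((5 * L) ^ 4 * (2 * r powr ex)))"
      by (rule sum_bounded_above) (rule tm)
    also have "\<dots> \<le> 5 * L * (D * real k * L ^ d * ((5 * L) ^ 4 * (2 * r powr ex)))"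
      by (rule mult_right_mono[OF cI]) (use D k L1 in auto)
    \<comment> \<open>Here \<open>5 * 5 ^ 4 * 2 = 6250\<close>. The power of \<open>L\<close>
      consists of \<open>d\<close> from the number of cells, 4 from the chaining factor and 1 from
      the number of levels.\<close>
    also have "\<dots> = 6250 * D * ((real k * r powr ex) * L ^ (d + 5))"
      by (simp add: power_mult_distrib power_add eval_nat_numeral)
    also have "real k * r powr ex = real n * R"
    proof -
      have "r powr ex = r * R" using r1 unfolding ex_def R_def by (simp add: powr_diff powr_minus_divide)
      moreover have "real k * r = real n" using k by (simp add: r)
      ultimately show ?thesis by simp
    qed
    finally show ?thesis .
  qed
  have sI': "(\<Sum>m\<in>I'. t m) \<le> 1296 * geom_const d * (real n * R * L ^ (d + 5))"
  proof -
    define q where "q = (2::real) powr (- 2 / real d)"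
    \<comment> \<open>The distance from the level where the two bounds cross. Since
      \<open>2 ^ m * lam m\<close> is constantly \<open>n\<close>, the factor
      \<open>lam m powr (- 2 / d)\<close> makes the cost decay geometrically in it, up to the
      polynomial chaining factor.\<close>
    define idx where "idx m = s - m - Suc i0" for m
    have tm: "t m \<le> real n * R * (6 * L) ^ 4 * (q ^ (idx m) * (1 + real (idx m)) ^ 4)" if m: "m \<in> I'" for m
    proof -
      have ms: "m \<le> s" "i0 < s - m" using m by (auto simp: I'_def)
      define p where "p = idx m"
      have p: "s - m = Suc i0 + p" using ms by (simp add: p_def idx_def)
      have lpos: "0 < lam m" using n0 by (simp add: lam_def)
      have "t m \<le> 2 ^ m * (real (s - m + 3) ^ 4 * lam m powr ex)"
        unfolding t_def by (intro mult_right_mono N(1) ms) auto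
      also have "\<dots> = (2 ^ m * lam m) * (lam m powr (- 2 / real d) * real (s - m + 3) ^ 4)"
        using lpos by (simp add: ex_def powr_diff powr_minus_divide)
      also have "2 ^ m * lam m = real n" by (simp add: lam_def)
      also have "lam m powr (- 2 / real d) \<le> R * q ^ p"
      proof -
        have "lam m powr (- 2 / real d) \<le> (2 ^ (s - m)) powr (- 2 / real d)"
          by (rule powr_mono2') (use lam(1)[OF ms(1)] in auto)
        also have "(2::real) ^ (s - m) = 2 ^ Suc i0 * 2 ^ p" by (simp add: p power_add)
        also have "(2 ^ Suc i0 * 2 ^ p) powr (- 2 / real d) = (2 ^ Suc i0) powr (- 2 / real d) * (2 ^ p :: real) powr (- 2 / real d)"
          by (rule powr_mult) 
        also have "(2 ^ p :: real) powr (- 2 / real d) = q ^ p"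
          unfolding q_def by (simp add: powr_realpow[symmetric] powr_powr mult.commute)
        also have "(2 ^ Suc i0 :: real) powr (- 2 / real d) \<le> R"
          unfolding R_def by (rule powr_mono2') (use i0(2) r1 in auto)
        finally show ?thesis by (simp add: q_def mult_right_mono)
      qed
      also have "real (s - m + 3) ^ 4 \<le> (6 * L * (1 + real p)) ^ 4"
      proof (rule power_mono)
        have "real (s - m + 3) = real i0 + 4 + real p" by (simp add: p)
        also have "\<dots> \<le> 6 * L + real p" using i0L L1 by simp
        also have "\<dots> \<le> 6 * L + 6 * L * real p" using L1 mult_right_mono[of 1 "6 * L" "real p"] by simp
        finally show "real (s - m + 3) \<le> 6 * L * (1 + real p)" by (simp add: algebra_simps)
      qed simp
      finally have "t m \<le> real n * (R * q ^ p * (6 * L * (1 + real p)) ^ 4)"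
        by (simp add: mult_left_mono mult_right_mono R less_imp_le q_def)
      also have "real n * (R * q ^ p * (6 * L * (1 + real p)) ^ 4) = real n * R * (6 * L) ^ 4 * (q ^ p * (1 + real p) ^ 4)"
        by (simp only: power_mult_distrib ac_simps)
      finally show ?thesis by (simp only: p_def)
    qed
    have fin: "finite I'" by (simp add: I'_def)
    have inj: "inj_on idx I'" by (auto simp: inj_on_def I'_def idx_def)
    have "(\<Sum>m\<in>I'. t m) \<le> (\<Sum>m\<in>I'. real n * R * (6 * L) ^ 4 * (q ^ (idx m) * (1 + real (idx m)) ^ 4))"
      by (rule sum_mono) (rule tm)
    also have "\<dots> = real n * R * (6 * L) ^ 4 * (\<Sum>p\<in>idx ` I'. q ^ p * (1 + real p) ^ 4)"
      by (simp add: sum.reindex[OF inj] sum_distrib_left comp_def)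
    also have "\<dots> \<le> real n * R * (6 * L) ^ 4 * geom_const d"
      unfolding geom_const_def q_def
      by (intro mult_left_mono sum_le_suminf summable_geom_const) (use fin d R L1 in auto)
    also have "\<dots> = 1296 * geom_const d * (real n * R * L ^ 4)" by (simp add: power_mult_distrib)
    also have "\<dots> \<le> 1296 * geom_const d * (real n * R * L ^ (d + 5))"
      by (intro mult_left_mono power_increasing L1) (use R geom_const_nonneg[of d] d in auto)
    finally show ?thesis .
  qed
  have "{..s} = I \<union> I'" "I \<inter> I' = {}" "finite I" "finite I'" by (auto simp: I_def I'_def)
  then have "(\<Sum>m\<le>s. t m) = (\<Sum>m\<in>I. t m) + (\<Sum>m\<in>I'. t m)" by (simp add: sum.union_disjoint)
  also have "\<dots> \<le> (6250 * D + 1296 * geom_const d) * (real n * R * L ^ (d + 5))"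
    using sI sI' by (simp add: distrib_right)
  finally show ?thesis by (simp add: t_def lam_def ex_def R_def)
qed

definition vol_const :: "nat \<Rightarrow> real" where
  "vol_const d = exp 1 * 8 ^ d * (1 + 2 ^ Suc d) ^ d + 4 * (2 * real d + 1)"

lemma (in level_boxes) thin_measure:
  assumes k: "1 \<le> k" "card K \<le> k" "k \<le> n" and m: "2 ^ m \<le> 2 * real n"
    and r: "r = real n / real k" and L: "L = log_plus r"
  shows "measure lborel (thin m) \<le> vol_const CARD('d) * (real k / 2 ^ m) * L ^ CARD('d)"
proof -
  let ?d = "CARD('d)"
  have r1: "1 \<le> r" using k by (simp add: r)
  have L1: "1 \<le> L" by (simp add: L log_plus_ge_1)
  \<comment> \<open>The power is high enough to undo the exponent \<open>1 / 2 ^ CARD('d)\<close> of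
    the low-density bound, which becomes of order \<open>1 / r\<close>, while \<open>ln B\<close>
    remains a constant multiple of \<open>ln r\<close>.\<close>
  define B where "B = r ^ (2 ^ Suc ?d)"
  have B: "1 \<le> B" using r1 by (simp add: B_def)
  have lnB: "1 + ln B \<le> (1 + 2 ^ Suc ?d) * L"
  proof -
    have "ln B = 2 ^ Suc ?d * ln r" using r1 by (simp add: B_def ln_realpow)
    also have "\<dots> \<le> 2 ^ Suc ?d * L" using ln_le_log_plus[of r] r1 by (simp add: L)
    finally show ?thesis using L1 by (simp add: distrib_right)
  qed
  have th: "(2 ^ ?d * B powr (- 1 / 2)) powr (1 / 2 ^ ?d) \<le> 2 / r"
  proof -
    have "B powr (- 1 / 2) = (1 / r) ^ (2 ^ ?d)"
    proof -
      have "B = (r ^ (2 ^ ?d))\<^sup>2" by (simp add: B_def power_mult[symmetric] mult.commute)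
      then have "B powr (1 / 2) = r ^ (2 ^ ?d)" using r1 by (simp add: powr_half_sqrt)
      then show ?thesis by (simp add: powr_minus_divide power_one_over)
    qed
    also have "2 ^ ?d * (1 / r) ^ (2 ^ ?d) \<le> (2 / r) ^ (2 ^ ?d)"
    proof -
      have "(2::real) ^ ?d \<le> 2 ^ (2 ^ ?d)" by (rule power_increasing) (auto simp: less_imp_le)
      then have "2 ^ ?d * (1 / r) ^ (2 ^ ?d) \<le> 2 ^ (2 ^ ?d) * (1 / r) ^ (2 ^ ?d)" by (rule mult_right_mono) (use r1 in simp)
      then show ?thesis by (simp add: power_divide)
    qed
    finally have "(2 ^ ?d * B powr (- 1 / 2)) powr (1 / 2 ^ ?d) \<le> ((2 / r) ^ (2 ^ ?d)) powr (1 / 2 ^ ?d)"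
      by (intro powr_mono2) auto
    also have "\<dots> = 2 / r"
    proof -
      have "(2 / r) ^ (2 ^ ?d) = (2 / r) powr (2 ^ ?d)" using r1 by (simp add: powr_realpow[symmetric])
      then show ?thesis using r1 by (simp add: powr_powr)
    qed
    finally show ?thesis .
  qed
  have kr: "1 / r \<le> 2 * (real k / 2 ^ m) * L ^ ?d"
  proof -
    have "1 / r = real k / real n" by (simp add: r)
    also have "\<dots> \<le> real k / (2 ^ m / 2)" by (rule divide_left_mono) (use m k in auto)
    also have "\<dots> = 2 * (real k / 2 ^ m) * 1" by simp
    also have "\<dots> \<le> 2 * (real k / 2 ^ m) * L ^ ?d" by (intro mult_left_mono one_le_power L1) auto
    finally show ?thesis .
  qed
  have "measure lborel (thin m) \<le> real (card K) * (exp 1 * (8 ^ ?d / 2 ^ m) * (1 + ln B) ^ ?d)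
    + (2 * real ?d + 1) * (2 ^ ?d * B powr (- 1 / 2)) powr (1 / 2 ^ ?d)"
    unfolding measure_def using thin_volume[OF B, of m] B by (intro enn2real_leI) (auto intro!: add_nonneg_nonneg mult_nonneg_nonneg)
  also have "\<dots> \<le> real k * (exp 1 * (8 ^ ?d / 2 ^ m) * ((1 + 2 ^ Suc ?d) * L) ^ ?d) + (2 * real ?d + 1) * (2 / r)"
    by (intro add_mono mult_mono power_mono lnB th) (use k B in \<open>auto intro!: mult_nonneg_nonneg add_nonneg_nonneg\<close>)
  also have "\<dots> \<le> real k * (exp 1 * (8 ^ ?d / 2 ^ m) * ((1 + 2 ^ Suc ?d) * L) ^ ?d) + (2 * real ?d + 1) * (2 * (2 * (real k / 2 ^ m) * L ^ ?d))"
    using kr by (intro add_left_mono mult_left_mono) auto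
  also have "\<dots> = vol_const ?d * (real k / 2 ^ m) * L ^ ?d"
    unfolding vol_const_def power_mult_distrib by (simp add: field_simps)
  finally show ?thesis .
qed

text \<open>The chaining stops at the first level whose subcells have at most one expected point
  under the uniform density. There \<open>2 ^ J\<close> is about \<open>l powr (1 / d)\<close>,
  which turns the boundary factor \<open>2 ^ (J * (d - 2))\<close> into
  \<open>l powr (1 - 2 / d)\<close>.\<close>

lemma dyadic_exponent:
  fixes l :: real
  assumes d: "2 \<le> d" and l: "1 \<le> l" "l < 2 ^ Suc i"
  obtains J :: nat where "l \<le> 2 ^ (J * d)" "2 ^ (J * d) \<le> 2 ^ d * l" "J \<le> Suc i"
    "2 ^ (J * (d - 2)) \<le> 2 ^ d * l powr (1 - 2 / real d)"
proof -
  have "l \<le> 2 ^ (Suc i * d)"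
  proof -
    have "Suc i * 1 \<le> Suc i * d" by (rule mult_le_mono2) (use d in simp)
    then have "(2::real) ^ Suc i \<le> 2 ^ (Suc i * d)" by (intro power_increasing) auto
    then show ?thesis using l by simp
  qed
  then have ex: "\<exists>J. l \<le> 2 ^ (J * d)" by blast
  define J where "J = (LEAST J. l \<le> 2 ^ (J * d))"
  have J: "l \<le> 2 ^ (J * d)" unfolding J_def by (rule LeastI_ex[OF ex])
  have Jle: "J \<le> Suc i" unfolding J_def by (rule Least_le) fact
  have e0: "0 \<le> 1 - 2 / real d" using d by (simp add: field_simps)
  have l1: "1 \<le> l powr (1 - 2 / real d)" by (rule ge_one_powr_ge_zero[OF l(1) e0])
  have "2 ^ (J * d) \<le> 2 ^ d * l \<and> 2 ^ (J * (d - 2)) \<le> 2 ^ d * l powr (1 - 2 / real d)"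
  proof (cases J)
    case 0
    have "1 * 1 \<le> 2 ^ d * l" "1 * 1 \<le> 2 ^ d * l powr (1 - 2 / real d)" by (intro mult_mono; use l l1 in simp)+
    then show ?thesis using 0 by simp
  next
    case (Suc j)
    have "\<not> l \<le> 2 ^ (j * d)" using Suc unfolding J_def by (intro not_less_Least) simp
    then have jl: "2 ^ (j * d) \<le> l" by simp
    have "(2::real) ^ (j * (d - 2)) = (2 ^ (j * d)) powr (1 - 2 / real d)"
    proof -
      have e: "real (j * d) * (1 - 2 / real d) = real (j * (d - 2))"
        using d by (simp add: field_simps of_nat_diff)
      have "(2::real) ^ (j * (d - 2)) = 2 powr real (j * (d - 2))" by (simp only: powr_realpow)
      also have "\<dots> = 2 powr (real (j * d) * (1 - 2 / real d))" by (simp only: e)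
      also have "\<dots> = (2 powr real (j * d)) powr (1 - 2 / real d)" by (simp only: powr_powr)
      also have "2 powr real (j * d) = (2::real) ^ (j * d)" by (simp only: powr_realpow)
      finally show ?thesis .
    qed
    also have "\<dots> \<le> l powr (1 - 2 / real d)" by (rule powr_mono2[OF e0 _ jl]) simp
    finally have "(2::real) ^ (d - 2) * 2 ^ (j * (d - 2)) \<le> 2 ^ d * l powr (1 - 2 / real d)"
      by (intro mult_mono power_increasing) auto
    then show ?thesis using jl Suc by (simp add: power_add)
  qed
  then show ?thesis using J Jle that by blast
qed

definition gap_const :: "nat \<Rightarrow> real \<Rightarrow> real \<Rightarrow> real" where
  "gap_const d M0 cc = (let Q = real ((4 * d + 1) ^ d) + 1 in
     16 * M0 * vol_const d + 2 * Q * (cc * 2 ^ d) * (6250 * (Q * vol_const d) + Q * (1296 * geom_const d)))"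

lemma vol_const_nonneg: "0 \<le> vol_const d" by (simp add: vol_const_def)

locale level_design = level_boxes K al be col f + mapped_design P n rho sg m0 M0
  for K and al be :: "nat \<Rightarrow> real ^ 'd::finite" and col f and P :: "(real ^ 'd) measure" and n rho sg m0 M0
begin

text \<open>The majorant \<open>G\<close> is fixed before \<open>\<omega>\<close> and
  \<open>u\<close>. A single mean thus controls the gap for all admissible \<open>u\<close>
  simultaneously, in particular for one computed from the sample.\<close>

lemma mean_gap:
  assumes d: "2 \<le> CARD('d)" and k: "1 \<le> k" "card K \<le> k" "k \<le> n"
    and r: "r = real n / real k" and L: "L = log_plus r"
  obtains G where "mean_le G (gap_const CARD('d) M0 cell_const * (real n * r powr (- 2 / real CARD('d)) * L ^ (CARD('d) + 5)))"
    "\<And>\<omega> u. (\<And>i. i < n \<Longrightarrow> rho (fst \<omega> i) \<in> Omega) \<Longrightarrow> (\<And>i. i < n \<Longrightarrow> 0 \<le> u i) \<Longrightarrow>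
      (\<And>i j. i < n \<Longrightarrow> j < n \<Longrightarrow> rho (fst \<omega> i) \<le> rho (fst \<omega> j) \<Longrightarrow>
        f (rho (fst \<omega> i)) = f (rho (fst \<omega> j)) \<Longrightarrow> u i \<le> u j) \<Longrightarrow>
      2 * (\<Sum>i<n. sg * snd \<omega> i * u i) - (\<Sum>i<n. (u i)\<^sup>2) \<le> G \<omega>"
proof -
  let ?d = "CARD('d)"
  define Q where "Q = real ((4 * ?d + 1) ^ ?d) + 1"
  have Q: "1 \<le> Q" by (simp add: Q_def)
  have r1: "1 \<le> r" using k by (simp add: r)
  have L1: "1 \<le> L" by (simp add: L log_plus_ge_1)
  have n1: "1 \<le> n" using k by simp
  \<comment> \<open>Cells of size up to \<open>s\<close> have a rate of at least one point, as the
    chaining requires. Points with smaller boxes are left to the bound by the squared noise on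
    \<open>thin (Suc s)\<close>.\<close>
  obtain s where s: "2 ^ s \<le> n" "n < 2 ^ Suc s"
  proof -
    have "\<exists>s. 2 ^ s \<le> n \<and> n < 2 ^ (s + 1)" by (rule ex_power_ivl1) (use n1 in auto)
    then show ?thesis using that by auto
  qed
  have sr: "2 ^ s \<le> real n" "real n < 2 ^ Suc s"
    using s by (metis of_nat_le_iff of_nat_numeral of_nat_power, metis of_nat_less_iff of_nat_numeral of_nat_power)
  \<comment> \<open>The 3 combines the \<open>J + 2\<close> of \<open>mean_cell\<close> with
    \<open>J \<le> Suc (s - m)\<close>.\<close>
  define kap where "kap m = cell_const * real (s - m + 3) ^ 4 * (2 ^ ?d * (real n / 2 ^ m) powr (1 - 2 / real ?d))" for m
  have "\<exists>J G. mean_le G (kap (size_of a)) \<and> (\<forall>\<omega>. (chain_bound (assigned a) a c J (\<lambda>i. sg * snd \<omega> i) (\<lambda>i. rho (fst \<omega> i)))\<^sup>2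
      / (1 + real (card {i. i < n \<and> cell a (rho (fst \<omega> i)) = upcell c})) \<le> G \<omega>)"
    if ac: "(a, c) \<in> active s" for a c
  proof -
    have ms: "size_of a \<le> s" using ac by (auto simp: active_def)
    obtain x where x: "x \<in> assigned a" "cell a x = c" using ac by (auto simp: active_def)
    have l1: "1 \<le> cell_rate a"
    proof -
      have "(2::real) ^ size_of a \<le> 2 ^ s" by (rule power_increasing) (use ms in auto)
      then have "(2::real) ^ size_of a \<le> real n" using sr(1) by (rule order_trans)
      then show ?thesis by (simp add: cell_rate_def)
    qed
    have "cell_rate a < 2 ^ Suc (s - size_of a)"
    proof -
      have "(2::real) ^ Suc s = 2 ^ Suc (s - size_of a) * 2 ^ size_of a"
        by (simp only: power_add[symmetric]) (use ms in simp)
      then show ?thesis using sr(2) by (simp add: cell_rate_def divide_less_eq)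
    qed
    then obtain J where J: "cell_rate a \<le> 2 ^ (J * ?d)" "2 ^ (J * ?d) \<le> 2 ^ ?d * cell_rate a" "J \<le> Suc (s - size_of a)"
      "2 ^ (J * (?d - 2)) \<le> 2 ^ ?d * cell_rate a powr (1 - 2 / real ?d)"
      using dyadic_exponent[OF d l1] by blast
    obtain G where G: "mean_le G (cell_const * real (J + 2) ^ 4 * 2 ^ (J * (?d - 2)))"
      "\<And>\<omega>. (chain_bound (assigned a) a c J (\<lambda>i. sg * snd \<omega> i) (\<lambda>i. rho (fst \<omega> i)))\<^sup>2
      / (1 + real (card {i. i < n \<and> cell a (rho (fst \<omega> i)) = upcell c})) \<le> G \<omega>"
      by (rule mean_cell[OF d assigned_measurable l1 J(1,2), of "upcell c" a c]) (use upcell_const(1)[OF x] in auto)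
    have "mean_le G (kap (size_of a))"
      unfolding kap_def
      by (rule mean_le_mono[OF G(1)], intro mult_mono power_mono mult_left_mono J(4)[unfolded cell_rate_def])
         (use J(3) cell_const_nonneg in auto)
    with G(2) show ?thesis by blast
  qed
  then have "\<forall>p\<in>active s. \<exists>JG. mean_le (snd JG) (kap (size_of (fst p))) \<and>
      (\<forall>\<omega>. (chain_bound (assigned (fst p)) (fst p) (snd p) (fst JG) (\<lambda>i. sg * snd \<omega> i) (\<lambda>i. rho (fst \<omega> i)))\<^sup>2
      / (1 + real (card {i. i < n \<and> cell (fst p) (rho (fst \<omega> i)) = upcell (snd p)})) \<le> snd JG \<omega>)"
    by simp
  from bchoice[OF this] obtain JG where JG: "\<And>p. p \<in> active s \<Longrightarrow> mean_le (snd (JG p)) (kap (size_of (fst p)))"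
    "\<And>p \<omega>. p \<in> active s \<Longrightarrow> (chain_bound (assigned (fst p)) (fst p) (snd p) (fst (JG p)) (\<lambda>i. sg * snd \<omega> i) (\<lambda>i. rho (fst \<omega> i)))\<^sup>2
      / (1 + real (card {i. i < n \<and> cell (fst p) (rho (fst \<omega> i)) = upcell (snd p)})) \<le> snd (JG p) \<omega>"
    by blast
  define J where "J p = fst (JG p)" for p
  define G where "G p = snd (JG p)" for p
  define GG where "GG \<omega> = 2 * (\<Sum>i | i < n \<and> rho (fst \<omega> i) \<in> thin (Suc s). (sg * snd \<omega> i)\<^sup>2)
    + (\<Sum>p\<in>active s. 2 * Q * G p \<omega>)" for \<omega>
  show thesis
  proof (rule that[of GG])
    fix \<omega> :: "(nat \<Rightarrow> real ^ 'd) \<times> (nat \<Rightarrow> real)" and u :: "nat \<Rightarrow> real"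
    assume x: "\<And>i. i < n \<Longrightarrow> rho (fst \<omega> i) \<in> Omega" and u0: "\<And>i. i < n \<Longrightarrow> 0 \<le> u i"
      and um: "\<And>i j. i < n \<Longrightarrow> j < n \<Longrightarrow> rho (fst \<omega> i) \<le> rho (fst \<omega> j) \<Longrightarrow>
        f (rho (fst \<omega> i)) = f (rho (fst \<omega> j)) \<Longrightarrow> u i \<le> u j"
    define W where "W p = chain_bound (assigned (fst p)) (fst p) (snd p) (J p) (\<lambda>i. sg * snd \<omega> i) (\<lambda>i. rho (fst \<omega> i))" for p
    have "2 * (\<Sum>i<n. sg * snd \<omega> i * u i) - (\<Sum>i<n. (u i)\<^sup>2)
      \<le> 2 * (\<Sum>i | i < n \<and> rho (fst \<omega> i) \<in> thin (Suc s). (sg * snd \<omega> i)\<^sup>2)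
      + (\<Sum>(a, c)\<in>active s. 2 * Q * ((W (a, c))\<^sup>2 / (1 + real (card {i. i < n \<and> cell a (rho (fst \<omega> i)) = upcell c}))))"
    proof (rule weighted_sum_bound[OF x u0])
      show "u i \<le> u j" if "i < n" "j < n" "rho (fst \<omega> i) \<le> rho (fst \<omega> j)" "f (rho (fst \<omega> i)) = f (rho (fst \<omega> j))" for i j
        using um that by blast
      show "(\<Sum>i | i < n \<and> rho (fst \<omega> i) \<in> assigned a \<and> cell a (rho (fst \<omega> i)) = c. sg * snd \<omega> i * u i) \<le> H * W (a, c)"
        if "(a, c) \<in> active s" "0 \<le> H" "\<And>i. i < n \<Longrightarrow> rho (fst \<omega> i) \<in> assigned a \<Longrightarrow> cell a (rho (fst \<omega> i)) = c \<Longrightarrow> u i \<le> H" for a c H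
        unfolding W_def fst_conv snd_conv
      proof (rule chain_bound_bounds_sum)
        show "u i \<le> u j" if ij: "i < n" "j < n" "rho (fst \<omega> i) \<in> assigned a" "rho (fst \<omega> j) \<in> assigned a"
          "cell a (rho (fst \<omega> i)) = c" "cell a (rho (fst \<omega> j)) = c" "rho (fst \<omega> i) \<le> rho (fst \<omega> j)" for i j
          using um[OF ij(1,2,7)] assigned_cell_const[OF ij(3,4)] ij by simp
      qed (use that u0 n1 in auto)
    qed (simp_all add: Q_def)
    also have "\<dots> \<le> GG \<omega>"
      unfolding GG_def
    proof (intro add_left_mono sum_mono)
      fix p assume p: "p \<in> active s"
      obtain a c where ac: "p = (a, c)" by (cases p)
      show "(case p of (a, c) \<Rightarrow> 2 * Q * ((W (a, c))\<^sup>2 / (1 + real (card {i. i < n \<and> cell a (rho (fst \<omega> i)) = upcell c})))) \<le> 2 * Q * G p \<omega>"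
        using JG(2)[OF p, of \<omega>] Q unfolding ac W_def J_def G_def fst_conv snd_conv prod.case
        by (intro mult_left_mono[where c = "2 * Q"]) simp_all
    qed
    finally show "2 * (\<Sum>i<n. sg * snd \<omega> i * u i) - (\<Sum>i<n. (u i)\<^sup>2) \<le> GG \<omega>" .
  next
    define R where "R = real n * r powr (- 2 / real ?d) * L ^ (?d + 5)"
    have fm: "emeasure lborel (thin m) = ennreal (measure lborel (thin m))" for m
      using thin_le_1[of m] by (intro emeasure_eq_ennreal_measure) (auto simp: top_unique)
    have m1: "measure lborel (thin m) \<le> 1" for m using thin_le_1[of m] by (simp add: fm)
    have "mean_le GG (2 * (real n * (8 * mass (thin (Suc s)))) + (\<Sum>p\<in>active s. 2 * Q * kap (size_of (fst p))))"
      unfolding GG_def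
      by (intro mean_le_add mean_le_cmult mean_rest mean_le_sum thin_measurable) (use JG(1) Q in \<open>auto simp: G_def\<close>)
    then show "mean_le GG (gap_const ?d M0 cell_const * (real n * r powr (- 2 / real ?d) * L ^ (?d + 5)))"
    proof (rule mean_le_mono)
      have rest: "2 * (real n * (8 * mass (thin (Suc s)))) \<le> 16 * M0 * vol_const ?d * R"
      proof -
        have "mass (thin (Suc s)) \<le> M0 * measure lborel (thin (Suc s))"
          by (rule mass_le) (auto simp: fm)
        also have "measure lborel (thin (Suc s)) \<le> vol_const ?d * (real k / 2 ^ Suc s) * L ^ ?d"
          by (rule thin_measure[OF k _ r L]) (use sr in simp)
        also have "\<dots> \<le> vol_const ?d * (real k / real n) * L ^ ?d"
          by (intro mult_right_mono mult_left_mono divide_left_mono vol_const_nonneg) (use sr L1 n1 in auto)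
        finally have "mass (thin (Suc s)) \<le> M0 * (vol_const ?d * (real k / real n) * L ^ ?d)"
          using m0 by (simp add: mult_left_mono)
        then have "2 * (real n * (8 * mass (thin (Suc s)))) \<le> 2 * (real n * (8 * (M0 * (vol_const ?d * (real k / real n) * L ^ ?d))))"
          by (intro mult_left_mono) auto
        also have "\<dots> = 16 * M0 * vol_const ?d * (real n * (1 / r) * L ^ ?d)" using n1 by (simp add: r)
        also have "\<dots> \<le> 16 * M0 * vol_const ?d * R"
          unfolding R_def
        proof (intro mult_left_mono mult_mono power_increasing L1)
          have "r powr (- 1) \<le> r powr (- 2 / real ?d)" by (rule powr_mono) (use d r1 in \<open>auto simp: field_simps\<close>)
          then show "1 / r \<le> r powr (- 2 / real ?d)" using r1 by (simp add: powr_minus_divide)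
        qed (use m0 vol_const_nonneg L1 r1 in auto)
        finally show ?thesis .
      qed
      define A where "A m = {p \<in> active s. size_of (fst p) = m}" for m
      \<comment> \<open>Division by \<open>Q\<close> removes the multiplicity of the shifted cells,
        so that \<open>2 ^ m\<close> and the volume bound apply directly.\<close>
      define N where "N m = real (card (A m)) / Q" for m
      have cA: "real (card (A m)) \<le> 2 ^ m * (Q * measure lborel (thin m))" for m
      proof -
        have "ennreal (real (card (A m)) * (1 / 2) ^ m) \<le> of_nat ((4 * ?d + 1) ^ ?d) * emeasure lborel (thin m)"
        proof -
          have "A m = {(a, c) \<in> active s. size_of a = m}" by (auto simp: A_def)
          then show ?thesis using card_act_level[of s m] by (simp only:)
        qed
        also have "\<dots> = ennreal ((Q - 1) * measure lborel (thin m))"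
          unfolding fm Q_def by (simp add: ennreal_mult ennreal_of_nat_eq_real_of_nat del: of_nat_power)
        finally have "real (card (A m)) * (1 / 2) ^ m \<le> (Q - 1) * measure lborel (thin m)"
          by (subst (asm) ennreal_le_iff) (use Q in auto)
        also have "\<dots> \<le> Q * measure lborel (thin m)" by (intro mult_right_mono) auto
        finally show ?thesis by (simp add: power_one_over field_simps)
      qed
      have N2: "N m \<le> vol_const ?d * real k * L ^ ?d" if m: "m \<le> s" for m
      proof -
        have "(2::real) ^ m \<le> 2 ^ s" by (rule power_increasing) (use m in auto)
        then have ms: "2 ^ m \<le> 2 * real n" using sr(1) by linarith
        have "N m \<le> 2 ^ m * measure lborel (thin m)" unfolding N_def using cA[of m] Q by (simp add: divide_le_eq ac_simps)
        also have "\<dots> \<le> 2 ^ m * (vol_const ?d * (real k / 2 ^ m) * L ^ ?d)"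
          by (intro mult_left_mono thin_measure[OF k ms r L]) auto
        finally show ?thesis by simp
      qed
      have N1: "N m \<le> 2 ^ m" for m
      proof -
        have "N m \<le> 2 ^ m * measure lborel (thin m)" unfolding N_def using cA[of m] Q by (simp add: divide_le_eq ac_simps)
        also have "\<dots> \<le> 2 ^ m * 1" by (intro mult_left_mono m1) auto
        finally show ?thesis by simp
      qed
      have "(\<Sum>p\<in>active s. 2 * Q * kap (size_of (fst p))) = (\<Sum>m\<le>s. \<Sum>p\<in>A m. 2 * Q * kap (size_of (fst p)))"
        unfolding A_def by (rule sum.group[symmetric]) (use finite_act in \<open>auto simp: active_def\<close>)
      also have "\<dots> = (\<Sum>m\<le>s. 2 * Q * (cell_const * 2 ^ ?d) * Q * (N m * (real (s - m + 3) ^ 4 * (real n / 2 ^ m) powr (1 - 2 / real ?d))))"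
        using Q by (intro sum.cong refl) (simp add: A_def kap_def N_def)
      also have "\<dots> = 2 * Q * (cell_const * 2 ^ ?d) * Q * (\<Sum>m\<le>s. N m * (real (s - m + 3) ^ 4 * (real n / 2 ^ m) powr (1 - 2 / real ?d)))"
        by (simp only: sum_distrib_left)
      also have "\<dots> \<le> 2 * Q * (cell_const * 2 ^ ?d) * Q * ((6250 * vol_const ?d + 1296 * geom_const ?d) * R)"
        unfolding R_def
        by (intro mult_left_mono sum_over_levels[OF d k(1,3) s vol_const_nonneg r L] N1 N2)
           (use Q cell_const_nonneg in \<open>auto simp: N_def\<close>)
      finally show "2 * (real n * (8 * mass (thin (Suc s)))) + (\<Sum>p\<in>active s. 2 * Q * kap (size_of (fst p)))
        \<le> gap_const ?d M0 cell_const * (real n * r powr (- 2 / real ?d) * L ^ (?d + 5))"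
        using rest unfolding gap_const_def R_def[symmetric] Let_def Q_def[symmetric] by (simp add: algebra_simps)
    qed
  qed
qed

end

section \<open>Reduction to the level boxes\<close>

lemma hyperrectangle_eq_cbox:
  fixes S :: "(real ^ 'd::finite) set"
  assumes S: "compact S" "hyperrectangle S"
  obtains a b where "S = cbox a b"
proof (cases "S = {}")
  case True
  have "cbox (1 :: real ^ 'd) 0 = {}" by (auto simp: mem_box_cart) (meson not_one_le_zero order_trans)
  then show ?thesis using True that by blast
next
  case False
  then obtain x0 where x0: "x0 \<in> S" by auto
  obtain I where I: "\<And>j. is_interval (I j)" "S = {x. \<forall>j. x $ j \<in> I j}"
    using S(2) by (auto simp: hyperrectangle_def)
  have "\<exists>a b. I j = cbox a b" for j
  proof -
    have "I j = (\<lambda>x. x $ j) ` S"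
    proof
      show "(\<lambda>x. x $ j) ` S \<subseteq> I j" using I(2) by auto
      show "I j \<subseteq> (\<lambda>x. x $ j) ` S"
      proof
        fix t assume "t \<in> I j"
        then have "(\<chi> i. if i = j then t else x0 $ i) \<in> S" using x0 I(2) by auto
        then show "t \<in> (\<lambda>x. x $ j) ` S" by (rule image_eqI[rotated]) simp
      qed
    qed
    then have "compact (I j)"
      by (simp add: compact_continuous_image continuous_on_component S(1))
    with I(1)[of j] show ?thesis using is_interval_compact by blast
  qed
  then obtain a b where ab: "\<And>j. I j = cbox (a j) (b j)" by metis
  have "S = cbox (\<chi> j. a j) (\<chi> j. b j)"
    unfolding I(2) ab by (auto simp: mem_box_cart)
  then show ?thesis by (rule that)
qed

lemma cbox_diff_box_null:
  fixes a b :: "real ^ 'd::finite"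
  shows "cbox a b - box a b \<in> null_sets lborel"
proof (cases "\<forall>i. a $ i \<le> b $ i")
  case True
  have "box a b \<subseteq> cbox a b" by (rule box_subset_cbox)
  then have "emeasure lborel (cbox a b - box a b) = emeasure lborel (cbox a b) - emeasure lborel (box a b)"
    using True by (intro emeasure_Diff) (auto simp: emeasure_lborel_box_cart)
  then show ?thesis using True by (auto simp: emeasure_lborel_box_cart)
next
  case False
  then have "cbox a b = {}" by (auto simp: mem_box_cart) (meson order_trans)
  then show ?thesis by simp
qed

text \<open>A piece may be merely dense in its rectangle, so that \<open>f\<close> could take other
  values inside. Monotonicity excludes this: each point of the interior has points of the piece
  below and above it, and \<open>f\<close> is squeezed between equal values.\<close>

lemma isotonic_pieces_boxes:
  fixes f :: "real ^ 'd::finite \<Rightarrow> real"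
  assumes f: "f \<in> isotonic_pieces k"
  obtains K al be col where "level_boxes K al be col f" "card K \<le> k"
proof -
  obtain R where R: "(\<Union>l\<in>{1..k}. R l) = (unit_cube :: (real ^ 'd) set)"
    "\<And>l. l \<in> {1..k} \<Longrightarrow> hyperrectangle (closure (R l))" "\<And>l. l \<in> {1..k} \<Longrightarrow> f constant_on R l"
    and iso: "mono_on unit_cube f"
    using f unfolding isotonic_pieces_def isotonic_def by auto
  have Rc: "closure (R l) \<subseteq> unit_cube" if "l \<in> {1..k}" for l
    using R(1) that by (intro closure_minimal) auto
  have "\<exists>a b. closure (R l) = cbox a b" if "l \<in> {1..k}" for l
  proof -
    have "compact (closure (R l))"
      using Rc[OF that] by (meson bounded_cbox bounded_subset closed_closure compact_eq_bounded_closed)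
    then show ?thesis using R(2)[OF that] hyperrectangle_eq_cbox by blast
  qed
  then obtain al be where ab: "\<And>l. l \<in> {1..k} \<Longrightarrow> closure (R l) = cbox (al l) (be l)" by metis
  have "\<exists>v. \<forall>x\<in>box (al l) (be l). f x = v" if l: "l \<in> {1..k}" for l
  proof -
    obtain v where v: "\<And>r. r \<in> R l \<Longrightarrow> f r = v" using R(3)[OF l] by (auto simp: constant_on_def)
    have "f x = v" if x: "x \<in> box (al l) (be l)" for x
    proof -
      have xc: "x \<in> unit_cube" using x ab[OF l] Rc[OF l] box_subset_cbox by blast
      have meets: "\<exists>r\<in>R l. r \<in> box p q" if "box p q \<noteq> {}" "box p q \<subseteq> cbox (al l) (be l)" for p q
        using that open_Int_closure_eq_empty[of "box p q" "R l"] ab[OF l] by auto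
      have lt: "al l $ i < x $ i \<and> x $ i < be l $ i" for i using x by (simp add: mem_box_cart)
      have "(\<chi> i. (al l $ i + x $ i) / 2) \<in> box (al l) x" "(\<chi> i. (x $ i + be l $ i) / 2) \<in> box x (be l)"
        using lt by (simp_all add: mem_box_cart)
      then have ne: "box (al l) x \<noteq> {}" "box x (be l) \<noteq> {}" by blast+
      have sub: "box (al l) x \<subseteq> cbox (al l) (be l)" "box x (be l) \<subseteq> cbox (al l) (be l)"
      proof -
        have "al l $ i \<le> y $ i \<and> y $ i \<le> be l $ i" if "y \<in> box (al l) x" for y i
          using lt[of i] that[unfolded mem_box_cart, rule_format, of i] by linarith
        then show "box (al l) x \<subseteq> cbox (al l) (be l)" by (auto simp: mem_box_cart(2))
        have "al l $ i \<le> y $ i \<and> y $ i \<le> be l $ i" if "y \<in> box x (be l)" for y i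
          using lt[of i] that[unfolded mem_box_cart, rule_format, of i] by linarith
        then show "box x (be l) \<subseteq> cbox (al l) (be l)" by (auto simp: mem_box_cart(2))
      qed
      obtain r where r: "r \<in> R l" "r \<in> box (al l) x" using meets[OF ne(1) sub(1)] by blast
      obtain r' where r': "r' \<in> R l" "r' \<in> box x (be l)" using meets[OF ne(2) sub(2)] by blast
      have rc: "r \<in> unit_cube" "r' \<in> unit_cube" using r r' R(1) l by blast+
      have "f r \<le> f x" using r by (intro mono_onD[OF iso rc(1) xc]) (simp add: mem_box_cart less_eq_vec_def less_imp_le)
      moreover have "f x \<le> f r'" using r' by (intro mono_onD[OF iso xc rc(2)]) (simp add: mem_box_cart less_eq_vec_def less_imp_le)
      ultimately show ?thesis using v r r' by simp
    qed
    then show ?thesis by blast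
  qed
  then obtain col where col: "\<And>l x. l \<in> {1..k} \<Longrightarrow> x \<in> box (al l) (be l) \<Longrightarrow> f x = col l" by metis
  \<comment> \<open>Pieces whose closure has empty interior are dropped; they cover only a null
    set.\<close>
  define K where "K = {l \<in> {1..k}. \<forall>i. al l $ i < be l $ i}"
  have bnd: "0 \<le> al l $ i \<and> be l $ i \<le> 1" if "l \<in> K" for l i
  proof -
    have "al l \<in> cbox (al l) (be l)" "be l \<in> cbox (al l) (be l)" using that by (auto simp: K_def mem_box_cart less_imp_le)
    then have "al l \<in> unit_cube" "be l \<in> unit_cube" using ab Rc that by (auto simp: K_def)
    then show ?thesis by (simp add: mem_box_cart)
  qed
  have "level_boxes K al be col f"
  proof
    show "unit_cube - (\<Union>l\<in>K. box (al l) (be l)) \<in> null_sets lborel"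
    proof (rule null_sets_subset)
      show "(\<Union>l\<in>{1..k}. cbox (al l) (be l) - box (al l) (be l)) \<in> null_sets lborel"
        by (intro null_sets_UN' cbox_diff_box_null) auto
      show "unit_cube - (\<Union>l\<in>K. box (al l) (be l)) \<in> sets lborel"
        by (auto simp: K_def intro!: sets.Diff sets.finite_UN)
      show "unit_cube - (\<Union>l\<in>K. box (al l) (be l)) \<subseteq> (\<Union>l\<in>{1..k}. cbox (al l) (be l) - box (al l) (be l))"
      proof
        fix x assume x: "x \<in> unit_cube - (\<Union>l\<in>K. box (al l) (be l))"
        then obtain l where l: "l \<in> {1..k}" "x \<in> R l" using R(1) by blast
        have "x \<in> cbox (al l) (be l)" using l closure_subset ab by blast
        moreover have "x \<notin> box (al l) (be l)"
        proof
          assume b: "x \<in> box (al l) (be l)"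
          then have "l \<in> K" using l by (auto simp: K_def mem_box_cart intro: less_trans)
          then show False using x b by blast
        qed
        ultimately show "x \<in> (\<Union>l\<in>{1..k}. cbox (al l) (be l) - box (al l) (be l))" using l by blast
      qed
    qed
  qed (use iso col bnd in \<open>auto simp: K_def\<close>)
  moreover have "card K \<le> card {1..k}" by (intro card_mono) (auto simp: K_def)
  then have "card K \<le> k" by simp
  ultimately show ?thesis by (rule that)
qed

section \<open>Reflection of the cube\<close>

lemma emeasure_lborel_reflect:
  fixes Q :: "(real ^ 'd::finite) set"
  assumes "Q \<in> sets borel"
  shows "emeasure lborel {x. 1 - x \<in> Q} = emeasure lborel Q"
proof -
  have "(lborel :: (real ^ 'd) measure) = density (distr lborel borel (\<lambda>x. 1 + (- 1) *\<^sub>R x)) (\<lambda>_. ennreal (\<bar>- 1\<bar> ^ DIM(real ^ 'd)))"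
    by (rule lborel_affine) simp
  then have "(lborel :: (real ^ 'd) measure) = distr lborel borel (\<lambda>x. 1 - x)"
    by (simp add: density_1)
  then have "emeasure lborel Q = emeasure (distr lborel borel (\<lambda>x. 1 - x)) Q" by simp
  also have "\<dots> = emeasure lborel ((\<lambda>x. 1 - x) -` Q \<inter> space lborel)"
    by (rule emeasure_distr) (use assms in auto)
  finally show ?thesis by (simp add: vimage_def)
qed

text \<open>The reflection reverses the order and the sign restores monotonicity. Boxes above a
  reflected point correspond to boxes below the original one, where the negative part of an isotone
  difference is at least as large.\<close>

lemma level_boxes_reflect:
  fixes f :: "real ^ 'd::finite \<Rightarrow> real"
  assumes "level_boxes K al be col f"
  shows "level_boxes K (\<lambda>l. 1 - be l) (\<lambda>l. 1 - al l) (\<lambda>l. - col l) (\<lambda>x. - f (1 - x))"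
proof -
  interpret level_boxes K al be col f by fact
  have box: "x \<in> box (1 - be l) (1 - al l) \<longleftrightarrow> 1 - x \<in> box (al l) (be l)" for x l
    by (auto simp: mem_box_cart algebra_simps less_diff_eq diff_less_eq)
      (metis add.commute less_diff_eq, metis add.commute diff_less_eq)?
  have cube: "1 - x \<in> unit_cube \<longleftrightarrow> x \<in> unit_cube" for x :: "real ^ 'd"
    by (auto simp: mem_box_cart)
  show ?thesis
  proof
    show "mono_on unit_cube (\<lambda>x. - f (1 - x))"
    proof (rule mono_onI)
      fix x y :: "real ^ 'd" assume xy: "x \<in> unit_cube" "y \<in> unit_cube" "x \<le> y"
      have "f (1 - y) \<le> f (1 - x)"
        using xy cube by (intro mono_onD[OF f_mono]) (auto simp: less_eq_vec_def)
      then show "- f (1 - x) \<le> - f (1 - y)" by simp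
    qed
    show "unit_cube - (\<Union>l\<in>K. box (1 - be l) (1 - al l)) \<in> null_sets lborel"
    proof -
      let ?N = "unit_cube - (\<Union>l\<in>K. box (al l) (be l))"
      have N: "?N \<in> sets borel" "emeasure lborel ?N = 0" using null by auto
      have eq: "unit_cube - (\<Union>l\<in>K. box (1 - be l) (1 - al l)) = {x. 1 - x \<in> ?N}"
        using cube box by auto
      have "(\<lambda>x :: real ^ 'd. 1 - x) -` ?N \<inter> space borel \<in> sets borel"
        by (rule measurable_sets[OF _ N(1)]) simp
      then have "{x. 1 - x \<in> ?N} \<in> sets borel" by (simp add: vimage_def)
      then show ?thesis unfolding eq using emeasure_lborel_reflect[OF N(1)] N(2) by auto
    qed
  qed (use finite_K al_less_be al_ge_0 be_le_1 f_col box in auto)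
qed

section \<open>Comparison of the design distribution with Lebesgue measure\<close>

context
  fixes P :: "(real ^ 'd::finite) measure" and p0 :: "real ^ 'd \<Rightarrow> real" and m0 M0 :: real
  assumes P: "cube_density P p0" and bounds: "\<forall>x\<in>unit_cube. m0 \<le> p0 x \<and> p0 x \<le> M0"
    and m0: "0 < m0"
begin

lemma P_space: "space P = unit_cube" and P_sets: "sets P = sets (restrict_space borel unit_cube)"
  using P by (auto simp: cube_density_def space_restrict_space sets_restrict_space)

lemma emeasure_P:
  assumes A: "A \<in> sets borel" "A \<subseteq> unit_cube"
  shows "emeasure P A = (\<integral>\<^sup>+x. ennreal (p0 x) * indicator A x \<partial>lborel)"
proof -
  have As: "A \<in> sets (restrict_space lborel unit_cube)"
    using A by (auto simp: sets_restrict_space image_iff intro!: bexI[of _ A])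
  have pm: "(\<lambda>x. ennreal (p0 x)) \<in> borel_measurable (restrict_space lborel unit_cube)"
    using P by (auto simp: cube_density_def)
  have "emeasure P A = (\<integral>\<^sup>+x. ennreal (p0 x) * indicator A x \<partial>restrict_space lborel unit_cube)"
    using P emeasure_density[OF pm As] by (simp add: cube_density_def)
  also have "\<dots> = (\<integral>\<^sup>+x. ennreal (p0 x) * indicator A x * indicator unit_cube x \<partial>lborel)"
    by (rule nn_integral_restrict_space) simp
  also have "\<dots> = (\<integral>\<^sup>+x. ennreal (p0 x) * indicator A x \<partial>lborel)"
    using A by (intro nn_integral_cong) (auto simp: indicator_def)
  finally show ?thesis .
qed

lemma emeasure_P_le:
  assumes A: "A \<in> sets borel" "A \<subseteq> unit_cube"
  shows "emeasure P A \<le> ennreal M0 * emeasure lborel A"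
proof -
  have "emeasure P A \<le> (\<integral>\<^sup>+x. ennreal M0 * indicator A x \<partial>lborel)"
    unfolding emeasure_P[OF A] by (intro nn_integral_mono) (use A bounds in \<open>auto simp: indicator_def intro!: ennreal_leI\<close>)
  then show ?thesis using A by (simp add: nn_integral_cmult_indicator)
qed

lemma emeasure_P_ge:
  assumes A: "A \<in> sets borel" "A \<subseteq> unit_cube"
  shows "ennreal m0 * emeasure lborel A \<le> emeasure P A"
proof -
  have "(\<integral>\<^sup>+x. ennreal m0 * indicator A x \<partial>lborel) \<le> emeasure P A"
    unfolding emeasure_P[OF A] by (intro nn_integral_mono) (use A bounds in \<open>auto simp: indicator_def intro!: ennreal_leI\<close>)
  then show ?thesis using A by (simp add: nn_integral_cmult_indicator)
qed

lemma m0_le_M0: "m0 \<le> M0"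
proof -
  have "(0 :: real ^ 'd) \<in> unit_cube" by (simp add: mem_box_cart)
  then show ?thesis using bounds by force
qed

lemma mapped_design_id: "mapped_design P (\<lambda>x. x) 1 m0 M0"
proof (intro mapped_design.intro design.intro mapped_design_axioms.intro)
  show "prob_space P" using P unfolding cube_density_def by blast
  have "(\<lambda>x. x) \<in> measurable (restrict_space borel unit_cube) borel"
    by (intro measurable_restrict_space1) simp
  then show "(\<lambda>x. x) \<in> measurable P borel"
    using measurable_cong_sets[OF P_sets refl] by blast
  have e: "{x \<in> space P. x \<in> Q} = Q \<inter> unit_cube" for Q by (auto simp: P_space)
  show "emeasure P {x \<in> space P. x \<in> Q} \<le> ennreal M0 * emeasure lborel Q" if Q: "Q \<in> sets borel" for Q
  proof -
    have "emeasure P (Q \<inter> unit_cube) \<le> ennreal M0 * emeasure lborel (Q \<inter> unit_cube)"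
      by (rule emeasure_P_le) (use Q in auto)
    also have "\<dots> \<le> ennreal M0 * emeasure lborel Q" by (intro mult_left_mono emeasure_mono) (use Q in auto)
    finally show ?thesis unfolding e .
  qed
  show "ennreal m0 * emeasure lborel Q \<le> emeasure P {x \<in> space P. x \<in> Q}" if "Q \<in> sets borel" "Q \<subseteq> unit_cube" for Q
    using emeasure_P_ge[OF that] that(2) unfolding e by (simp add: Int_absorb2)
qed (use m0 m0_le_M0 in auto)

lemma mapped_design_reflect: "mapped_design P (\<lambda>x. 1 - x) (- 1) m0 M0"
proof (intro mapped_design.intro design.intro mapped_design_axioms.intro)
  show "prob_space P" using P unfolding cube_density_def by blast
  have "(\<lambda>x :: real ^ 'd. 1 - x) \<in> measurable (restrict_space borel unit_cube) borel"
    by (intro measurable_restrict_space1) simp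
  then show "(\<lambda>x. 1 - x) \<in> measurable P borel"
    using measurable_cong_sets[OF P_sets refl] by blast
  have cube: "1 - x \<in> unit_cube \<longleftrightarrow> x \<in> unit_cube" for x :: "real ^ 'd"
    by (auto simp: mem_box_cart)
  have meas: "{x. 1 - x \<in> Q} \<in> sets borel" if Q: "Q \<in> sets borel" for Q :: "(real ^ 'd) set"
  proof -
    have "(\<lambda>x :: real ^ 'd. 1 - x) -` Q \<inter> space borel \<in> sets borel"
      by (rule measurable_sets[OF _ Q]) simp
    then show ?thesis by (simp add: vimage_def)
  qed
  have e: "{x \<in> space P. 1 - x \<in> Q} = {x. 1 - x \<in> Q} \<inter> unit_cube" for Q by (auto simp: P_space)
  show "emeasure P {x \<in> space P. 1 - x \<in> Q} \<le> ennreal M0 * emeasure lborel Q" if Q: "Q \<in> sets borel" for Q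
  proof -
    have "emeasure P ({x. 1 - x \<in> Q} \<inter> unit_cube) \<le> ennreal M0 * emeasure lborel ({x. 1 - x \<in> Q} \<inter> unit_cube)"
      by (rule emeasure_P_le) (use meas[OF Q] in auto)
    also have "\<dots> \<le> ennreal M0 * emeasure lborel {x. 1 - x \<in> Q}" by (intro mult_left_mono emeasure_mono) (use meas[OF Q] in auto)
    finally show ?thesis unfolding e emeasure_lborel_reflect[OF Q] .
  qed
  show "ennreal m0 * emeasure lborel Q \<le> emeasure P {x \<in> space P. 1 - x \<in> Q}" if Q: "Q \<in> sets borel" "Q \<subseteq> unit_cube" for Q
  proof -
    have s: "{x. 1 - x \<in> Q} \<subseteq> unit_cube" using Q(2) cube by blast
    show ?thesis
      using emeasure_P_ge[OF meas[OF Q(1)] s] s unfolding e emeasure_lborel_reflect[OF Q(1)] by (simp add: Int_absorb2)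
  qed
qed (use m0 m0_le_M0 in auto)

end

text \<open>Minimality at \<open>f\<close> alone gives the bound without the last, quadratic sum.
  Comparison along the segment from the minimiser to \<open>f\<close> gives the variational
  inequality \<open>B \<le> 0\<close>, which supplies this sum while the loss of \<open>f\<close>
  keeps the factor 1.\<close>

lemma least_squares_basic_inequality:
  fixes x :: "nat \<Rightarrow> real ^ 'd::finite"
  assumes lse: "least_squares_estimator n fhat" and x: "\<And>i. i < n \<Longrightarrow> x i \<in> unit_cube"
    and f: "f \<in> isotonic" and y: "y = (\<lambda>i. f0 (x i) + e i)"
  shows "fhat x y \<in> isotonic"
    and "(\<Sum>i<n. (fhat x y (x i) - f0 (x i))\<^sup>2) \<le> (\<Sum>i<n. (f (x i) - f0 (x i))\<^sup>2)
      + (2 * (\<Sum>i<n. e i * (fhat x y (x i) - f (x i))) - (\<Sum>i<n. (fhat x y (x i) - f (x i))\<^sup>2))"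
proof -
  define g where "g = fhat x y"
  have am: "is_arg_min (\<lambda>f. \<Sum>i<n. (y i - f (x i))\<^sup>2) (\<lambda>f. f \<in> isotonic) g"
    using lse x by (auto simp: least_squares_estimator_def g_def)
  then have g: "g \<in> isotonic" and gmin: "\<And>h. h \<in> isotonic \<Longrightarrow> (\<Sum>i<n. (y i - g (x i))\<^sup>2) \<le> (\<Sum>i<n. (y i - h (x i))\<^sup>2)"
    by (auto simp: is_arg_min_def not_less)
  define B where "B = (\<Sum>i<n. (y i - g (x i)) * (f (x i) - g (x i)))"
  define C where "C = (\<Sum>i<n. (f (x i) - g (x i))\<^sup>2)"
  have C0: "0 \<le> C" unfolding C_def by (rule sum_nonneg) simp
  have uB: "2 * B \<le> u * C" if u: "0 < u" "u \<le> 1" for u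
  proof -
    have "(\<lambda>z. (1 - u) * g z + u * f z) \<in> isotonic"
      using f g u unfolding isotonic_def by (auto simp: mono_on_def intro!: add_mono mult_left_mono)
    then have "(\<Sum>i<n. (y i - g (x i))\<^sup>2) \<le> (\<Sum>i<n. (y i - ((1 - u) * g (x i) + u * f (x i)))\<^sup>2)" by (rule gmin)
    also have "\<dots> = (\<Sum>i<n. (y i - g (x i))\<^sup>2 - 2 * u * ((y i - g (x i)) * (f (x i) - g (x i))) + u\<^sup>2 * (f (x i) - g (x i))\<^sup>2)"
      by (intro sum.cong refl) (simp add: power2_eq_square algebra_simps)
    also have "\<dots> = (\<Sum>i<n. (y i - g (x i))\<^sup>2) - 2 * u * B + u\<^sup>2 * C"
      by (simp add: sum.distrib sum_subtractf sum_distrib_left B_def C_def)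
    finally have "u * (2 * B) \<le> u * (u * C)" by (simp add: power2_eq_square)
    then show ?thesis using u by simp
  qed
  have B: "B \<le> 0"
  proof (rule ccontr)
    assume "\<not> B \<le> 0"
    then have Bp: "0 < B" by simp
    \<comment> \<open>A step along the segment that is so short that the quadratic term cannot
      compensate a positive \<open>B\<close>.\<close>
    define u where "u = min 1 (B / (C + 1))"
    have "0 < u" "u \<le> 1" using Bp C0 by (auto simp: u_def)
    then have "2 * B \<le> u * C" by (rule uB)
    also have "\<dots> \<le> B / (C + 1) * C" by (rule mult_right_mono) (auto simp: u_def C0)
    also have "\<dots> \<le> B" using Bp C0 by (simp add: field_simps)
    finally show False using Bp by simp
  qed
  show "fhat x y \<in> isotonic" using g by (simp add: g_def)
  have "(\<Sum>i<n. (g (x i) - f0 (x i))\<^sup>2)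
    = (\<Sum>i<n. (f (x i) - f0 (x i))\<^sup>2 + 2 * (e i * (g (x i) - f (x i))) - (g (x i) - f (x i))\<^sup>2
        + 2 * ((y i - g (x i)) * (f (x i) - g (x i))))"
    by (intro sum.cong refl) (simp add: y power2_eq_square algebra_simps)
  also have "\<dots> = (\<Sum>i<n. (f (x i) - f0 (x i))\<^sup>2) + 2 * (\<Sum>i<n. e i * (g (x i) - f (x i)))
      - (\<Sum>i<n. (g (x i) - f (x i))\<^sup>2) + 2 * B"
    by (simp add: sum.distrib sum_subtractf sum_distrib_left B_def)
  finally show "(\<Sum>i<n. (fhat x y (x i) - f0 (x i))\<^sup>2) \<le> (\<Sum>i<n. (f (x i) - f0 (x i))\<^sup>2)
      + (2 * (\<Sum>i<n. e i * (fhat x y (x i) - f (x i))) - (\<Sum>i<n. (fhat x y (x i) - f (x i))\<^sup>2))"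
    using B by (simp add: g_def)
qed

section \<open>From the sample to the risk\<close>

lemma (in design) sample_in_space:
  assumes "\<omega> \<in> space law" "i < n"
  shows "fst \<omega> i \<in> space P"
proof -
  have "fst \<omega> \<in> space (\<Pi>\<^sub>M i\<in>{..<n}. P)"
    using assms(1) unfolding sample_law_def space_pair_measure by (simp add: mem_Times_iff)
  then show ?thesis using assms(2) by (simp add: space_PiM PiE_iff)
qed

text \<open>Stated for values in \<open>ennreal\<close>, because the approximation error may have an
  infinite integral.\<close>

lemma (in design) nn_integral_sample_single:
  fixes g :: "real ^ 'd \<Rightarrow> ennreal"
  assumes i: "i < n" and g: "g \<in> borel_measurable P"
  shows "(\<lambda>\<omega>. g (fst \<omega> i)) \<in> borel_measurable law"
    and "(\<integral>\<^sup>+\<omega>. g (fst \<omega> i) \<partial>law) = (\<integral>\<^sup>+x. g x \<partial>P)"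
proof -
  define h where "h j p = (if j = i then g (fst p) else 1)" for j and p :: "(real ^ 'd) \<times> real"
  have h: "h j \<in> borel_measurable (P \<Otimes>\<^sub>M std_normal)" for j
    unfolding h_def using measurable_compose[OF measurable_fst g] by (cases "j = i") auto
  have e: "(\<Prod>j<n. h j (fst \<omega> j, snd \<omega> j)) = g (fst \<omega> i)" for \<omega> :: "(nat \<Rightarrow> real ^ 'd) \<times> (nat \<Rightarrow> real)"
    using i by (simp add: h_def prod.delta)
  show "(\<lambda>\<omega>. g (fst \<omega> i)) \<in> borel_measurable law"
    using nn_integral_sample_prod(1)[of h] h unfolding e by blast
  have "(\<integral>\<^sup>+\<omega>. g (fst \<omega> i) \<partial>law) = (\<Prod>j<n. \<integral>\<^sup>+x. \<integral>\<^sup>+t. h j (x, t) \<partial>std_normal \<partial>P)"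
    using nn_integral_sample_prod(2)[of h] h unfolding e by blast
  also have "\<dots> = (\<Prod>j<n. if j = i then (\<integral>\<^sup>+x. g x \<partial>P) else 1)"
    using P.emeasure_space_1 N.emeasure_space_1 by (intro prod.cong refl) (auto simp: h_def)
  also have "\<dots> = (\<integral>\<^sup>+x. g x \<partial>P)" using i by (simp add: prod.delta)
  finally show "(\<integral>\<^sup>+\<omega>. g (fst \<omega> i) \<partial>law) = (\<integral>\<^sup>+x. g x \<partial>P)" .
qed

text \<open>The factor 2 covers the positive and the negative part of the difference; the 8 covers
  \<open>k > n\<close>, where the second moment of the noise is enough.\<close>

definition risk_const :: "nat \<Rightarrow> real \<Rightarrow> real \<Rightarrow> real" where
  "risk_const d m0 M0 = 2 * gap_const d M0 (cell_bound d m0 M0) + 8"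

lemma gap_const_nonneg:
  assumes "0 < d" "0 < m0" "m0 \<le> M0"
  shows "0 \<le> gap_const d M0 (cell_bound d m0 M0)"
  unfolding gap_const_def Let_def cell_bound_def using assms geom_const_nonneg[OF assms(1)] vol_const_nonneg[of d]
  by (intro add_nonneg_nonneg mult_nonneg_nonneg divide_nonneg_nonneg) auto

text \<open>For \<open>d = 2\<close> this compares 7 with 9, and for larger \<open>d\<close> it
  amounts to \<open>d * d \<ge> 4\<close>.\<close>

lemma power_le_rate:
  assumes d: "2 \<le> d" and L: "1 \<le> L"
  shows "L ^ (d + 5) \<le> L powr (2 * gamma_exponent d)"
proof -
  have "real (d + 5) \<le> 2 * gamma_exponent d"
  proof (cases "d = 2")
    case True
    then show ?thesis by (simp add: gamma_exponent_def)
  next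
    case False
    have "2 * 2 \<le> real d * real d" using d by (intro mult_mono) auto
    then show ?thesis using False d by (simp add: gamma_exponent_def power2_eq_square)
  qed
  then have "L powr real (d + 5) \<le> L powr (2 * gamma_exponent d)" using L by (intro powr_mono) auto
  then show ?thesis using L by (simp only: powr_realpow[of L "d + 5"] order.strict_trans2[OF zero_less_one L])
qed

text \<open>Besides the majorant a Borel version \<open>ft\<close> of \<open>f\<close> is provided,
  since \<open>f\<close> need not be Borel measurable while its squared distance to
  \<open>f0\<close> has to be integrated over the sample.\<close>

lemma isotonic_pieces_gap:
  fixes P :: "(real ^ 'd::finite) measure" and n k :: nat
  assumes d: "2 \<le> CARD('d)" and P: "cube_density P p0" and bounds: "\<forall>x\<in>unit_cube. m0 \<le> p0 x \<and> p0 x \<le> M0"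
    and m0: "0 < m0" and k: "1 \<le> k" and n: "1 \<le> n" and f: "f \<in> isotonic_pieces k"
  obtains G Om ft where
    "design.mean_le P n G (risk_const CARD('d) m0 M0 * (real n * (real k / real n) powr (2 / real CARD('d))
       * log_plus (real n / real k) powr (2 * gamma_exponent CARD('d))))"
    "Om \<in> sets borel" "unit_cube - Om \<in> null_sets lborel"
    "ft \<in> borel_measurable borel" "\<And>x. x \<in> Om \<Longrightarrow> ft x = f x"
    "\<And>x e g. (\<And>i. i < n \<Longrightarrow> x i \<in> Om) \<Longrightarrow> g \<in> isotonic \<Longrightarrow>
      2 * (\<Sum>i<n. e i * (g (x i) - f (x i))) - (\<Sum>i<n. (g (x i) - f (x i))\<^sup>2) \<le> G (x, e)"
proof -
  let ?d = "CARD('d)"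
  define r where "r = real n / real k"
  define L where "L = log_plus r"
  have L1: "1 \<le> L" by (simp add: L_def log_plus_ge_1)
  have M0: "m0 \<le> M0" by (rule m0_le_M0[OF P bounds m0])
  define gc where "gc = gap_const ?d M0 (cell_bound ?d m0 M0)"
  have gc: "0 \<le> gc" unfolding gc_def by (rule gap_const_nonneg) (use d m0 M0 in auto)
  define rate where "rate = real n * (real k / real n) powr (2 / real ?d) * L powr (2 * gamma_exponent ?d)"
  obtain K al be col where lb: "level_boxes K al be col f" and cK: "card K \<le> k"
    using isotonic_pieces_boxes[OF f] by blast
  interpret B: level_boxes K al be col f by (rule lb)
  interpret B': level_boxes K "\<lambda>l. 1 - be l" "\<lambda>l. 1 - al l" "\<lambda>l. - col l" "\<lambda>x. - f (1 - x)"
    by (rule level_boxes_reflect[OF lb])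
  interpret D: mapped_design P n "\<lambda>x. x" 1 m0 M0 by (rule mapped_design_id[OF P bounds m0])
  interpret D': mapped_design P n "\<lambda>x. 1 - x" "- 1" m0 M0 by (rule mapped_design_reflect[OF P bounds m0])
  interpret LD: level_design K al be col f P n "\<lambda>x. x" 1 m0 M0 ..
  interpret LD': level_design K "\<lambda>l. 1 - be l" "\<lambda>l. 1 - al l" "\<lambda>l. - col l" "\<lambda>x. - f (1 - x)" P n "\<lambda>x. 1 - x" "- 1" m0 M0 ..
  define ft where "ft x = (if x \<in> B.Omega then f x else 0)" for x
  have ftm: "ft \<in> borel_measurable borel"
  proof (rule measurableI)
    fix A :: "real set"
    have "ft -` A \<inter> space borel = (\<Union>l\<in>{l \<in> K. col l \<in> A}. box (al l) (be l)) \<union> (if 0 \<in> A then - B.Omega else {})"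
      using B.f_col by (auto simp: ft_def B.Omega_def split: if_splits) blast
    also have "\<dots> \<in> sets borel"
      using B.finite_K B.Omega_measurable by (intro sets.Un sets.finite_UN) (auto simp: Compl_eq_Diff_UNIV)
    finally show "ft -` A \<inter> space borel \<in> sets borel" .
  qed simp
  have null: "unit_cube - B.Omega \<in> null_sets lborel" using B.null by (simp add: B.Omega_def)
  have "\<exists>G. D.mean_le G (risk_const ?d m0 M0 * rate) \<and> (\<forall>x e g. (\<forall>i<n. x i \<in> B.Omega) \<longrightarrow> g \<in> isotonic \<longrightarrow>
      2 * (\<Sum>i<n. e i * (g (x i) - f (x i))) - (\<Sum>i<n. (g (x i) - f (x i))\<^sup>2) \<le> G (x, e))"
  proof (cases "k \<le> n")
    case True
    have cc: "D.cell_const = cell_bound ?d m0 M0" "D'.cell_const = cell_bound ?d m0 M0"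
      by (rule D.cell_const_def, rule D'.cell_const_def)
    define v where "v = gc * (real n * r powr (- 2 / real ?d) * L ^ (?d + 5))"
    obtain G where G: "D.mean_le G v"
      "\<And>\<omega> u. (\<And>i. i < n \<Longrightarrow> fst \<omega> i \<in> B.Omega) \<Longrightarrow> (\<And>i. i < n \<Longrightarrow> 0 \<le> u i) \<Longrightarrow>
      (\<And>i j. i < n \<Longrightarrow> j < n \<Longrightarrow> fst \<omega> i \<le> fst \<omega> j \<Longrightarrow> f (fst \<omega> i) = f (fst \<omega> j) \<Longrightarrow> u i \<le> u j) \<Longrightarrow>
      2 * (\<Sum>i<n. 1 * snd \<omega> i * u i) - (\<Sum>i<n. (u i)\<^sup>2) \<le> G \<omega>"
      using LD.mean_gap[OF d k cK True r_def L_def] unfolding cc gc_def[symmetric] v_def by blast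
    obtain G' where G': "D.mean_le G' v"
      "\<And>\<omega> u. (\<And>i. i < n \<Longrightarrow> 1 - fst \<omega> i \<in> B'.Omega) \<Longrightarrow> (\<And>i. i < n \<Longrightarrow> 0 \<le> u i) \<Longrightarrow>
      (\<And>i j. i < n \<Longrightarrow> j < n \<Longrightarrow> 1 - fst \<omega> i \<le> 1 - fst \<omega> j \<Longrightarrow> - f (1 - (1 - fst \<omega> i)) = - f (1 - (1 - fst \<omega> j)) \<Longrightarrow> u i \<le> u j) \<Longrightarrow>
      2 * (\<Sum>i<n. - 1 * snd \<omega> i * u i) - (\<Sum>i<n. (u i)\<^sup>2) \<le> G' \<omega>"
      using LD'.mean_gap[OF d k cK True r_def L_def] unfolding cc gc_def[symmetric] v_def by blast
    have "D.mean_le (\<lambda>\<omega>. G \<omega> + G' \<omega>) (v + v)" by (rule D.mean_le_add[OF G(1) G'(1)])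
    then have "D.mean_le (\<lambda>\<omega>. G \<omega> + G' \<omega>) (risk_const ?d m0 M0 * rate)"
    proof (rule D.mean_le_mono)
      have "r powr (- 2 / real ?d) = (real k / real n) powr (2 / real ?d)"
      proof -
        have "inverse r powr (2 / real ?d) = inverse (r powr (2 / real ?d))"
          by (rule inverse_powr)
        moreover have "inverse r = real k / real n" by (simp add: r_def)
        ultimately show ?thesis by (simp add: powr_minus)
      qed
      moreover have "real n * (real k / real n) powr (2 / real ?d) * L ^ (?d + 5) \<le> rate"
        unfolding rate_def by (intro mult_left_mono power_le_rate d L1) auto
      ultimately have "v \<le> gc * rate" unfolding v_def by (simp add: gc mult_left_mono)
      moreover have "0 \<le> rate" by (simp add: rate_def)
      ultimately show "v + v \<le> risk_const ?d m0 M0 * rate"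
        by (simp add: risk_const_def gc_def[symmetric] distrib_right)
    qed
    moreover have "2 * (\<Sum>i<n. e i * (g (x i) - f (x i))) - (\<Sum>i<n. (g (x i) - f (x i))\<^sup>2) \<le> G (x, e) + G' (x, e)"
      if x: "\<forall>i<n. x i \<in> B.Omega" and g: "g \<in> isotonic" for x e g
    proof -
      have gm: "g y \<le> g z" if "y \<in> B.Omega" "z \<in> B.Omega" "y \<le> z" for y z
        using g B.Omega_subset that by (auto simp: isotonic_def dest: mono_onD)
      \<comment> \<open>At every point at most one of \<open>u\<close> and \<open>u'\<close> is
        nonzero, so the linear and the quadratic part of the gap both split exactly.\<close>
      define u where "u i = max 0 (g (x i) - f (x i))" for i
      define u' where "u' i = max 0 (f (x i) - g (x i))" for i
      have "2 * (\<Sum>i<n. 1 * snd (x, e) i * u i) - (\<Sum>i<n. (u i)\<^sup>2) \<le> G (x, e)"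
      proof (rule G(2))
        fix i j assume ij: "i < n" "j < n" "fst (x, e) i \<le> fst (x, e) j" "f (fst (x, e) i) = f (fst (x, e) j)"
        then have "g (x i) \<le> g (x j)" using gm x by auto
        then show "u i \<le> u j" using ij by (auto simp: u_def)
      qed (use x in \<open>auto simp: u_def\<close>)
      moreover have "2 * (\<Sum>i<n. - 1 * snd (x, e) i * u' i) - (\<Sum>i<n. (u' i)\<^sup>2) \<le> G' (x, e)"
      proof (rule G'(2))
        fix i assume "i < n"
        then have "x i \<in> B.Omega" using x by blast
        then obtain l where l: "l \<in> K" "x i \<in> box (al l) (be l)" by (auto simp: B.Omega_def)
        then have "1 - x i \<in> box (1 - be l) (1 - al l)" by (simp add: mem_box_cart)
        then show "1 - fst (x, e) i \<in> B'.Omega" using l by (auto simp: B'.Omega_def)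
      next
        fix i j assume ij: "i < n" "j < n" "1 - fst (x, e) i \<le> 1 - fst (x, e) j"
          "- f (1 - (1 - fst (x, e) i)) = - f (1 - (1 - fst (x, e) j))"
        then have "g (x j) \<le> g (x i)" using gm x by (auto simp: less_eq_vec_def)
        then show "u' i \<le> u' j" using ij by (auto simp: u'_def)
      qed (auto simp: u'_def)
      moreover have "2 * (\<Sum>i<n. e i * (g (x i) - f (x i))) - (\<Sum>i<n. (g (x i) - f (x i))\<^sup>2)
        = (2 * (\<Sum>i<n. 1 * snd (x, e) i * u i) - (\<Sum>i<n. (u i)\<^sup>2))
          + (2 * (\<Sum>i<n. - 1 * snd (x, e) i * u' i) - (\<Sum>i<n. (u' i)\<^sup>2))"
      proof -
        have "2 * (e i * (g (x i) - f (x i))) - (g (x i) - f (x i))\<^sup>2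
          = (2 * (1 * snd (x, e) i * u i) - (u i)\<^sup>2) + (2 * (- 1 * snd (x, e) i * u' i) - (u' i)\<^sup>2)" for i
          by (cases "f (x i) \<le> g (x i)") (auto simp: u_def u'_def max_def algebra_simps power2_eq_square)
        then have "(\<Sum>i<n. 2 * (e i * (g (x i) - f (x i))) - (g (x i) - f (x i))\<^sup>2)
          = (\<Sum>i<n. (2 * (1 * snd (x, e) i * u i) - (u i)\<^sup>2) + (2 * (- 1 * snd (x, e) i * u' i) - (u' i)\<^sup>2))"
          by (intro sum.cong) auto
        then show ?thesis by (simp only: sum.distrib sum_subtractf sum_distrib_left[symmetric])
      qed
      ultimately show ?thesis by linarith
    qed
    ultimately show ?thesis by (intro exI[of _ "\<lambda>\<omega>. G \<omega> + G' \<omega>"]) auto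
  next
    case False
    \<comment> \<open>With more pieces than observations the rate per observation is at least 1, and
      completing the square bounds the gap by the squared noise alone.\<close>
    define G where "G \<omega> = (\<Sum>i<n. (snd \<omega> i)\<^sup>2)" for \<omega> :: "(nat \<Rightarrow> real ^ 'd) \<times> (nat \<Rightarrow> real)"
    have "D.mean_le G (real n * (8 * D.mass UNIV))"
    proof -
      have "{i. i < n} = {..<n}" by auto
      then show ?thesis using D.mean_rest[of UNIV] by (simp add: G_def[abs_def])
    qed
    then have "D.mean_le G (risk_const ?d m0 M0 * rate)"
    proof (rule D.mean_le_mono)
      have "1 \<le> (real k / real n) powr (2 / real ?d)" by (rule ge_one_powr_ge_zero) (use False n in auto)
      moreover have "1 \<le> L powr (2 * gamma_exponent ?d)"
        using power_le_rate[OF d L1] one_le_power[OF L1, of "?d + 5"] by linarith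
      ultimately have "real n * 1 * 1 \<le> rate" unfolding rate_def by (intro mult_mono) auto
      then have "real n \<le> rate" by simp
      moreover have "real n * (8 * D.mass UNIV) \<le> real n * (8 * 1)"
        using D.mass_bounds(2)[of UNIV] by (intro mult_left_mono) auto
      moreover have "8 * rate \<le> risk_const ?d m0 M0 * rate"
        unfolding risk_const_def gc_def[symmetric] using gc by (intro mult_right_mono) (auto simp: rate_def)
      ultimately show "real n * (8 * D.mass UNIV) \<le> risk_const ?d m0 M0 * rate" by linarith
    qed
    moreover have "2 * (\<Sum>i<n. e i * (g (x i) - f (x i))) - (\<Sum>i<n. (g (x i) - f (x i))\<^sup>2) \<le> G (x, e)" for x e g
    proof -
      have "2 * (e i * (g (x i) - f (x i))) - (g (x i) - f (x i))\<^sup>2 \<le> (e i)\<^sup>2" for i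
      proof -
        have "0 \<le> (e i - (g (x i) - f (x i)))\<^sup>2" by simp
        then show ?thesis by (simp add: power2_eq_square algebra_simps)
      qed
      then have "(\<Sum>i<n. 2 * (e i * (g (x i) - f (x i))) - (g (x i) - f (x i))\<^sup>2) \<le> (\<Sum>i<n. (e i)\<^sup>2)"
        by (intro sum_mono) auto
      then show ?thesis by (simp add: G_def sum_subtractf sum_distrib_left)
    qed
    ultimately show ?thesis by (intro exI[of _ G]) auto
  qed
  then obtain G where G: "D.mean_le G (risk_const ?d m0 M0 * rate)" "\<And>x e g. (\<forall>i<n. x i \<in> B.Omega) \<Longrightarrow> g \<in> isotonic \<Longrightarrow>
      2 * (\<Sum>i<n. e i * (g (x i) - f (x i))) - (\<Sum>i<n. (g (x i) - f (x i))\<^sup>2) \<le> G (x, e)" by blast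
  show thesis
    by (rule that[of G B.Omega ft]) (use G null ftm in \<open>auto simp: rate_def L_def r_def ft_def\<close>)
qed

lemma risk_le:
  fixes P :: "(real ^ 'd::finite) measure" and n k :: nat
  assumes d: "2 \<le> CARD('d)" and P: "cube_density P p0" and bounds: "\<forall>x\<in>unit_cube. m0 \<le> p0 x \<and> p0 x \<le> M0"
    and m0: "0 < m0" and k: "1 \<le> k" and n: "1 \<le> n" and f: "f \<in> isotonic_pieces k"
    and f0: "f0 \<in> borel_measurable (restrict_space borel unit_cube)"
    and lse: "least_squares_estimator n fhat"
  shows "risk P n fhat f0 \<le> L2_norm_sq P (\<lambda>x. f x - f0 x)
    + ennreal (risk_const CARD('d) m0 M0 * (real k / real n) powr (2 / real CARD('d))
       * log_plus (real n / real k) powr (2 * gamma_exponent CARD('d)))"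
proof -
  have "prob_space P" using P unfolding cube_density_def by blast
  then interpret D: design P n by (rule design.intro)
  define rate where "rate = (real k / real n) powr (2 / real CARD('d)) * log_plus (real n / real k) powr (2 * gamma_exponent CARD('d))"
  obtain G Om ft where G': "D.mean_le G (risk_const CARD('d) m0 M0 * (real n * (real k / real n) powr (2 / real CARD('d))
       * log_plus (real n / real k) powr (2 * gamma_exponent CARD('d))))"
    and Om: "Om \<in> sets borel" "unit_cube - Om \<in> null_sets lborel"
    and ft: "ft \<in> borel_measurable borel" "\<And>x. x \<in> Om \<Longrightarrow> ft x = f x"
    and gap: "\<And>x e g. (\<And>i. i < n \<Longrightarrow> x i \<in> Om) \<Longrightarrow> g \<in> isotonic \<Longrightarrow>
      2 * (\<Sum>i<n. e i * (g (x i) - f (x i))) - (\<Sum>i<n. (g (x i) - f (x i))\<^sup>2) \<le> G (x, e)"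
    by (rule isotonic_pieces_gap[OF d P bounds m0 k n f], rule that, assumption+) blast
  have G: "D.mean_le G (risk_const CARD('d) m0 M0 * (real n * rate))"
    using G' by (simp only: rate_def mult.assoc)
  have fiso: "f \<in> isotonic" using f by (simp add: isotonic_pieces_def)
  have sp: "space P = unit_cube" and se: "sets P = sets (restrict_space borel unit_cube)"
    by (rule P_space[OF P bounds m0], rule P_sets[OF P bounds m0])
  have bm: "h \<in> borel_measurable P" if "h \<in> borel_measurable (restrict_space borel unit_cube)" for h :: "real ^ 'd \<Rightarrow> real"
    using that measurable_cong_sets[OF se refl] by blast
  define q where "q x = ennreal ((ft x - f0 x)\<^sup>2)" for x
  have qm: "q \<in> borel_measurable P"
  proof -
    have "ft \<in> borel_measurable P" by (rule bm) (rule measurable_restrict_space1[OF ft(1)])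
    moreover have "f0 \<in> borel_measurable P" by (rule bm) (rule f0)
    ultimately show ?thesis unfolding q_def by measurable
  qed
  have nullP: "emeasure P (unit_cube - Om) = 0"
  proof -
    have "emeasure P (unit_cube - Om) \<le> ennreal M0 * emeasure lborel (unit_cube - Om)"
      by (rule emeasure_P_le[OF P bounds m0]) (use Om in auto)
    then show ?thesis by (simp add: null_setsD1[OF Om(2)])
  qed
  have OmP: "unit_cube - Om \<in> sets P"
    unfolding se using Om by (auto simp: sets_restrict_space image_iff intro!: bexI[of _ "unit_cube - Om"])
  have AEP: "AE x in P. x \<in> Om"
    by (rule AE_I[of _ _ "unit_cube - Om"]) (use nullP OmP in \<open>auto simp: sp\<close>)
  have AE1: "AE \<omega> in D.law. fst \<omega> i \<in> Om" if i: "i < n" for i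
  proof -
    define g where "g = (indicator (unit_cube - Om) :: real ^ 'd \<Rightarrow> ennreal)"
    have g: "g \<in> borel_measurable P" unfolding g_def using OmP by simp
    have "(\<integral>\<^sup>+\<omega>. g (fst \<omega> i) \<partial>D.law) = 0"
      unfolding D.nn_integral_sample_single(2)[OF i g] unfolding g_def using OmP nullP by simp
    then have "AE \<omega> in D.law. g (fst \<omega> i) = 0"
      using nn_integral_0_iff_AE[OF D.nn_integral_sample_single(1)[OF i g]] by simp
    then show ?thesis using AE_space
    proof eventually_elim
      case (elim \<omega>)
      have "fst \<omega> i \<in> unit_cube"
        using D.sample_in_space[OF elim(2) i] by (simp only: sp)
      then show ?case using elim(1) by (auto simp: g_def indicator_def split: if_splits)
    qed
  qed
  have AEall: "AE \<omega> in D.law. \<forall>i<n. fst \<omega> i \<in> Om"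
    using AE1 by (simp add: AE_all_countable)
  have Gm: "(\<lambda>\<omega>. ennreal (G \<omega>)) \<in> borel_measurable D.law" and G0: "\<And>\<omega>. 0 \<le> G \<omega>"
    and Gv: "(\<integral>\<^sup>+\<omega>. ennreal (G \<omega>) \<partial>D.law) \<le> ennreal (risk_const CARD('d) m0 M0 * (real n * rate))"
    using G by (auto simp: D.mean_le_def)
  let ?c = "ennreal (1 / real n)"
  have "risk P n fhat f0 \<le> (\<integral>\<^sup>+\<omega>. (\<Sum>i<n. ?c * q (fst \<omega> i)) + ?c * ennreal (G \<omega>) \<partial>D.law)"
    unfolding risk_def
  proof (rule nn_integral_mono_AE)
    show "AE \<omega> in D.law. (case \<omega> of (x, e) \<Rightarrow> let y = \<lambda>i. f0 (x i) + e i in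
        ennreal ((\<Sum>i<n. (fhat x y (x i) - f0 (x i))\<^sup>2) / real n))
      \<le> (\<Sum>i<n. ?c * q (fst \<omega> i)) + ?c * ennreal (G \<omega>)"
      using AEall AE_space
    proof eventually_elim
      case (elim \<omega>)
      obtain x e where \<omega>: "\<omega> = (x, e)" by (cases \<omega>)
      have xc: "x i \<in> unit_cube" if "i < n" for i
        using D.sample_in_space[OF elim(2) that] by (simp only: \<omega> fst_conv sp)
      have xO: "x i \<in> Om" if "i < n" for i using elim(1) that by (simp add: \<omega>)
      define y where "y = (\<lambda>i. f0 (x i) + e i)"
      note basic = least_squares_basic_inequality[OF lse xc fiso y_def]
      have "2 * (\<Sum>i<n. e i * (fhat x y (x i) - f (x i))) - (\<Sum>i<n. (fhat x y (x i) - f (x i))\<^sup>2) \<le> G (x, e)"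
        by (rule gap[OF xO basic(1)])
      with basic(2) have "(\<Sum>i<n. (fhat x y (x i) - f0 (x i))\<^sup>2) \<le> (\<Sum>i<n. (f (x i) - f0 (x i))\<^sup>2) + G (x, e)"
        by linarith
      also have "(\<Sum>i<n. (f (x i) - f0 (x i))\<^sup>2) = (\<Sum>i<n. (ft (x i) - f0 (x i))\<^sup>2)"
        by (intro sum.cong refl) (use ft(2) xO in auto)
      finally have "(\<Sum>i<n. (fhat x y (x i) - f0 (x i))\<^sup>2) / real n
        \<le> ((\<Sum>i<n. (ft (x i) - f0 (x i))\<^sup>2) + G (x, e)) / real n"
        by (rule divide_right_mono) simp
      also have "\<dots> = (\<Sum>i<n. 1 / real n * (ft (x i) - f0 (x i))\<^sup>2) + 1 / real n * G (x, e)"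
        by (simp add: add_divide_distrib sum_divide_distrib)
      finally have "ennreal ((\<Sum>i<n. (fhat x y (x i) - f0 (x i))\<^sup>2) / real n)
        \<le> ennreal ((\<Sum>i<n. 1 / real n * (ft (x i) - f0 (x i))\<^sup>2) + 1 / real n * G (x, e))"
        by (rule ennreal_leI)
      also have "\<dots> = (\<Sum>i<n. ?c * q (x i)) + ?c * ennreal (G (x, e))"
      proof -
        have "(\<Sum>i<n. ?c * q (x i)) = (\<Sum>i<n. ennreal (1 / real n * (ft (x i) - f0 (x i))\<^sup>2))"
          unfolding q_def by (intro sum.cong refl ennreal_mult'[symmetric]) simp
        also have "\<dots> = ennreal (\<Sum>i<n. 1 / real n * (ft (x i) - f0 (x i))\<^sup>2)"
          by (rule sum_ennreal) simp
        finally have "ennreal (\<Sum>i<n. 1 / real n * (ft (x i) - f0 (x i))\<^sup>2) = (\<Sum>i<n. ?c * q (x i))" ..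
        moreover have "ennreal (1 / real n * G (x, e)) = ?c * ennreal (G (x, e))"
          by (rule ennreal_mult') simp
        moreover have "0 \<le> (\<Sum>i<n. 1 / real n * (ft (x i) - f0 (x i))\<^sup>2)" by (intro sum_nonneg) simp
        moreover have "0 \<le> 1 / real n * G (x, e)" using G0 by simp
        ultimately show ?thesis by (simp only: ennreal_plus)
      qed
      finally show ?case by (simp add: \<omega> y_def Let_def)
    qed
  qed
  also have "\<dots> = (\<Sum>i<n. \<integral>\<^sup>+\<omega>. ?c * q (fst \<omega> i) \<partial>D.law) + (\<integral>\<^sup>+\<omega>. ?c * ennreal (G \<omega>) \<partial>D.law)"
    using D.nn_integral_sample_single(1)[OF _ qm] Gm
    by (subst nn_integral_add) (auto intro!: nn_integral_sum)
  also have "(\<Sum>i<n. \<integral>\<^sup>+\<omega>. ?c * q (fst \<omega> i) \<partial>D.law) = (\<Sum>i<n. ?c * (\<integral>\<^sup>+x. q x \<partial>P))"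
    using D.nn_integral_sample_single[OF _ qm] by (intro sum.cong refl) (simp add: nn_integral_cmult)
  also have "\<dots> = (\<integral>\<^sup>+x. q x \<partial>P)"
  proof -
    have "of_nat n * ?c = 1"
      using n by (simp add: ennreal_of_nat_eq_real_of_nat ennreal_mult[symmetric])
    then show ?thesis by (simp add: mult.assoc[symmetric])
  qed
  also have "\<dots> = L2_norm_sq P (\<lambda>x. f x - f0 x)"
    unfolding L2_norm_sq_def q_def
    by (rule nn_integral_cong_AE) (use AEP ft(2) in \<open>auto elim!: eventually_mono\<close>)
  also have "(\<integral>\<^sup>+\<omega>. ?c * ennreal (G \<omega>) \<partial>D.law) \<le> ?c * ennreal (risk_const CARD('d) m0 M0 * (real n * rate))"
    using Gv Gm by (simp add: nn_integral_cmult mult_left_mono)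
  also have "?c * ennreal (risk_const CARD('d) m0 M0 * (real n * rate)) = ennreal (risk_const CARD('d) m0 M0 * rate)"
    using n by (simp add: ennreal_mult'[symmetric])
  finally show ?thesis by (simp add: rate_def mult.assoc add_left_mono)
qed

theorem theorem5:
  fixes m0 M0 :: real
  assumes "CARD('d::finite) \<ge> 2" and "0 < m0" and "m0 \<le> M0"
  shows "\<exists>C>0. \<forall>n\<ge>2. \<forall>(P :: (real ^ 'd) measure) p0 f0 fhat.
    cube_density P p0 \<and> (\<forall>x\<in>unit_cube. m0 \<le> p0 x \<and> p0 x \<le> M0) \<and>
    f0 \<in> borel_measurable (restrict_space borel unit_cube) \<and>
    least_squares_estimator n fhat \<longrightarrow>
    risk P n fhat f0 \<le>
      (INF k\<in>{1..}. (INF f\<in>isotonic_pieces k. L2_norm_sq P (\<lambda>x. f x - f0 x)) +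
         ennreal (C * (real k / real n) powr (2 / real CARD('d))
                    * log_plus (real n / real k) powr (2 * gamma_exponent CARD('d))))"
proof (intro exI[of _ "risk_const CARD('d) m0 M0"] conjI allI impI)
  show "0 < risk_const CARD('d) m0 M0"
    unfolding risk_const_def using gap_const_nonneg[of "CARD('d)" m0 M0] assms by simp
next
  fix n :: nat and P :: "(real ^ 'd) measure" and p0 f0 :: "real ^ 'd \<Rightarrow> real" and fhat :: "'d estimator"
  assume n: "2 \<le> n" and A: "cube_density P p0 \<and> (\<forall>x\<in>unit_cube. m0 \<le> p0 x \<and> p0 x \<le> M0) \<and>
    f0 \<in> borel_measurable (restrict_space borel unit_cube) \<and> least_squares_estimator n fhat"
  show "risk P n fhat f0 \<le>
      (INF k\<in>{1..}. (INF f\<in>isotonic_pieces k. L2_norm_sq P (\<lambda>x. f x - f0 x)) +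
         ennreal (risk_const CARD('d) m0 M0 * (real k / real n) powr (2 / real CARD('d))
                    * log_plus (real n / real k) powr (2 * gamma_exponent CARD('d))))"
  proof (rule INF_greatest)
    fix k :: nat assume k: "k \<in> {1..}"
    let ?c = "ennreal (risk_const CARD('d) m0 M0 * (real k / real n) powr (2 / real CARD('d))
                    * log_plus (real n / real k) powr (2 * gamma_exponent CARD('d)))"
    \<comment> \<open>The finite constant is moved to the left, so that the inner infimum stands
      alone and can be treated by \<open>INF_greatest\<close>.\<close>
    have "risk P n fhat f0 - ?c \<le> (INF f\<in>isotonic_pieces k. L2_norm_sq P (\<lambda>x. f x - f0 x))"
    proof (rule INF_greatest)
      fix f :: "real ^ 'd \<Rightarrow> real" assume "f \<in> isotonic_pieces k"
      then have "risk P n fhat f0 \<le> L2_norm_sq P (\<lambda>x. f x - f0 x) + ?c"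
        by (intro risk_le) (use A k n assms in auto)
      then show "risk P n fhat f0 - ?c \<le> L2_norm_sq P (\<lambda>x. f x - f0 x)"
        by (simp add: ennreal_minus_le_iff add.commute)
    qed
    then show "risk P n fhat f0 \<le> (INF f\<in>isotonic_pieces k. L2_norm_sq P (\<lambda>x. f x - f0 x)) + ?c"
      by (simp add: ennreal_minus_le_iff add.commute)
  qed
qed

end
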